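(* Let $d\ge1$ be an integer and set $\nu=d/2-1$. For $t\in\mathbb{R}$ let $\mathcal{L}^t$ be the linear operator on $L^2\big(\mathbb{R}_+,\frac{x^\nu e^{-x}}{\Gamma(\nu+1)}\mathrm{d}x\big)$ determined by $$\mathcal{L}^t:L_n^{(\nu)}(x)\mapsto e^{2\pi n i t}L_n^{(\nu)}\big(\tfrac{2}{p}x\big),\qquad n\ge0.$$ Let $2\le p,q<\infty$ satisfy $\frac{d}{p}+\frac{2}{q}=\frac{d}{2}$, let $f\in L^2(\mathbb{R}^d,\mathrm{d}\boldsymbol x)$ be a radial function with expansion $f(\boldsymbol x)=\sum_{n\ge0}\alpha(n)\Psi_n(\boldsymbol x)$, and put $g(x)=\sum_{n\ge0}\alpha(n)L_n^{(\nu)}(x)$. Then $$\frac{\big\|\,\|e^{it\Delta}f(\boldsymbol x)\|_{L^p(\mathrm{d}\boldsymbol x)}\big\|_{L^q(\mathrm{d}t)}}{(p^{-1/2p}\,2^{1/p-1/2})^d}=\left(\int_{-1/2}^{1/2}\bigg(\int_0^\infty|\mathcal{L}^tg(x)|^p\,\frac{e^{-x}x^\nu}{\Gamma(\nu+1)}\,\mathrm{d}x\bigg)^{q/p}\mathrm{d}t\right)^{1/q}$$ and $$\frac{C(p,d)}{(p^{-1/2p}\,2^{1/p-1/2})^d}\,\|f\|_{L^2(\mathrm{d}\boldsymbol x)}=\bigg(\int_0^\infty|g(x)|^2\,\frac{e^{-x}x^\nu}{\Gamma(\nu+1)}\,\mathrm{d}x\bigg)^{1/2}.$$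
   Context: The exponent $p^{-1/2p}$ means $p^{-1/(2p)}$. Functions are complex valued. $e^{it\Delta}f(\boldsymbol x)$ is the solution of $\partial_t u=i\Delta u$ on $\mathbb{R}^d\times\mathbb{R}$ with $u(\boldsymbol x,0)=f(\boldsymbol x)$; the $L^q(\mathrm{d}t)$ norm is over $t\in\mathbb{R}$. $C(p,d)=\big(p^{-1/2p}\,2^{1/p-1/4}\big)^d$. For $\nu>-1$, $L_n^{(\nu)}$ are the (standard) generalized Laguerre polynomials: the orthogonal polynomials for $e^{-x}x^\nu\mathrm{d}x$ on $(0,\infty)$ with $\int_0^\infty|L_n^{(\nu)}(x)|^2e^{-x}x^\nu\mathrm{d}x=\Gamma(n+\nu+1)/n!$ (and leading coefficient of sign $(-1)^n$). They form an orthogonal basis of $L^2(\mathbb{R}_+,e^{-x}x^\nu\mathrm{d}x)$, $\mathbb{R}_+=(0,\infty)$; $\mathcal{L}^t$ is extended linearly and continuously. With $\nu=d/2-1$, the functions $\Psi_n(\boldsymbol x)=L_n^{(\nu)}(2\pi\|\boldsymbol x\|^2)e^{-\pi\|\boldsymbol x\|^2}$ form an orthogonal basis of the space of radial functions in $L^2(\mathbb{R}^d,\mathrm{d}\boldsymbol x)$. *)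

theory Defs
  imports "HOL-Analysis.Analysis" "HOL-Computational_Algebra.Polynomial"
begin

text \<open>
  Norms take values in \<^typ>\<open>ennreal\<close>, so no finiteness is presupposed. The power is only used
  with exponents \<open>a > 0\<close>, for which \<open>\<infinity> powr a = \<infinity>\<close>.
\<close>

definition enn_powr :: "ennreal \<Rightarrow> real \<Rightarrow> ennreal" where
  "enn_powr x a = (if x = top then top else ennreal (enn2real x powr a))"

definition Lp_enorm :: "'a measure \<Rightarrow> real \<Rightarrow> ('a \<Rightarrow> ennreal) \<Rightarrow> ennreal" where
  "Lp_enorm M p F = enn_powr (\<integral>\<^sup>+x. enn_powr (F x) p \<partial>M) (1 / p)"

definition Lp_norm :: "'a measure \<Rightarrow> real \<Rightarrow> ('a \<Rightarrow> complex) \<Rightarrow> ennreal" where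
  "Lp_norm M p f = Lp_enorm M p (\<lambda>x. ennreal (cmod (f x)))"

text \<open>Elements of \<open>L\<^sup>2\<close> are represented by functions; equality in \<open>L\<^sup>2\<close> is equality almost everywhere.\<close>

definition L2 :: "'a measure \<Rightarrow> ('a \<Rightarrow> complex) set" where
  "L2 M = {f \<in> borel_measurable M. Lp_norm M 2 f < top}"

definition has_L2_sum :: "'a measure \<Rightarrow> (nat \<Rightarrow> 'a \<Rightarrow> complex) \<Rightarrow> ('a \<Rightarrow> complex) \<Rightarrow> bool" where
  "has_L2_sum M \<phi> h \<longleftrightarrow>
     h \<in> L2 M \<and> (\<lambda>N. Lp_norm M 2 (\<lambda>x. (\<Sum>n<N. \<phi> n x) - h x)) \<longlonglongrightarrow> 0"

definition L2_suminf :: "'a measure \<Rightarrow> (nat \<Rightarrow> 'a \<Rightarrow> complex) \<Rightarrow> 'a \<Rightarrow> complex" where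
  "L2_suminf M \<phi> = (SOME h. has_L2_sum M \<phi> h)"

definition bounded_L2_operator :: "'a measure \<Rightarrow> (('a \<Rightarrow> complex) \<Rightarrow> ('a \<Rightarrow> complex)) \<Rightarrow> bool" where
  "bounded_L2_operator M T \<longleftrightarrow>
     (\<forall>h\<in>L2 M. T h \<in> L2 M) \<and>
     (\<forall>h\<in>L2 M. \<forall>k\<in>L2 M. \<forall>a b.
        AE x in M. T (\<lambda>y. a * h y + b * k y) x = a * T h x + b * T k x) \<and>
     (\<exists>C::real. \<forall>h\<in>L2 M. Lp_norm M 2 (T h) \<le> ennreal C * Lp_norm M 2 h)"


definition is_laguerre :: "real \<Rightarrow> (nat \<Rightarrow> real poly) \<Rightarrow> bool" where
  "is_laguerre \<nu> L \<longleftrightarrow>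
     (\<forall>n. degree (L n) = n \<and> (-1) ^ n * lead_coeff (L n) > 0) \<and>
     (\<forall>m n. (LINT x:{0<..}|lborel. poly (L m) x * poly (L n) x * (exp (-x) * x powr \<nu>)) =
              (if m = n then Gamma (real n + \<nu> + 1) / fact n else 0))"

text \<open>The conditions in \<^const>\<open>is_laguerre\<close> determine the family uniquely for \<open>\<nu> > -1\<close>.\<close>

definition laguerre :: "real \<Rightarrow> nat \<Rightarrow> real poly" where
  "laguerre \<nu> = (THE L. is_laguerre \<nu> L)"

definition laguerre_measure :: "real \<Rightarrow> real measure" where
  "laguerre_measure \<nu> =
     density lborel (\<lambda>x. ennreal (indicator {0<..} x * (exp (-x) * x powr \<nu> / Gamma (\<nu> + 1))))"

definition is_laguerre_operator ::
    "real \<Rightarrow> real \<Rightarrow> real \<Rightarrow> ((real \<Rightarrow> complex) \<Rightarrow> (real \<Rightarrow> complex)) \<Rightarrow> bool" where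
  "is_laguerre_operator p \<nu> t T \<longleftrightarrow>
     bounded_L2_operator (laguerre_measure \<nu>) T \<and>
     (\<forall>n. AE x in laguerre_measure \<nu>.
        T (\<lambda>y. of_real (poly (laguerre \<nu> n) y)) x =
        exp (2 * of_real pi * of_nat n * \<i> * of_real t) * of_real (poly (laguerre \<nu> n) (2 / p * x)))"

text \<open>
  For \<open>p \<ge> 2\<close> and \<open>\<nu> > -1\<close> such an operator exists, and it is unique up to equality almost
  everywhere because the Laguerre polynomials span a dense subspace.
\<close>

definition laguerre_operator ::
    "real \<Rightarrow> real \<Rightarrow> real \<Rightarrow> (real \<Rightarrow> complex) \<Rightarrow> (real \<Rightarrow> complex)" where
  "laguerre_operator p \<nu> t = (SOME T. is_laguerre_operator p \<nu> t T)"

definition radial_basis :: "nat \<Rightarrow> 'a::euclidean_space \<Rightarrow> complex" where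
  "radial_basis n x =
     of_real (poly (laguerre (real DIM('a) / 2 - 1) n) (2 * pi * (norm x)\<^sup>2) * exp (- pi * (norm x)\<^sup>2))"

definition radial :: "('a::euclidean_space \<Rightarrow> complex) \<Rightarrow> bool" where
  "radial f \<longleftrightarrow> (\<exists>h. AE x in lborel. f x = h (norm x))"


definition partial_deriv :: "'a::euclidean_space \<Rightarrow> ('a \<Rightarrow> complex) \<Rightarrow> 'a \<Rightarrow> complex" where
  "partial_deriv b \<phi> x = frechet_derivative \<phi> (at x) b"

definition laplacian :: "('a::euclidean_space \<Rightarrow> complex) \<Rightarrow> 'a \<Rightarrow> complex" where
  "laplacian \<phi> x = (\<Sum>b\<in>Basis. partial_deriv b (partial_deriv b \<phi>) x)"

definition test_function :: "('a::euclidean_space \<Rightarrow> complex) \<Rightarrow> bool" where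
  "test_function \<phi> \<longleftrightarrow>
     bounded {x. \<phi> x \<noteq> 0} \<and>
     \<phi> differentiable_on UNIV \<and>
     (\<forall>b\<in>Basis. partial_deriv b \<phi> differentiable_on UNIV) \<and>
     (\<forall>b\<in>Basis. \<forall>c\<in>Basis. continuous_on UNIV (partial_deriv c (partial_deriv b \<phi>)))"

text \<open>
  For \<open>f \<in> L\<^sup>2\<close> the equation \<open>\<partial>\<^sub>t u = i \<Delta> u\<close>, \<open>u(0) = f\<close> is understood in the usual sense: \<open>u\<close> is a
  continuous curve in \<open>L\<^sup>2\<close> which solves the equation weakly in space. Testing against \<open>C\<^sup>2\<close> functions
  of compact support is equivalent to testing against \<open>C\<^sup>\<infinity>\<close> ones, by mollification. The pairing is
  bilinear (no conjugate).
\<close>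

definition is_schroedinger_solution ::
    "('a::euclidean_space \<Rightarrow> complex) \<Rightarrow> (real \<Rightarrow> 'a \<Rightarrow> complex) \<Rightarrow> bool" where
  "is_schroedinger_solution f u \<longleftrightarrow>
     (\<forall>t. u t \<in> L2 lborel) \<and>
     (AE x in lborel. u 0 x = f x) \<and>
     (\<forall>t. ((\<lambda>s. Lp_norm lborel 2 (\<lambda>x. u s x - u t x)) \<longlongrightarrow> 0) (at t)) \<and>
     (\<forall>\<phi>. test_function \<phi> \<longrightarrow> (\<forall>t.
        ((\<lambda>s. LINT x|lborel. u s x * \<phi> x) has_vector_derivative
           \<i> * (LINT x|lborel. u t x * laplacian \<phi> x)) (at t)))"

text \<open>
  \<open>schroedinger f t\<close> is \<open>e\<^sup>i\<^sup>t\<^sup>\<Delta> f\<close>. For \<open>f \<in> L\<^sup>2\<close> a solution exists and each \<open>u t\<close> is unique up to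
  equality almost everywhere.
\<close>

definition schroedinger :: "('a::euclidean_space \<Rightarrow> complex) \<Rightarrow> real \<Rightarrow> 'a \<Rightarrow> complex" where
  "schroedinger f = (SOME u. is_schroedinger_solution f u)"

definition strichartz_const :: "real \<Rightarrow> nat \<Rightarrow> real" where
  "strichartz_const p d = (p powr (- (1 / (2 * p))) * 2 powr (1 / p - 1 / 4)) ^ d"

end

theory Submission
  imports Defs
begin

text \<open>
  Write \<open>\<sigma>(t) = 1 + (4 \<pi> t)\<^sup>2\<close>, \<open>s(t) = - arctan (4 \<pi> t) / \<pi>\<close> and
  \<open>G\<^sub>s(y) = \<Sum>\<^sub>n \<alpha>(n) exp (2 \<pi> i n s) L\<^sub>n(y)\<close>. The theorem rests on the formula

    \<open>(exp (i t \<Delta>) f)(x) = (1 + 4 \<pi> i t) powr (- d / 2) * exp (- \<pi> |x|\<^sup>2 / (1 + 4 \<pi> i t)) * G\<^sub>s(2 \<pi> |x|\<^sup>2 / \<sigma>)\<close>,   \<open>s = s(t)\<close>,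

  called the lens transform below: up to a unimodular factor the free flow rotates the \<open>n\<close>-th Laguerre
  coefficient through the angle \<open>2 \<pi> n s\<close> and dilates by \<open>sqrt \<sigma>\<close>. Each term of the sum
  solves the equation because it reduces to the Laguerre differential equation
  (\<open>mode_r_time_derivative\<close>).

  Given the formula, both identities are changes of variables. Under the Gaussian
  \<open>exp (- \<kappa> |x|\<^sup>2)\<close> the quantity \<open>\<kappa> |x|\<^sup>2\<close> has, up to a constant, the Laguerre weight as its law
  (\<open>nn_integral_radial_gaussian\<close>). With \<open>\<kappa> = \<pi> p / \<sigma>\<close> this turns the \<open>p\<close>-th power of the norm
  at time \<open>t\<close> into \<open>p powr (- d / 2) * \<sigma> powr (d / 2 - d p / 4)\<close> times the integral of
  \<open>|G\<^sub>s(2 x / p)|\<^sup>p\<close> against the normalised weight (\<open>nn_integral_lens\<close>), and \<open>x \<mapsto> G\<^sub>s(2 x / p)\<close> is the image of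
  \<open>g\<close> under the Laguerre operator. Raised to the power \<open>q / p\<close>, the power of \<open>\<sigma>\<close> becomes
  \<open>1 / \<sigma>\<close>, which is what the admissibility of \<open>(p, q)\<close> says; and \<open>dt / \<sigma> = ds / 4\<close> up to sign, where
  \<open>s\<close> runs through \<open>(-1/2, 1/2)\<close> (\<open>nn_integral_lens_phase\<close>). The second identity is the case
  \<open>p = 2\<close>, \<open>t = 0\<close>.

  The flow, the function \<open>g\<close>, the Laguerre polynomials and the operator are specified by properties, so each
  must be shown to exist and to be determined by them. For the flow this means weak solutions in \<open>L\<^sup>2\<close>.
  Existence follows from the lens transform, since the partial sums converge uniformly in time
  (\<open>lens_flow_solution\<close>). Uniqueness is a duality argument: pairing a solution with the heat kernel
  at complex time gives a constant (\<open>schroedinger_gaussian_pairing_zero\<close>), and the pairings with all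
  Gaussians determine a function (\<open>AE_zero_of_gaussian_averages\<close>). The Laguerre operator is a
  multiplier of modulus one followed by a bounded dilation (\<open>is_laguerre_operator_exists\<close>), and continuity
  determines its values on Laguerre series (\<open>is_laguerre_operator_apply\<close>).
\<close>

section \<open>Square-integrable functions\<close>

text \<open>
  Squared norms are easier to handle than norms: they add up for orthogonal sums, and the estimate
  \<open>|a + b|\<^sup>2 \<le> 2 |a|\<^sup>2 + 2 |b|\<^sup>2\<close> replaces the triangle inequality in all limit arguments.
\<close>

definition sqint :: "'a measure \<Rightarrow> ('a \<Rightarrow> complex) \<Rightarrow> ennreal" where
  "sqint M f = (\<integral>\<^sup>+x. ennreal ((cmod (f x))\<^sup>2) \<partial>M)"

lemma enn_powr_ennreal: "0 \<le> x \<Longrightarrow> enn_powr (ennreal x) a = ennreal (x powr a)"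
  by (simp add: enn_powr_def)

lemma enn_powr_top [simp]: "enn_powr top a = top"
  by (simp add: enn_powr_def)

lemma enn_powr_eq_top_iff [simp]: "enn_powr X a = top \<longleftrightarrow> X = top"
  by (simp add: enn_powr_def)

lemma enn_powr_measurable [measurable]: "(\<lambda>X. enn_powr X a) \<in> borel_measurable borel"
  unfolding enn_powr_def by measurable

lemma enn_powr_cmult:
  assumes "0 < c"
  shows "enn_powr (ennreal c * X) a = ennreal (c powr a) * enn_powr X a"
proof (cases X)
  case (real r)
  then show ?thesis
    using assms by (simp add: enn_powr_ennreal powr_mult flip: ennreal_mult)
next
  case top
  then show ?thesis using assms by (simp add: ennreal_mult_top)
qed

lemma enn_powr_enn_powr: "enn_powr (enn_powr X a) b = enn_powr X (a * b)"
  by (cases X) (simp_all add: enn_powr_ennreal powr_powr)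

lemma Lp_norm_2: "Lp_norm M 2 f = enn_powr (sqint M f) (1 / 2)"
  by (simp add: Lp_norm_def Lp_enorm_def sqint_def enn_powr_ennreal)

lemma Lp_norm_2_le_iff:
  assumes "0 \<le> C"
  shows "Lp_norm M 2 f \<le> ennreal C \<longleftrightarrow> sqint M f \<le> ennreal (C\<^sup>2)"
proof (cases "sqint M f")
  case (real r)
  have "r powr (1/2) \<le> C \<longleftrightarrow> r \<le> C\<^sup>2"
    using real assms by (simp add: powr_half_sqrt real_le_lsqrt real_sqrt_le_iff')
  then show ?thesis using real assms by (simp add: Lp_norm_2 enn_powr_ennreal)
next
  case top
  then show ?thesis by (simp add: Lp_norm_2 top_unique)
qed

lemma Lp_norm_2_lt_top_iff: "Lp_norm M 2 f < top \<longleftrightarrow> sqint M f < top"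
  using less_top[of "sqint M f"] less_top[of "Lp_norm M 2 f"] by (simp add: Lp_norm_2)

lemma tendsto_ennreal_0_iff:
  "((f :: 'a \<Rightarrow> ennreal) \<longlongrightarrow> 0) F \<longleftrightarrow> (\<forall>e>0. eventually (\<lambda>x. f x \<le> ennreal e) F)"
proof
  assume "(f \<longlongrightarrow> 0) F"
  then have "eventually (\<lambda>x. f x < ennreal e) F" if "e > 0" for e
    using that by (auto dest: order_tendstoD(2)[of f 0 F "ennreal e"])
  then show "\<forall>e>0. eventually (\<lambda>x. f x \<le> ennreal e) F"
    by (meson eventually_mono less_imp_le)
next
  assume *: "\<forall>e>0. eventually (\<lambda>x. f x \<le> ennreal e) F"
  show "(f \<longlongrightarrow> 0) F"
  proof (rule order_tendstoI)
    fix a :: ennreal assume "0 < a"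
    have "\<exists>e>0. ennreal e < a"
    proof (cases a)
      case (real r)
      then show ?thesis using \<open>0 < a\<close> by (intro exI[of _ "r / 2"]) (auto simp: ennreal_less_iff)
    next
      case top
      then show ?thesis by (intro exI[of _ 1]) auto
    qed
    then obtain e where e: "0 < e" "ennreal e < a" by blast
    then show "eventually (\<lambda>x. f x < a) F"
      using *[rule_format, OF e(1)] by (auto elim!: eventually_mono)
  qed auto
qed

lemma tendsto_ennreal_0_le:
  fixes f g :: "'a \<Rightarrow> ennreal"
  assumes g: "(g \<longlongrightarrow> c) F" and le: "\<And>x. f x \<le> g x" and c: "c = 0"
  shows "(f \<longlongrightarrow> 0) F"
  by (rule tendsto_sandwich[OF _ _ tendsto_const g[unfolded c]]) (simp_all add: le)

lemma tendsto_Lp_norm_2_iff: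
  "((\<lambda>i. Lp_norm M 2 (f i)) \<longlongrightarrow> 0) F \<longleftrightarrow> ((\<lambda>i. sqint M (f i)) \<longlongrightarrow> 0) F"
proof -
  have "(\<forall>e>0. eventually (\<lambda>x. Lp_norm M 2 (f x) \<le> ennreal e) F) \<longleftrightarrow>
        (\<forall>e>0. eventually (\<lambda>x. sqint M (f x) \<le> ennreal e) F)" (is "?A \<longleftrightarrow> ?B")
  proof
    assume A: ?A
    show ?B
    proof (intro allI impI)
      fix e :: real assume "0 < e"
      then have "eventually (\<lambda>x. Lp_norm M 2 (f x) \<le> ennreal (sqrt e)) F"
        using A by auto
      then show "eventually (\<lambda>x. sqint M (f x) \<le> ennreal e) F"
        using \<open>0 < e\<close> by (simp add: Lp_norm_2_le_iff)
    qed
  next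
    assume B: ?B
    then show ?A by (auto simp: Lp_norm_2_le_iff)
  qed
  then show ?thesis by (simp add: tendsto_ennreal_0_iff)
qed

lemma L2_iff: "f \<in> L2 M \<longleftrightarrow> f \<in> borel_measurable M \<and> sqint M f < top"
  by (simp add: L2_def Lp_norm_2_lt_top_iff)

lemma L2_measurable: "f \<in> L2 M \<Longrightarrow> f \<in> borel_measurable M"
  by (simp add: L2_iff)

lemma sqint_cong_AE: "AE x in M. f x = g x \<Longrightarrow> sqint M f = sqint M g"
  unfolding sqint_def by (intro nn_integral_cong_AE) auto

lemma sqint_mono_AE: "AE x in M. cmod (f x) \<le> cmod (g x) \<Longrightarrow> sqint M f \<le> sqint M g"
  unfolding sqint_def by (intro nn_integral_mono_AE) (auto intro!: ennreal_leI power_mono)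

lemma sqint_minus_commute: "sqint M (\<lambda>x. f x - g x) = sqint M (\<lambda>x. g x - f x)"
  by (simp add: sqint_def norm_minus_commute)

lemma sqint_cmult:
  assumes "f \<in> borel_measurable M"
  shows "sqint M (\<lambda>x. a * f x) = ennreal ((cmod a)\<^sup>2) * sqint M f"
  unfolding sqint_def using assms
  by (subst nn_integral_cmult[symmetric]) (auto simp: norm_mult power_mult_distrib ennreal_mult)

lemma sqint_add_le:
  assumes [measurable]: "f \<in> borel_measurable M" "g \<in> borel_measurable M"
  shows "sqint M (\<lambda>x. f x + g x) \<le> 2 * sqint M f + 2 * sqint M g"
proof -
  have "(cmod (a + b))\<^sup>2 \<le> 2 * (cmod a)\<^sup>2 + 2 * (cmod b)\<^sup>2" for a b
  proof -
    have "(cmod (a + b))\<^sup>2 \<le> (cmod a + cmod b)\<^sup>2"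
      by (intro power_mono norm_triangle_ineq) auto
    also have "\<dots> \<le> 2 * (cmod a)\<^sup>2 + 2 * (cmod b)\<^sup>2"
      using zero_le_power2[of "cmod a - cmod b"] by (simp add: power2_eq_square algebra_simps)
    finally show ?thesis .
  qed
  then have "sqint M (\<lambda>x. f x + g x)
      \<le> (\<integral>\<^sup>+x. ennreal (2 * (cmod (f x))\<^sup>2 + 2 * (cmod (g x))\<^sup>2) \<partial>M)"
    unfolding sqint_def by (intro nn_integral_mono ennreal_leI) auto
  also have "\<dots> = (\<integral>\<^sup>+x. 2 * ennreal ((cmod (f x))\<^sup>2) + 2 * ennreal ((cmod (g x))\<^sup>2) \<partial>M)"
    by (intro nn_integral_cong) (simp add: ennreal_plus ennreal_mult)
  also have "\<dots> = 2 * sqint M f + 2 * sqint M g"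
    unfolding sqint_def by (subst nn_integral_add) (auto simp: nn_integral_cmult)
  finally show ?thesis .
qed

lemma sqint_diff_le:
  assumes [measurable]: "f \<in> borel_measurable M" "g \<in> borel_measurable M"
  shows "sqint M (\<lambda>x. f x - g x) \<le> 2 * sqint M f + 2 * sqint M g"
proof -
  have "sqint M (\<lambda>x. - g x) = sqint M g" by (simp add: sqint_def)
  then show ?thesis using sqint_add_le[of f M "\<lambda>x. - g x"] by simp
qed

lemma sqint_triangle_le:
  assumes [measurable]: "f \<in> borel_measurable M" "g \<in> borel_measurable M" "h \<in> borel_measurable M"
  shows "sqint M (\<lambda>x. f x - h x) \<le> 2 * sqint M (\<lambda>x. f x - g x) + 2 * sqint M (\<lambda>x. g x - h x)"
  using sqint_add_le[of "\<lambda>x. f x - g x" M "\<lambda>x. g x - h x"] by simp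

lemma ennreal_2_mult_add_lt_top: "2 * (a::ennreal) + 2 * b < top" if "a < top" "b < top"
  using that by (simp add: ennreal_mult_less_top)

lemma L2_add: "f \<in> L2 M \<Longrightarrow> g \<in> L2 M \<Longrightarrow> (\<lambda>x. f x + g x) \<in> L2 M"
  using sqint_add_le[of f M g] ennreal_2_mult_add_lt_top[of "sqint M f" "sqint M g"]
  by (auto simp: L2_iff intro: le_less_trans)

lemma L2_diff: "f \<in> L2 M \<Longrightarrow> g \<in> L2 M \<Longrightarrow> (\<lambda>x. f x - g x) \<in> L2 M"
  using sqint_diff_le[of f M g] ennreal_2_mult_add_lt_top[of "sqint M f" "sqint M g"]
  by (auto simp: L2_iff intro: le_less_trans)

lemma L2_cmult: "f \<in> L2 M \<Longrightarrow> (\<lambda>x. a * f x) \<in> L2 M"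
  by (auto simp: L2_iff sqint_cmult ennreal_mult_less_top)

lemma L2_zero: "(\<lambda>x. 0) \<in> L2 M"
  by (simp add: L2_iff sqint_def)

lemma L2_sum: "(\<And>i. i \<in> I \<Longrightarrow> f i \<in> L2 M) \<Longrightarrow> (\<lambda>x. \<Sum>i\<in>I. f i x) \<in> L2 M"
  by (induction I rule: infinite_finite_induct) (auto intro!: L2_zero L2_add)

lemma sqint_eq_0_imp_AE:
  assumes [measurable]: "f \<in> borel_measurable M" and "sqint M f = 0"
  shows "AE x in M. f x = 0"
  using assms(2) unfolding sqint_def by (subst (asm) nn_integral_0_iff_AE) auto

lemma integrable_cmod_sq:
  assumes "f \<in> L2 M"
  shows "integrable M (\<lambda>x. (cmod (f x))\<^sup>2)"
  using assms by (intro integrableI_nonneg) (auto simp: L2_iff sqint_def)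

lemma sqint_eq_integral:
  assumes "f \<in> L2 M"
  shows "sqint M f = ennreal (LINT x|M. (cmod (f x))\<^sup>2)"
  unfolding sqint_def using integrable_cmod_sq[OF assms]
  by (subst nn_integral_eq_integral) auto

lemma integrable_L2_mult:
  assumes f: "f \<in> L2 M" and g: "g \<in> L2 M"
  shows "integrable M (\<lambda>x. f x * g x)"
proof (rule Bochner_Integration.integrable_bound)
  show "integrable M (\<lambda>x. (cmod (f x))\<^sup>2 + (cmod (g x))\<^sup>2)"
    using assms by (intro Bochner_Integration.integrable_add integrable_cmod_sq)
  show "(\<lambda>x. f x * g x) \<in> borel_measurable M"
    using assms by (auto simp: L2_iff)
  have "a * b \<le> a\<^sup>2 + b\<^sup>2" if "a \<ge> 0" "b \<ge> 0" for a b :: real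
    using zero_le_power2[of "a - b"] mult_nonneg_nonneg[OF that]
    by (simp add: power2_eq_square algebra_simps)
  then show "AE x in M. norm (f x * g x) \<le> norm ((cmod (f x))\<^sup>2 + (cmod (g x))\<^sup>2)"
    by (auto simp: norm_mult)
qed

text \<open>
  The Cauchy--Schwarz inequality for the bilinear pairing.
\<close>

lemma cmod_integral_mult_le:
  assumes f: "f \<in> borel_measurable M" and g: "g \<in> borel_measurable M"
    and fA: "sqint M f \<le> ennreal (A\<^sup>2)" and gB: "sqint M g \<le> ennreal (B\<^sup>2)"
    and A: "0 \<le> A" and B: "0 \<le> B"
  shows "cmod (LINT x|M. f x * g x) \<le> A * B"
proof -
  note [measurable] = f g
  have L: "f \<in> L2 M" "g \<in> L2 M"
    using assms by (auto simp: L2_iff intro: le_less_trans)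
  have "ennreal (cmod (LINT x|M. f x * g x)) \<le> (\<integral>\<^sup>+x. ennreal (cmod (f x)) * ennreal (cmod (g x)) \<partial>M)"
    using integral_norm_bound_ennreal[OF integrable_L2_mult[OF L]] by (simp add: norm_mult ennreal_mult)
  then have "(ennreal (cmod (LINT x|M. f x * g x)))\<^sup>2 \<le>
      (\<integral>\<^sup>+x. ennreal (cmod (f x)) * ennreal (cmod (g x)) \<partial>M)\<^sup>2"
    by (intro power_mono_ennreal)
  also have "\<dots> \<le> (\<integral>\<^sup>+x. (ennreal (cmod (f x)))\<^sup>2 \<partial>M) * (\<integral>\<^sup>+x. (ennreal (cmod (g x)))\<^sup>2 \<partial>M)"
    by (intro Cauchy_Schwarz_nn_integral) auto
  also have "\<dots> = sqint M f * sqint M g"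
    by (simp add: sqint_def ennreal_power)
  also have "\<dots> \<le> ennreal (A\<^sup>2) * ennreal (B\<^sup>2)"
    by (intro mult_mono fA gB) auto
  finally have "ennreal ((cmod (LINT x|M. f x * g x))\<^sup>2) \<le> ennreal ((A * B)\<^sup>2)"
    by (simp add: ennreal_power power_mult_distrib ennreal_mult)
  then show ?thesis
    using A B by (simp add: abs_le_square_iff[symmetric])
qed

lemma has_L2_sum_unique:
  assumes "has_L2_sum M \<phi> h" "has_L2_sum M \<phi> k" and [measurable]: "\<And>n. \<phi> n \<in> borel_measurable M"
  shows "AE x in M. h x = k x"
proof -
  have [measurable]: "h \<in> borel_measurable M" "k \<in> borel_measurable M"
    using assms by (auto simp: has_L2_sum_def L2_iff)
  have *: "((\<lambda>N. sqint M (\<lambda>x. (\<Sum>n<N. \<phi> n x) - h x)) \<longlongrightarrow> 0) sequentially"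
          "((\<lambda>N. sqint M (\<lambda>x. (\<Sum>n<N. \<phi> n x) - k x)) \<longlongrightarrow> 0) sequentially"
    using assms by (auto simp: has_L2_sum_def tendsto_Lp_norm_2_iff)
  have "((\<lambda>N. 2 * sqint M (\<lambda>x. (\<Sum>n<N. \<phi> n x) - h x) + 2 * sqint M (\<lambda>x. (\<Sum>n<N. \<phi> n x) - k x)) \<longlongrightarrow> 2 * 0 + 2 * 0) sequentially"
    by (intro tendsto_add tendsto_mult_ennreal * tendsto_const) auto
  moreover have "sqint M (\<lambda>x. h x - k x) \<le>
     2 * sqint M (\<lambda>x. (\<Sum>n<N. \<phi> n x) - h x) + 2 * sqint M (\<lambda>x. (\<Sum>n<N. \<phi> n x) - k x)" for N
    using sqint_triangle_le[of h M "\<lambda>x. (\<Sum>n<N. \<phi> n x)" k]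
    by (subst sqint_minus_commute[of M "\<lambda>x. (\<Sum>n<N. \<phi> n x)" h]) simp
  ultimately have "sqint M (\<lambda>x. h x - k x) \<le> 0"
    by (intro tendsto_lowerbound[of _ "0::ennreal" sequentially]) auto
  then show ?thesis
    using sqint_eq_0_imp_AE[of "\<lambda>x. h x - k x" M] by simp
qed

text \<open>
  The squared increments remain summable in the mean after multiplication by \<open>2\<^sup>k\<close>. Almost
  everywhere they are therefore at most a constant times \<open>2 powr - k\<close>, and the telescoping series converges
  absolutely.
\<close>

lemma AE_convergent_of_sqint_steps:
  assumes [measurable]: "\<And>k. f k \<in> borel_measurable M"
    and step: "\<And>k. sqint M (\<lambda>x. f (Suc k) x - f k x) \<le> ennreal ((1/4) ^ k)"
  shows "AE x in M. convergent (\<lambda>k. f k x)"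
proof -
  define G where "G x = (\<Sum>k. ennreal (2 ^ k * (cmod (f (Suc k) x - f k x))\<^sup>2))" for x
  have "(\<integral>\<^sup>+x. G x \<partial>M) = (\<Sum>k. \<integral>\<^sup>+x. ennreal (2 ^ k * (cmod (f (Suc k) x - f k x))\<^sup>2) \<partial>M)"
    unfolding G_def by (intro nn_integral_suminf) auto
  also have "\<dots> = (\<Sum>k. ennreal (2 ^ k) * sqint M (\<lambda>x. f (Suc k) x - f k x))"
    unfolding sqint_def by (intro arg_cong[where f=suminf] ext) (simp add: nn_integral_cmult ennreal_mult)
  also have "\<dots> \<le> (\<Sum>k. ennreal ((1/2) ^ k))"
  proof (intro suminf_le summableI)
    fix k :: nat
    have "ennreal (2 ^ k) * sqint M (\<lambda>x. f (Suc k) x - f k x) \<le> ennreal (2 ^ k) * ennreal ((1/4) ^ k)"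
      by (intro mult_left_mono step) auto
    also have "\<dots> = ennreal ((1/2) ^ k)"
      by (subst ennreal_mult[symmetric]) (auto simp flip: power_mult_distrib)
    finally show "ennreal (2 ^ k) * sqint M (\<lambda>x. f (Suc k) x - f k x) \<le> ennreal ((1/2) ^ k)" .
  qed
  also have "\<dots> = ennreal (\<Sum>k. (1/2) ^ k)"
    by (intro suminf_ennreal2 summable_geometric) auto
  also have "\<dots> < \<infinity>" by simp
  finally have "(\<integral>\<^sup>+x. G x \<partial>M) \<noteq> \<infinity>" by simp
  then have "AE x in M. G x \<noteq> \<infinity>"
    by (intro nn_integral_noteq_infinite) (auto simp: G_def)
  then show ?thesis
  proof eventually_elim
    case (elim x)
    then obtain C where C: "G x = ennreal C" "0 \<le> C"
      by (cases "G x") auto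
    have bound: "norm (f (Suc k) x - f k x) \<le> sqrt C * (sqrt (1/2)) ^ k" for k
    proof -
      define F where "F j = ennreal (2 ^ j * (cmod (f (Suc j) x - f j x))\<^sup>2)" for j
      have "sum F {k} \<le> suminf F"
        by (intro sum_le_suminf summableI) auto
      moreover have "suminf F = ennreal C"
        unfolding F_def C(1)[symmetric] G_def ..
      ultimately have "F k \<le> ennreal C" by simp
      then have "2 ^ k * (cmod (f (Suc k) x - f k x))\<^sup>2 \<le> C"
        using C(2) by (simp only: F_def ennreal_le_iff)
      then have "(cmod (f (Suc k) x - f k x))\<^sup>2 \<le> C * (1/2) ^ k"
        by (simp add: field_simps power_divide)
      then have "cmod (f (Suc k) x - f k x) \<le> sqrt (C * (1/2) ^ k)"
        by (rule real_le_rsqrt)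
      then show ?thesis by (simp add: real_sqrt_mult real_sqrt_power)
    qed
    have "summable (\<lambda>k. f (Suc k) x - f k x)"
    proof (rule summable_comparison_test'[of _ 0])
      show "summable (\<lambda>k. sqrt C * (sqrt (1/2)) ^ k)"
        by (intro summable_mult summable_geometric) (auto simp: real_sqrt_lt_1_iff)
    qed (use bound in auto)
    then have "convergent (\<lambda>n. \<Sum>k<n. f (Suc k) x - f k x)"
      by (simp add: summable_iff_convergent)
    then have "convergent (\<lambda>n. f n x - f 0 x)"
      by (simp only: sum_lessThan_telescope[of "\<lambda>k. f k x"])
    then have "convergent (\<lambda>n. f n x - f 0 x + f 0 x)"
      by (intro convergent_add convergent_const)
    then show ?case by simp
  qed
qed

text \<open>
  By Fatou's lemma a bound that holds eventually along the sequence passes to its pointwise limit.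
\<close>

lemma sqint_limit_le:
  assumes [measurable]: "\<And>k. f k \<in> borel_measurable M" "h \<in> borel_measurable M"
    and lim: "AE x in M. (\<lambda>k. f k x) \<longlonglongrightarrow> F x"
    and B: "eventually (\<lambda>k. sqint M (\<lambda>x. f k x - h x) \<le> B) sequentially"
  shows "sqint M (\<lambda>x. F x - h x) \<le> B"
proof -
  have "sqint M (\<lambda>x. F x - h x) = (\<integral>\<^sup>+x. liminf (\<lambda>k. ennreal ((cmod (f k x - h x))\<^sup>2)) \<partial>M)"
    unfolding sqint_def
  proof (intro nn_integral_cong_AE)
    show "AE x in M. ennreal ((cmod (F x - h x))\<^sup>2) = liminf (\<lambda>k. ennreal ((cmod (f k x - h x))\<^sup>2))"
      using lim
    proof eventually_elim
      case (elim x)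
      have "(\<lambda>k. ennreal ((cmod (f k x - h x))\<^sup>2)) \<longlonglongrightarrow> ennreal ((cmod (F x - h x))\<^sup>2)"
        by (intro tendsto_intros elim)
      then show ?case by (rule lim_imp_Liminf[symmetric, rotated]) simp
    qed
  qed
  also have "\<dots> \<le> liminf (\<lambda>k. sqint M (\<lambda>x. f k x - h x))"
    unfolding sqint_def by (intro nn_integral_liminf) auto
  also have "\<dots> \<le> B"
    using Liminf_mono[OF B] by (simp add: Liminf_const)
  finally show ?thesis .
qed

section \<open>Orthogonal systems\<close>

definition orthogonal_functions :: "'a measure \<Rightarrow> (nat \<Rightarrow> 'a \<Rightarrow> real) \<Rightarrow> (nat \<Rightarrow> real) \<Rightarrow> bool" where
  "orthogonal_functions M \<phi> c \<longleftrightarrow>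
     (\<forall>n. \<phi> n \<in> borel_measurable M) \<and>
     (\<forall>m n. integrable M (\<lambda>x. \<phi> m x * \<phi> n x)) \<and>
     (\<forall>m n. (LINT x|M. \<phi> m x * \<phi> n x) = (if m = n then c n else 0))"

definition coefficient :: "'a measure \<Rightarrow> (nat \<Rightarrow> 'a \<Rightarrow> real) \<Rightarrow> (nat \<Rightarrow> real) \<Rightarrow> ('a \<Rightarrow> complex) \<Rightarrow> nat \<Rightarrow> complex" where
  "coefficient M \<phi> c h n = (LINT x|M. h x * of_real (\<phi> n x)) / of_real (c n)"

definition partial_sum :: "(nat \<Rightarrow> 'a \<Rightarrow> real) \<Rightarrow> (nat \<Rightarrow> complex) \<Rightarrow> nat \<Rightarrow> 'a \<Rightarrow> complex" where
  "partial_sum \<phi> b N x = (\<Sum>n<N. b n * of_real (\<phi> n x))"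

definition series_limit :: "(nat \<Rightarrow> 'a \<Rightarrow> real) \<Rightarrow> (nat \<Rightarrow> nat) \<Rightarrow> (nat \<Rightarrow> complex) \<Rightarrow> 'a \<Rightarrow> complex" where
  "series_limit \<phi> r b x = lim (\<lambda>k. partial_sum \<phi> b (r k) x)"

context
  fixes M :: "'a measure" and \<phi> :: "nat \<Rightarrow> 'a \<Rightarrow> real" and c :: "nat \<Rightarrow> real"
  assumes orthogonal_functions: "orthogonal_functions M \<phi> c"
begin

lemma measurable_basis: "\<phi> n \<in> borel_measurable M"
  and integrable_basis: "integrable M (\<lambda>x. \<phi> m x * \<phi> n x)"
  and orthogonal: "(LINT x|M. \<phi> m x * \<phi> n x) = (if m = n then c n else 0)"
  using orthogonal_functions by (auto simp: orthogonal_functions_def)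

lemma norm_basis_nonneg: "0 \<le> c n"
proof -
  have "0 \<le> (LINT x|M. \<phi> n x * \<phi> n x)" by (intro integral_nonneg_AE) auto
  then show ?thesis by (simp add: orthogonal)
qed

lemma basis_L2: "(\<lambda>x. of_real (\<phi> n x)) \<in> L2 M"
  using integrable_basis[of n n] measurable_basis[of n]
  by (auto simp: L2_iff sqint_def power2_eq_square integrable_iff_bounded)

lemma partial_sum_L2: "(\<lambda>x. \<Sum>n\<in>I. b n * of_real (\<phi> n x)) \<in> L2 M"
  by (intro L2_sum L2_cmult basis_L2)

lemma pythagoras_integral:
  assumes "finite I"
  shows "(LINT x|M. (cmod (\<Sum>n\<in>I. b n * of_real (\<phi> n x)))\<^sup>2) = (\<Sum>n\<in>I. (cmod (b n))\<^sup>2 * c n)"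
proof -
  have int: "integrable M (\<lambda>x. b m * cnj (b n) * complex_of_real (\<phi> m x * \<phi> n x))" for m n
    by (intro integrable_mult_right integrable_of_real integrable_basis)
  have "complex_of_real (LINT x|M. (cmod (\<Sum>n\<in>I. b n * of_real (\<phi> n x)))\<^sup>2) =
        (LINT x|M. complex_of_real ((cmod (\<Sum>n\<in>I. b n * of_real (\<phi> n x)))\<^sup>2))"
    by (rule integral_of_real[symmetric]) (rule integrable_cmod_sq[OF partial_sum_L2])
  also have "\<dots> = (LINT x|M. (\<Sum>m\<in>I. \<Sum>n\<in>I. b m * cnj (b n) * complex_of_real (\<phi> m x * \<phi> n x)))"
    by (intro Bochner_Integration.integral_cong refl)
       (simp only: complex_norm_square cnj_sum sum_product, simp add: mult_ac)
  also have "\<dots> = (\<Sum>m\<in>I. \<Sum>n\<in>I. b m * cnj (b n) * (LINT x|M. complex_of_real (\<phi> m x * \<phi> n x)))"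
    using int by (simp add: Bochner_Integration.integral_sum del: of_real_mult)
  also have "\<dots> = (\<Sum>m\<in>I. \<Sum>n\<in>I. if m = n then complex_of_real ((cmod (b n))\<^sup>2 * c n) else 0)"
    by (intro sum.cong refl)
       (simp only: integral_complex_of_real orthogonal, auto simp: complex_norm_square simp del: of_real_power)
  also have "\<dots> = complex_of_real (\<Sum>n\<in>I. (cmod (b n))\<^sup>2 * c n)"
    using assms by simp
  finally show ?thesis by (simp only: of_real_eq_iff)
qed

lemma pythagoras:
  assumes "finite I"
  shows "sqint M (\<lambda>x. \<Sum>n\<in>I. b n * of_real (\<phi> n x)) = ennreal (\<Sum>n\<in>I. (cmod (b n))\<^sup>2 * c n)"
  using sqint_eq_integral[OF partial_sum_L2] pythagoras_integral[OF assms] by simp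

text \<open>
  The difference of the two sides is the integral of \<open>|h - S|\<^sup>2\<close>, where \<open>S\<close> is the partial sum of the
  expansion of \<open>h\<close>.
\<close>

lemma bessel:
  assumes h: "h \<in> L2 M" and cpos: "\<And>n. c n > 0"
  shows "(\<Sum>n<N. (cmod (coefficient M \<phi> c h n))\<^sup>2 * c n) \<le> (LINT x|M. (cmod (h x))\<^sup>2)"
proof -
  define a where "a = coefficient M \<phi> c h"
  define S where "S x = (\<Sum>n<N. a n * of_real (\<phi> n x))" for x
  define E where "E = (\<Sum>n<N. (cmod (a n))\<^sup>2 * c n)"
  have S: "S \<in> L2 M" unfolding S_def by (rule partial_sum_L2)
  have inth: "integrable M (\<lambda>x. h x * of_real (\<phi> n x))" for n
    by (rule integrable_L2_mult[OF h basis_L2])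
  have hphi: "(LINT x|M. h x * of_real (\<phi> n x)) = a n * of_real (c n)" for n
    using cpos[of n] by (simp add: a_def coefficient_def)
  have hS: "h x * cnj (S x) = (\<Sum>n<N. cnj (a n) * (h x * of_real (\<phi> n x)))" for x
    by (simp add: S_def sum_distrib_left mult_ac)
  have intS: "integrable M (\<lambda>x. h x * cnj (S x))"
    unfolding hS by (intro Bochner_Integration.integrable_sum integrable_mult_right inth)
  have "(LINT x|M. h x * cnj (S x)) = (\<Sum>n<N. cnj (a n) * (a n * of_real (c n)))"
    unfolding hS using inth by (simp add: Bochner_Integration.integral_sum hphi)
  also have "\<dots> = of_real E"
    unfolding E_def by (simp add: complex_norm_square mult_ac del: of_real_power)
  finally have hSE: "(LINT x|M. h x * cnj (S x)) = of_real E" .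
  have "(cmod (h x - S x))\<^sup>2 = (cmod (h x))\<^sup>2 + (cmod (S x))\<^sup>2 - 2 * Re (h x * cnj (S x))" for x
    by (simp add: cmod_power2) (simp add: power2_eq_square algebra_simps)
  then have "(LINT x|M. (cmod (h x - S x))\<^sup>2) =
     (LINT x|M. (cmod (h x))\<^sup>2) + (LINT x|M. (cmod (S x))\<^sup>2) - 2 * (LINT x|M. Re (h x * cnj (S x)))"
    using integrable_cmod_sq[OF h] integrable_cmod_sq[OF S] integrable_Re[OF intS]
    by (simp del: times_complex.simps)
  also have "(LINT x|M. Re (h x * cnj (S x))) = E"
    using integral_Re[OF intS] hSE by simp
  also have "(LINT x|M. (cmod (S x))\<^sup>2) = E"
    unfolding S_def E_def by (rule pythagoras_integral) simp
  finally have "(LINT x|M. (cmod (h x))\<^sup>2) - E = (LINT x|M. (cmod (h x - S x))\<^sup>2)" by simp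
  also have "\<dots> \<ge> 0" by (intro integral_nonneg_AE) auto
  finally show ?thesis by (simp add: E_def a_def)
qed

lemma coefficient_basis:
  assumes "c n \<noteq> 0"
  shows "coefficient M \<phi> c (\<lambda>x. of_real (\<phi> n x)) m = (if m = n then 1 else 0)"
proof -
  have "(LINT x|M. complex_of_real (\<phi> n x) * complex_of_real (\<phi> m x)) = complex_of_real (LINT x|M. \<phi> n x * \<phi> m x)"
    using integral_complex_of_real[of M "\<lambda>x. \<phi> n x * \<phi> m x"] by simp
  then show ?thesis using assms by (auto simp: coefficient_def orthogonal)
qed

lemma coefficient_linear:
  assumes "h \<in> L2 M" "k \<in> L2 M"
  shows "coefficient M \<phi> c (\<lambda>x. a * h x + b * k x) n = a * coefficient M \<phi> c h n + b * coefficient M \<phi> c k n"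
proof -
  have "(LINT x|M. (a * h x + b * k x) * of_real (\<phi> n x)) =
        (LINT x|M. a * (h x * of_real (\<phi> n x)) + b * (k x * of_real (\<phi> n x)))"
    by (intro Bochner_Integration.integral_cong) (auto simp: algebra_simps)
  also have "\<dots> = a * (LINT x|M. h x * of_real (\<phi> n x)) + b * (LINT x|M. k x * of_real (\<phi> n x))"
    using integrable_L2_mult[OF assms(1) basis_L2] integrable_L2_mult[OF assms(2) basis_L2]
    by simp
  finally show ?thesis by (simp add: coefficient_def add_divide_distrib)
qed

lemma partial_sum_measurable: "partial_sum \<phi> b N \<in> borel_measurable M"
  using measurable_basis unfolding partial_sum_def[abs_def] by measurable

text \<open>
  The Riesz--Fischer theorem. The subsequence of partial sums depends only on the sizes of the
  coefficients, so that one choice serves all series obtained by turning the phases.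
\<close>

lemma riesz_fischer:
  assumes "summable (\<lambda>n. (cmod (a n))\<^sup>2 * c n)"
  obtains r :: "nat \<Rightarrow> nat" where
    "\<And>b. (\<And>n. cmod (b n) \<le> cmod (a n)) \<Longrightarrow>
        has_L2_sum M (\<lambda>n x. b n * of_real (\<phi> n x)) (series_limit \<phi> r b)"
    "\<And>b N. (\<And>n. cmod (b n) \<le> cmod (a n)) \<Longrightarrow>
        sqint M (\<lambda>x. series_limit \<phi> r b x - partial_sum \<phi> b N x)
        \<le> ennreal (\<Sum>n. (cmod (a (n + N)))\<^sup>2 * c (n + N))"
proof -
  note [measurable] = measurable_basis partial_sum_measurable
  define w where "w n = (cmod (a n))\<^sup>2 * c n" for n
  define tail where "tail N = (\<Sum>n. w (n + N))" for N
  have w0: "0 \<le> w n" for n by (simp add: w_def norm_basis_nonneg)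
  have sw: "summable w" using assms by (simp add: w_def[abs_def])
  have tail0: "tail \<longlonglongrightarrow> 0"
  proof -
    have "(\<lambda>N. suminf w - (\<Sum>n<N. w n)) \<longlonglongrightarrow> suminf w - suminf w"
      by (intro tendsto_intros summable_LIMSEQ sw)
    moreover have "tail = (\<lambda>N. suminf w - (\<Sum>n<N. w n))"
      unfolding tail_def by (rule ext) (rule suminf_minus_initial_segment[OF sw])
    ultimately show ?thesis by simp
  qed
  have "\<exists>N. \<forall>n\<ge>N. tail n \<le> (1/4) ^ k" for k
    using order_tendstoD(2)[OF tail0, of "(1/4)^k"] by (auto simp: eventually_sequentially intro: less_imp_le)
  then obtain N0 where N0: "\<And>k n. n \<ge> N0 k \<Longrightarrow> tail n \<le> (1/4) ^ k" by metis
  \<comment> \<open>The sum makes \<open>r\<close> increasing and at least \<open>N0 k\<close>, the summand \<open>k\<close> makes it unbounded.\<close>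
  define r where "r k = k + (\<Sum>j\<le>k. N0 j)" for k
  have rk: "N0 k \<le> r k" for k
  proof -
    have "N0 k \<le> (\<Sum>j\<le>k. N0 j)" by (rule member_le_sum) auto
    then show ?thesis by (simp add: r_def)
  qed
  have r_mono: "r k \<le> r (Suc k)" for k by (simp add: r_def)
  have r_ge: "k \<le> r k" for k by (simp add: r_def)
  have block: "sqint M (\<lambda>x. partial_sum \<phi> b N' x - partial_sum \<phi> b N x) \<le> ennreal (tail N)"
    if b: "\<And>n. cmod (b n) \<le> cmod (a n)" and "N \<le> N'" for b N N'
  proof -
    have "partial_sum \<phi> b N' x - partial_sum \<phi> b N x =
          (\<Sum>n\<in>{N..<N'}. b n * of_real (\<phi> n x))" for x
      using \<open>N \<le> N'\<close> by (simp add: partial_sum_def sum_diff_nat_ivl[of 0] atLeast0LessThan[symmetric])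
    then have "sqint M (\<lambda>x. partial_sum \<phi> b N' x - partial_sum \<phi> b N x) =
         ennreal (\<Sum>n\<in>{N..<N'}. (cmod (b n))\<^sup>2 * c n)"
      by (simp add: pythagoras)
    also have "(\<Sum>n\<in>{N..<N'}. (cmod (b n))\<^sup>2 * c n) \<le> (\<Sum>n\<in>{N..<N'}. w n)"
      unfolding w_def by (intro sum_mono mult_right_mono power_mono b norm_basis_nonneg) auto
    also have "(\<Sum>n\<in>{N..<N'}. w n) = (\<Sum>n<N'-N. w (n + N))"
      using \<open>N \<le> N'\<close> sum.shift_bounds_nat_ivl[of w 0 N "N' - N"] by (simp add: atLeast0LessThan)
    also have "\<dots> \<le> tail N"
      unfolding tail_def by (intro sum_le_suminf) (auto simp: w0 summable_iff_shift sw)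
    finally show ?thesis by (simp add: ennreal_leI)
  qed
  have conv: "AE x in M. (\<lambda>k. partial_sum \<phi> b (r k) x) \<longlonglongrightarrow> series_limit \<phi> r b x"
    if b: "\<And>n. cmod (b n) \<le> cmod (a n)" for b
  proof -
    have "AE x in M. convergent (\<lambda>k. partial_sum \<phi> b (r k) x)"
    proof (rule AE_convergent_of_sqint_steps)
      fix k
      show "sqint M (\<lambda>x. partial_sum \<phi> b (r (Suc k)) x - partial_sum \<phi> b (r k) x) \<le> ennreal ((1/4)^k)"
        using block[OF b r_mono[of k]] N0[OF rk[of k]] by (meson ennreal_leI order_trans)
    qed measurable
    then show ?thesis by (simp add: convergent_LIMSEQ_iff series_limit_def)
  qed
  have bound: "sqint M (\<lambda>x. series_limit \<phi> r b x - partial_sum \<phi> b N x)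
        \<le> ennreal (tail N)" if b: "\<And>n. cmod (b n) \<le> cmod (a n)" for b N
  proof (rule sqint_limit_le[OF _ _ conv[OF b]])
    show "eventually (\<lambda>k. sqint M (\<lambda>x. partial_sum \<phi> b (r k) x - partial_sum \<phi> b N x) \<le> ennreal (tail N)) sequentially"
      using eventually_ge_at_top[of N]
      by eventually_elim (intro block b, use r_ge order_trans in blast)
  qed measurable
  have meas: "(series_limit \<phi> r b) \<in> borel_measurable M" for b :: "nat \<Rightarrow> complex"
    unfolding series_limit_def[abs_def] by measurable
  have "has_L2_sum M (\<lambda>n x. b n * of_real (\<phi> n x)) (series_limit \<phi> r b)"
    if b: "\<And>n. cmod (b n) \<le> cmod (a n)" for b
    unfolding has_L2_sum_def partial_sum_def[symmetric]
  proof
    show "(series_limit \<phi> r b) \<in> L2 M"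
      using le_less_trans[OF bound[OF b, of 0] ennreal_less_top] meas[of b] by (simp add: L2_iff partial_sum_def)
    have "(\<lambda>N. ennreal (tail N)) \<longlonglongrightarrow> 0"
      using tendsto_ennrealI[OF tail0] by simp
    then have "(\<lambda>N. sqint M (\<lambda>x. series_limit \<phi> r b x - partial_sum \<phi> b N x)) \<longlonglongrightarrow> 0"
      by (rule tendsto_ennreal_0_le) (rule bound[OF b], rule refl)
    then show "(\<lambda>N. Lp_norm M 2 (\<lambda>x. partial_sum \<phi> b N x - series_limit \<phi> r b x)) \<longlonglongrightarrow> 0"
      unfolding tendsto_Lp_norm_2_iff by (subst sqint_minus_commute)
  qed
  then show thesis using that[of r] bound by (simp add: tail_def w_def)
qed

end

section \<open>Laguerre polynomials\<close>

text \<open>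
  The coefficients of \<open>binom (n + \<nu>, n)\<close> times the confluent hypergeometric polynomial
  \<open>1F1 (- n; \<nu> + 1; x)\<close>. In this form the two-term recurrence between consecutive coefficients, which
  is the Laguerre equation, can be read off.
\<close>

definition laguerre_coeff :: "real \<Rightarrow> nat \<Rightarrow> nat \<Rightarrow> real" where
  "laguerre_coeff \<nu> n k =
     pochhammer (\<nu> + 1) n / fact n * pochhammer (- real n) k / (pochhammer (\<nu> + 1) k * fact k)"

definition laguerre_poly :: "real \<Rightarrow> nat \<Rightarrow> real poly" where
  "laguerre_poly \<nu> n = (\<Sum>k\<le>n. monom (laguerre_coeff \<nu> n k) k)"

lemma pochhammer_add_one_pos: "\<nu> > -1 \<Longrightarrow> pochhammer (\<nu> + 1 :: real) k > 0"
  by (intro pochhammer_pos) auto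

lemma coeff_laguerre_poly: "coeff (laguerre_poly \<nu> n) k = laguerre_coeff \<nu> n k"
proof (cases "k \<le> n")
  case False
  then have "pochhammer (- real n) k = 0"
    by (auto simp: pochhammer_eq_0_iff intro!: exI[of _ n])
  then show ?thesis
    using False by (simp add: laguerre_poly_def laguerre_coeff_def coeff_sum)
qed (simp add: laguerre_poly_def coeff_sum)

lemma laguerre_coeff_Suc:
  assumes "\<nu> > -1"
  shows "real (Suc k) * (\<nu> + 1 + real k) * laguerre_coeff \<nu> n (Suc k) = (real k - real n) * laguerre_coeff \<nu> n k"
proof -
  have "pochhammer (\<nu> + 1) k \<noteq> 0" "\<nu> + 1 + real k \<noteq> 0" using pochhammer_add_one_pos[OF assms, of k] assms by auto
  then show ?thesis
    by (simp add: laguerre_coeff_def pochhammer_Suc divide_simps)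
qed

lemma laguerre_ode:
  assumes "\<nu> > -1"
  shows "[:0, 1:] * pderiv (pderiv (laguerre_poly \<nu> n)) + [:\<nu> + 1, -1:] * pderiv (laguerre_poly \<nu> n)
           = smult (- real n) (laguerre_poly \<nu> n)"
proof (rule poly_eqI)
  fix k
  show "coeff ([:0, 1:] * pderiv (pderiv (laguerre_poly \<nu> n)) + [:\<nu> + 1, -1:] * pderiv (laguerre_poly \<nu> n)) k
        = coeff (smult (- real n) (laguerre_poly \<nu> n)) k"
    using laguerre_coeff_Suc[OF assms, of k n]
    by (cases k) (simp_all add: coeff_pderiv coeff_laguerre_poly algebra_simps)
qed

lemma pderiv_laguerre_poly:
  assumes "\<nu> > -1"
  shows "pderiv (laguerre_poly \<nu> (Suc n)) = - laguerre_poly (\<nu> + 1) n"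
proof (rule poly_eqI)
  fix k
  have "pochhammer (\<nu> + 1 + 1) k > 0" by (rule pochhammer_pos) (use assms in auto)
  moreover have "pochhammer (- real (Suc n)) (Suc k) = - real (Suc n) * pochhammer (- real n) k"
    by (subst pochhammer_rec) (simp add: algebra_simps)
  ultimately show "coeff (pderiv (laguerre_poly \<nu> (Suc n))) k = coeff (- laguerre_poly (\<nu> + 1) n) k"
    using assms
    by (simp add: coeff_pderiv coeff_laguerre_poly laguerre_coeff_def pochhammer_rec[of "\<nu> + 1"] divide_simps)
       (simp add: algebra_simps)
qed

lemma laguerre_coeff_lead:
  assumes "\<nu> > -1"
  shows "laguerre_coeff \<nu> n n = (-1) ^ n / fact n"
proof -
  have "pochhammer (- real n) n = (-1) ^ n * fact n"
    using pochhammer_same[of n, where 'a=real] by simp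
  then show ?thesis using pochhammer_add_one_pos[OF assms, of n] by (simp add: laguerre_coeff_def)
qed

lemma degree_laguerre_poly:
  assumes "\<nu> > -1"
  shows "degree (laguerre_poly \<nu> n) = n"
proof (rule antisym)
  show "degree (laguerre_poly \<nu> n) \<le> n"
    unfolding laguerre_poly_def by (intro degree_sum_le) (auto intro: order_trans[OF degree_monom_le])
  show "n \<le> degree (laguerre_poly \<nu> n)"
    by (intro le_degree) (simp add: coeff_laguerre_poly laguerre_coeff_lead[OF assms])
qed

definition gamma_weight :: "real \<Rightarrow> real \<Rightarrow> real" where
  "gamma_weight \<nu> x = indicator {0<..} x * (exp (-x) * x powr \<nu>)"

definition gamma_integral :: "real \<Rightarrow> real poly \<Rightarrow> real" where
  "gamma_integral \<nu> p = (LINT x|lborel. poly p x * gamma_weight \<nu> x)"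

lemma gamma_weight_nonneg: "0 \<le> gamma_weight \<nu> x"
  by (simp add: gamma_weight_def)

lemma gamma_weight_measurable [measurable]: "gamma_weight \<nu> \<in> borel_measurable borel"
  unfolding gamma_weight_def by measurable

lemma gamma_weight_monomial:
  assumes "\<nu> > -1"
  shows "has_bochner_integral lborel (\<lambda>x. x ^ k * gamma_weight \<nu> x) (Gamma (\<nu> + real k + 1))"
proof (rule has_bochner_integral_nn_integral)
  have eq: "x ^ k * gamma_weight \<nu> x = indicator {0..} x * x powr (\<nu> + real k + 1 - 1) / exp x" if "x \<noteq> 0" for x
    using that by (auto simp: gamma_weight_def indicator_def powr_add powr_realpow exp_minus divide_simps)
  have "(\<integral>\<^sup>+x. ennreal (x ^ k * gamma_weight \<nu> x) \<partial>lborel) =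
        (\<integral>\<^sup>+x. ennreal (indicator {0..} x * x powr (\<nu> + real k + 1 - 1) / exp x) \<partial>lborel)"
    by (intro nn_integral_cong_AE) (use AE_lborel_singleton[of 0] eq in \<open>auto elim!: eventually_mono\<close>)
  also have "\<dots> = Gamma (\<nu> + real k + 1)"
    using assms by (intro Gamma_conv_nn_integral_real[symmetric]) auto
  finally show "(\<integral>\<^sup>+x. ennreal (x ^ k * gamma_weight \<nu> x) \<partial>lborel) = ennreal (Gamma (\<nu> + real k + 1))" .
  show "0 \<le> Gamma (\<nu> + real k + 1)"
    using assms by (intro Gamma_real_nonneg) auto
  show "AE x in lborel. 0 \<le> x ^ k * gamma_weight \<nu> x"
    by (auto simp: gamma_weight_def indicator_def)
qed measurable

lemma integrable_poly_gamma_weight: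
  assumes "\<nu> > -1"
  shows "integrable lborel (\<lambda>x. poly p x * gamma_weight \<nu> x)"
proof -
  have "(\<lambda>x. poly p x * gamma_weight \<nu> x) = (\<lambda>x. \<Sum>i\<le>degree p. coeff p i * (x ^ i * gamma_weight \<nu> x))"
    by (simp add: poly_altdef sum_distrib_right mult.assoc)
  then show ?thesis
    using gamma_weight_monomial[OF assms]
    by (auto intro!: Bochner_Integration.integrable_sum simp: has_bochner_integral_iff)
qed

lemma gamma_integral_add:
  "\<nu> > -1 \<Longrightarrow> gamma_integral \<nu> (p + q) = gamma_integral \<nu> p + gamma_integral \<nu> q"
  by (simp add: gamma_integral_def distrib_right integrable_poly_gamma_weight)

lemma gamma_integral_diff:
  "\<nu> > -1 \<Longrightarrow> gamma_integral \<nu> (p - q) = gamma_integral \<nu> p - gamma_integral \<nu> q"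
  by (simp add: gamma_integral_def left_diff_distrib integrable_poly_gamma_weight)

lemma gamma_integral_smult: "gamma_integral \<nu> (smult a p) = a * gamma_integral \<nu> p"
  by (simp add: gamma_integral_def mult.assoc)

lemma gamma_integral_0 [simp]: "gamma_integral \<nu> 0 = 0"
  by (simp add: gamma_integral_def)

lemma gamma_integral_sum:
  "\<nu> > -1 \<Longrightarrow> gamma_integral \<nu> (\<Sum>i\<in>I. p i) = (\<Sum>i\<in>I. gamma_integral \<nu> (p i))"
  by (induction I rule: infinite_finite_induct) (simp_all add: gamma_integral_add)

lemma gamma_integral_monom:
  "\<nu> > -1 \<Longrightarrow> gamma_integral \<nu> (monom a k) = a * Gamma (\<nu> + real k + 1)"
  using gamma_weight_monomial[of \<nu> k]
  by (simp add: gamma_integral_def poly_monom has_bochner_integral_iff mult.assoc)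

lemma gamma_integral_shift: "gamma_integral \<nu> ([:0, 1:] * p) = gamma_integral (\<nu> + 1) p"
  unfolding gamma_integral_def
  by (intro Bochner_Integration.integral_cong)
     (auto simp: gamma_weight_def indicator_def powr_add)

text \<open>
  The integrand is \<open>(x r(x) e\<^sup>-\<^sup>x x\<^sup>\<nu>)'\<close>; on monomials the identity is the functional equation of the
  Gamma function.
\<close>

lemma gamma_integral_by_parts:
  assumes "\<nu> > -1"
  shows "gamma_integral \<nu> ([:0, 1:] * pderiv r + [:\<nu> + 1, -1:] * r) = 0"
proof -
  define F where "F r = gamma_integral \<nu> ([:0, 1:] * pderiv r + [:\<nu> + 1, -1:] * r)" for r
  have add: "F (p + q) = F p + F q" for p q
    unfolding F_def using assms by (simp only: pderiv_add distrib_left gamma_integral_add)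
  have mon: "F (monom a k) = 0" for a k
  proof -
    have "[:0, 1:] * pderiv (monom a k) + [:\<nu> + 1, -1:] * monom a k = monom ((\<nu> + real k + 1) * a) k - monom a (Suc k)"
      by (rule poly_eqI) (auto simp: coeff_pderiv coeff_pCons algebra_simps split: nat.splits)
    then show ?thesis
      using assms Gamma_plus1[of "\<nu> + real k + 1"] nonpos_Ints_nonpos[of "\<nu> + real k + 1"]
      by (fastforce simp: F_def gamma_integral_diff gamma_integral_monom add_ac simp del: mult_pCons_left)
  qed
  have F0: "F 0 = 0" by (simp add: F_def)
  have "F (\<Sum>i\<in>I. monom (coeff r i) i) = 0" for I
    by (induction I rule: infinite_finite_induct) (simp_all add: add mon F0)
  from this[of "{..degree r}"] show ?thesis
    by (simp add: poly_as_sum_of_monoms F_def)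
qed

text \<open>
  The Laguerre operator in Sturm--Liouville form. The right-hand side is symmetric when \<open>q\<close> is also a
  Laguerre polynomial, so eigenfunctions for different \<open>n\<close> are orthogonal.
\<close>

lemma laguerre_dirichlet_form:
  assumes "\<nu> > -1"
  shows "real n * gamma_integral \<nu> (laguerre_poly \<nu> n * q) =
         gamma_integral \<nu> ([:0, 1:] * (pderiv (laguerre_poly \<nu> n) * pderiv q))"
proof -
  let ?L = "laguerre_poly \<nu> n"
  have "[:0, 1:] * pderiv (pderiv ?L * q) + [:\<nu> + 1, -1:] * (pderiv ?L * q) =
        ([:0, 1:] * pderiv (pderiv ?L) + [:\<nu> + 1, -1:] * pderiv ?L) * q + [:0, 1:] * (pderiv ?L * pderiv q)"
    unfolding pderiv_mult by algebra
  also have "\<dots> = smult (- real n) (?L * q) + [:0, 1:] * (pderiv ?L * pderiv q)"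
    by (subst laguerre_ode[OF assms]) simp
  finally have "gamma_integral \<nu> (smult (- real n) (?L * q) + [:0, 1:] * (pderiv ?L * pderiv q)) = 0"
    using gamma_integral_by_parts[OF assms, of "pderiv ?L * q"] by simp
  then show ?thesis
    by (simp only: gamma_integral_add[OF assms] gamma_integral_smult)
qed

lemma laguerre_poly_orthogonal:
  assumes "\<nu> > -1" "m \<noteq> n"
  shows "gamma_integral \<nu> (laguerre_poly \<nu> m * laguerre_poly \<nu> n) = 0"
proof -
  have "real m * gamma_integral \<nu> (laguerre_poly \<nu> m * laguerre_poly \<nu> n) =
        real n * gamma_integral \<nu> (laguerre_poly \<nu> m * laguerre_poly \<nu> n)"
    using laguerre_dirichlet_form[OF assms(1), of m "laguerre_poly \<nu> n"]
      laguerre_dirichlet_form[OF assms(1), of n "laguerre_poly \<nu> m"]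
    by (simp only: mult.commute)
  then show ?thesis using assms(2) by simp
qed

text \<open>
  For \<open>q = L\<^sub>n\<close> the Dirichlet form is the squared norm of \<open>L\<^sub>n'\<close> for the weight with parameter \<open>\<nu> + 1\<close>,
  and \<open>L\<^sub>n' = - L\<^sub>n\<^sub>-\<^sub>1\<close> with parameter \<open>\<nu> + 1\<close>; hence induction on \<open>n\<close>.
\<close>

lemma laguerre_poly_norm:
  assumes "\<nu> > -1"
  shows "gamma_integral \<nu> (laguerre_poly \<nu> n * laguerre_poly \<nu> n) = Gamma (real n + \<nu> + 1) / fact n"
  using assms
proof (induction n arbitrary: \<nu>)
  case 0
  have "laguerre_poly \<nu> 0 = monom 1 0" by (simp add: laguerre_poly_def laguerre_coeff_def)
  then have "laguerre_poly \<nu> 0 * laguerre_poly \<nu> 0 = monom 1 0" by (simp add: mult_monom)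
  then show ?case using 0 by (simp only: gamma_integral_monom) simp
next
  case (Suc n)
  have "real (Suc n) * gamma_integral \<nu> (laguerre_poly \<nu> (Suc n) * laguerre_poly \<nu> (Suc n)) =
        gamma_integral (\<nu> + 1) (laguerre_poly (\<nu> + 1) n * laguerre_poly (\<nu> + 1) n)"
    using laguerre_dirichlet_form[OF Suc.prems, of "Suc n" "laguerre_poly \<nu> (Suc n)"]
    by (simp only: gamma_integral_shift pderiv_laguerre_poly[OF Suc.prems] minus_mult_minus)
  also have "\<dots> = Gamma (real n + (\<nu> + 1) + 1) / fact n"
    using Suc.prems by (intro Suc.IH) auto
  finally have "gamma_integral \<nu> (laguerre_poly \<nu> (Suc n) * laguerre_poly \<nu> (Suc n)) =
      Gamma (real n + (\<nu> + 1) + 1) / fact n / real (Suc n)"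
    by (simp add: eq_divide_eq mult.commute del: of_nat_Suc)
  then show ?case by (simp add: algebra_simps)
qed

lemma is_laguerre_iff:
  "is_laguerre \<nu> L \<longleftrightarrow>
     (\<forall>n. degree (L n) = n \<and> (-1) ^ n * lead_coeff (L n) > 0) \<and>
     (\<forall>m n. gamma_integral \<nu> (L m * L n) = (if m = n then Gamma (real n + \<nu> + 1) / fact n else 0))"
proof -
  have "(LINT x:{0<..}|lborel. poly (L m) x * poly (L n) x * (exp (-x) * x powr \<nu>)) = gamma_integral \<nu> (L m * L n)" for m n
    unfolding set_lebesgue_integral_def gamma_integral_def gamma_weight_def
    by (intro Bochner_Integration.integral_cong) auto
  then show ?thesis by (simp add: is_laguerre_def)
qed

lemma is_laguerre_laguerre_poly: "\<nu> > -1 \<Longrightarrow> is_laguerre \<nu> (laguerre_poly \<nu>)"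
  by (auto simp: is_laguerre_iff degree_laguerre_poly coeff_laguerre_poly laguerre_coeff_lead
      laguerre_poly_norm laguerre_poly_orthogonal simp flip: power_mult_distrib)

lemma poly_in_span_of_degree_basis:
  assumes "\<And>n. degree (B n) = n" "\<And>n. lead_coeff (B n) \<noteq> (0::real)"
  assumes "\<forall>i\<ge>n. coeff q i = 0"
  shows "\<exists>a. q = (\<Sum>k<n. smult (a k) (B k))"
  using assms(3)
proof (induction n arbitrary: q)
  case 0
  then show ?case by (auto simp: poly_eq_iff)
next
  case (Suc n)
  let ?e = "coeff q n / coeff (B n) n"
  have "coeff (B n) n \<noteq> 0" using assms(1)[of n] assms(2)[of n] by simp
  moreover have "coeff (B n) i = 0" if "i > n" for i
    using assms(1)[of n] that by (simp add: coeff_eq_0)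
  ultimately have "coeff (q - smult ?e (B n)) i = 0" if "n \<le> i" for i
    using Suc.prems that by (cases "i = n") auto
  then obtain a where "q - smult ?e (B n) = (\<Sum>k<n. smult (a k) (B k))" using Suc.IH by blast
  then have "q = (\<Sum>k<n. smult (a k) (B k)) + smult ?e (B n)" by (metis diff_add_cancel)
  then show ?case
    by (intro exI[of _ "a(n := ?e)"]) simp
qed

text \<open>
  Once the leading coefficients are matched, the difference of the two polynomials of degree \<open>n\<close> has lower
  degree and is orthogonal to everything of lower degree, so it vanishes. The norm and the sign of the leading
  coefficient then fix the factor.
\<close>

lemma is_laguerre_unique:
  assumes \<nu>: "\<nu> > -1" and L: "is_laguerre \<nu> L"
  shows "L = laguerre_poly \<nu>"
proof
  fix n
  let ?P = "laguerre_poly \<nu>"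
  note P = is_laguerre_laguerre_poly[OF \<nu>]
  have lower: "gamma_integral \<nu> (B n * q) = 0" if B: "is_laguerre \<nu> B" and q: "\<forall>i\<ge>n. coeff q i = 0" for B q
  proof -
    have "\<exists>a. q = (\<Sum>k<n. smult (a k) (B k))"
    proof (rule poly_in_span_of_degree_basis[OF _ _ q])
      show "degree (B n) = n" for n using B by (auto simp: is_laguerre_iff)
      show "lead_coeff (B n) \<noteq> 0" for n using B unfolding is_laguerre_iff by (metis less_irrefl mult_zero_right)
    qed
    then obtain a where "q = (\<Sum>k<n. smult (a k) (B k))" ..
    then have "gamma_integral \<nu> (B n * q) = (\<Sum>k<n. a k * gamma_integral \<nu> (B n * B k))"
      using \<nu> by (simp add: sum_distrib_left gamma_integral_sum gamma_integral_smult)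
    also have "\<dots> = 0" using B by (intro sum.neutral) (auto simp: is_laguerre_iff)
    finally show ?thesis .
  qed
  have dL: "degree (L n) = n" "degree (?P n) = n" and sL: "(-1) ^ n * coeff (L n) n > 0"
    using L P by (auto simp: is_laguerre_iff) (metis L is_laguerre_iff)
  have lP: "coeff (?P n) n = (-1) ^ n / fact n" using laguerre_coeff_lead[OF \<nu>] by (simp add: coeff_laguerre_poly)
  define e where "e = coeff (L n) n / coeff (?P n) n"
  have "e = ((-1) ^ n * coeff (L n) n) * fact n"
    by (cases "even n") (auto simp: e_def lP)
  then have e: "e > 0" "coeff (L n) n = e * coeff (?P n) n"
    using sL by (auto simp: e_def lP)
  define D where "D = L n - smult e (?P n)"
  have D0: "\<forall>i\<ge>n. coeff D i = 0"
  proof (intro allI impI)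
    fix i assume "n \<le> i"
    then show "coeff D i = 0"
      using e dL by (cases "i = n") (auto simp: D_def coeff_eq_0)
  qed
  have "\<exists>a. D = (\<Sum>k<n. smult (a k) (?P k))"
  proof (rule poly_in_span_of_degree_basis[OF _ _ D0])
    show "degree (?P n) = n" for n using \<nu> by (rule degree_laguerre_poly)
    show "lead_coeff (?P n) \<noteq> 0" for n
      using \<nu> by (simp add: degree_laguerre_poly coeff_laguerre_poly laguerre_coeff_lead)
  qed
  then obtain a where a: "D = (\<Sum>k<n. smult (a k) (?P k))" ..
  have "a k = 0" if "k < n" for k
  proof -
    have low: "\<forall>i\<ge>n. coeff (?P k) i = 0"
      using that \<nu> by (auto simp: coeff_eq_0 degree_laguerre_poly)
    have "gamma_integral \<nu> (D * ?P k) = gamma_integral \<nu> (L n * ?P k) - e * gamma_integral \<nu> (?P n * ?P k)"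
      using \<nu> by (simp add: D_def left_diff_distrib gamma_integral_diff gamma_integral_smult)
    also have "\<dots> = 0" using lower[OF L low] lower[OF P low] by simp
    finally have "0 = gamma_integral \<nu> (D * ?P k)" ..
    also have "\<dots> = (\<Sum>j<n. a j * gamma_integral \<nu> (?P j * ?P k))"
      using \<nu> by (simp add: a sum_distrib_right gamma_integral_sum gamma_integral_smult)
    also have "\<dots> = (\<Sum>j<n. if j = k then a j * (Gamma (real k + \<nu> + 1) / fact k) else 0)"
      using P by (intro sum.cong) (auto simp: is_laguerre_iff)
    also have "\<dots> = a k * (Gamma (real k + \<nu> + 1) / fact k)" using that by simp
    finally show "a k = 0" using \<nu> Gamma_real_pos[of "real k + \<nu> + 1"] by fastforce
  qed
  then have "D = 0" by (simp add: a)
  then have Ln: "L n = smult e (?P n)" by (simp add: D_def)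
  have Gn: "Gamma (real n + \<nu> + 1) > 0" using \<nu> by (intro Gamma_real_pos) auto
  have "gamma_integral \<nu> (L n * L n) = e\<^sup>2 * gamma_integral \<nu> (?P n * ?P n)"
    by (simp add: Ln gamma_integral_smult power2_eq_square)
  then have "e\<^sup>2 = 1"
    using L P Gn by (simp add: is_laguerre_iff)
  then have "e = 1" using e by (simp add: power2_eq_1_iff)
  then show "L n = ?P n" by (simp add: Ln)
qed

lemma laguerre_eq: "\<nu> > -1 \<Longrightarrow> laguerre \<nu> = laguerre_poly \<nu>"
  unfolding laguerre_def using is_laguerre_laguerre_poly is_laguerre_unique by (intro the_equality) auto

subsection \<open>The Laguerre measure\<close>

lemma laguerre_measure_eq:
  "laguerre_measure \<nu> = density lborel (\<lambda>x. ennreal (gamma_weight \<nu> x / Gamma (\<nu> + 1)))"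
  by (simp add: laguerre_measure_def gamma_weight_def)

lemma sets_laguerre_measure [measurable_cong, simp]: "sets (laguerre_measure \<nu>) = sets borel"
  by (simp add: laguerre_measure_eq)

lemma borel_measurable_laguerre_measure:
  "f \<in> borel_measurable (laguerre_measure \<nu>) \<longleftrightarrow> f \<in> borel_measurable borel"
  by (simp add: measurable_cong_sets[OF sets_laguerre_measure refl])

lemma nn_integral_laguerre_measure:
  assumes "f \<in> borel_measurable borel"
  shows "(\<integral>\<^sup>+x. f x \<partial>laguerre_measure \<nu>) = (\<integral>\<^sup>+x. ennreal (gamma_weight \<nu> x / Gamma (\<nu> + 1)) * f x \<partial>lborel)"
  using assms unfolding laguerre_measure_eq by (subst nn_integral_density) auto

lemma orthogonal_laguerre:
  assumes "\<nu> > -1"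
  shows "orthogonal_functions (laguerre_measure \<nu>) (\<lambda>n. poly (laguerre \<nu> n))
           (\<lambda>n. Gamma (real n + \<nu> + 1) / (fact n * Gamma (\<nu> + 1)))"
  unfolding orthogonal_functions_def
proof (intro conjI allI)
  have G: "Gamma (\<nu> + 1) > 0" using assms by (intro Gamma_real_pos) auto
  have [measurable]: "poly p \<in> borel_measurable borel" for p :: "real poly"
    by (intro borel_measurable_continuous_onI continuous_intros)
  show "poly (laguerre \<nu> n) \<in> borel_measurable (laguerre_measure \<nu>)" for n
    by measurable
  have w: "0 \<le> gamma_weight \<nu> x / Gamma (\<nu> + 1)" for x
    using G by (simp add: gamma_weight_nonneg)
  fix m n
  let ?p = "laguerre \<nu> m * laguerre \<nu> n"
  have eq: "(gamma_weight \<nu> x / Gamma (\<nu> + 1)) *\<^sub>R (poly (laguerre \<nu> m) x * poly (laguerre \<nu> n) x) =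
        (poly ?p x * gamma_weight \<nu> x) / Gamma (\<nu> + 1)" for x by simp
  show "integrable (laguerre_measure \<nu>) (\<lambda>x. poly (laguerre \<nu> m) x * poly (laguerre \<nu> n) x)"
    unfolding laguerre_measure_eq
    by (subst integrable_density)
       (use integrable_poly_gamma_weight[OF assms, of ?p] w in \<open>auto simp only: eq intro!: integrable_divide\<close>, measurable)
  have "(LINT x|laguerre_measure \<nu>. poly (laguerre \<nu> m) x * poly (laguerre \<nu> n) x) =
        gamma_integral \<nu> ?p / Gamma (\<nu> + 1)"
    unfolding laguerre_measure_eq gamma_integral_def
    by (subst integral_density) (use w in \<open>auto simp only: eq integral_divide_zero\<close>, measurable)
  then show "(LINT x|laguerre_measure \<nu>. poly (laguerre \<nu> m) x * poly (laguerre \<nu> n) x) =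
        (if m = n then Gamma (real n + \<nu> + 1) / (fact n * Gamma (\<nu> + 1)) else 0)"
    using is_laguerre_laguerre_poly[OF assms] by (simp add: is_laguerre_iff laguerre_eq[OF assms])
qed

section \<open>Radial functions\<close>

text \<open>
  On a half-line \<open>{..a}\<close> the left-hand side is the volume of a ball of radius \<open>sqrt (a / \<kappa>)\<close>.
\<close>

lemma distr_norm_sq:
  fixes \<kappa> :: real
  assumes \<kappa>: "\<kappa> > 0"
  defines "D \<equiv> real DIM('a::euclidean_space)"
  shows "distr (lborel :: 'a measure) borel (\<lambda>x. \<kappa> * (norm x)\<^sup>2) =
         density lborel (\<lambda>r. ennreal ((pi / \<kappa>) powr (D / 2) * (indicator {0<..} r * r powr (D / 2 - 1) / Gamma (D / 2))))"
    (is "?M = density lborel ?w")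
proof (rule measure_eqI_generator_eq)
  have D: "D > 0" by (simp add: D_def)
  have GD: "Gamma (D / 2) > 0" using D by (intro Gamma_real_pos) auto
  show "Int_stable (range (\<lambda>a::real. {..a}))"
    by (auto simp: Int_stable_def)
  show "range (\<lambda>a::real. {..a}) \<subseteq> Pow UNIV" by simp
  show "sets ?M = sigma_sets UNIV (range (\<lambda>a. {..a}))" "sets (density lborel ?w) = sigma_sets UNIV (range (\<lambda>a. {..a}))"
    by (simp_all add: borel_eq_atMost)
  show "range (\<lambda>i::nat. {..real i}) \<subseteq> range (\<lambda>a::real. {..a})" by auto
  show "(\<Union>i::nat. {..real i}) = UNIV" using real_arch_simple by auto
  have eM: "emeasure ?M {..a} = (if a < 0 then 0 else ennreal (pi powr (D / 2) / Gamma (D / 2 + 1) * (a / \<kappa>) powr (D / 2)))" for a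
  proof -
    have "emeasure ?M {..a} = emeasure lborel {x::'a. \<kappa> * (norm x)\<^sup>2 \<le> a}"
      by (subst emeasure_distr) (auto intro!: arg_cong2[where f=emeasure])
    also have "\<dots> = (if a < 0 then 0 else ennreal (pi powr (D / 2) / Gamma (D / 2 + 1) * (a / \<kappa>) powr (D / 2)))"
    proof (cases "a < 0")
      case True
      have "\<not> \<kappa> * (norm x)\<^sup>2 \<le> a" for x :: 'a
        using True \<kappa> mult_nonneg_nonneg[of \<kappa> "(norm x)\<^sup>2"] zero_le_power2[of "norm x"] by linarith
      then show ?thesis using True by simp
    next
      case False
      have "\<kappa> * (norm x)\<^sup>2 \<le> a \<longleftrightarrow> norm x \<le> sqrt (a / \<kappa>)" for x :: 'a
      proof -
        have "\<kappa> * (norm x)\<^sup>2 \<le> a \<longleftrightarrow> (norm x)\<^sup>2 \<le> a / \<kappa>"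
          using \<kappa> by (simp add: pos_le_divide_eq mult.commute)
        also have "\<dots> \<longleftrightarrow> sqrt ((norm x)\<^sup>2) \<le> sqrt (a / \<kappa>)"
          by (rule real_sqrt_le_iff[symmetric])
        finally show ?thesis by simp
      qed
      then have "{x::'a. \<kappa> * (norm x)\<^sup>2 \<le> a} = cball 0 (sqrt (a / \<kappa>))"
        by (simp only: set_eq_iff mem_Collect_eq mem_cball dist_0_norm) simp
      moreover have "sqrt (a / \<kappa>) ^ DIM('a) = (a / \<kappa>) powr (D / 2)"
      proof (cases "a = 0")
        case False
        with \<open>\<not> a < 0\<close> \<kappa> have "a / \<kappa> > 0" by auto
        then have "sqrt (a / \<kappa>) ^ DIM('a) = ((a / \<kappa>) powr (1 / 2)) ^ DIM('a)"
          by (simp only: powr_half_sqrt less_imp_le)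
        also have "\<dots> = (a / \<kappa>) powr (real DIM('a) * (1 / 2))"
          by (rule powr_power) (use False \<kappa> in auto)
        finally show ?thesis by (simp add: D_def)
      qed (use D in \<open>simp add: D_def\<close>)
      ultimately show ?thesis using False \<kappa>
        by (simp add: emeasure_cball unit_ball_vol_def D_def)
    qed
    finally show ?thesis .
  qed
  show "emeasure ?M {..real i} \<noteq> \<infinity>" for i by (simp add: eM)
  fix X assume "X \<in> range (\<lambda>a::real. {..a})"
  then obtain a where X: "X = {..a}" by auto
  have "emeasure (density lborel ?w) X = (\<integral>\<^sup>+r. ?w r * indicator {..a} r \<partial>lborel)"
    by (subst emeasure_density) (auto simp: X)
  also have "\<dots> = (if a < 0 then 0 else ennreal (pi powr (D / 2) / Gamma (D / 2 + 1) * (a / \<kappa>) powr (D / 2)))"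
  proof (cases "a < 0")
    case True
    then have 0: "?w r * indicator {..a} r = 0" for r by (auto simp: indicator_def)
    show ?thesis unfolding 0 using True by simp
  next
    case False
    define C where "C = (pi / \<kappa>) powr (D / 2) / Gamma (D / 2)"
    have C: "C \<ge> 0" using GD by (simp add: C_def)
    have "(\<integral>\<^sup>+r. ?w r * indicator {..a} r \<partial>lborel) =
          (\<integral>\<^sup>+r. ennreal C * ennreal (indicator {0..a} r * r powr (D / 2 - 1)) \<partial>lborel)"
      by (intro nn_integral_cong) (use C GD in \<open>auto simp: indicator_def C_def ennreal_mult[symmetric]\<close>)
    also have "\<dots> = ennreal C * (\<integral>\<^sup>+r. ennreal (indicator {0..a} r * r powr (D / 2 - 1)) \<partial>lborel)"
      by (rule nn_integral_cmult) auto
    also have "(\<integral>\<^sup>+r. ennreal (indicator {0..a} r * r powr (D / 2 - 1)) \<partial>lborel) =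
               ennreal (a powr (D / 2 - 1 + 1) / (D / 2 - 1 + 1))"
      by (rule nn_integral_has_integral_lebesgue[OF _ has_integral_powr_from_0]) (use False D in auto)
    also have "ennreal C * \<dots> = ennreal (C * (a powr (D / 2) / (D / 2)))"
      by (simp only: ennreal_mult'[OF C] diff_add_cancel)
    also have "C * (a powr (D / 2) / (D / 2)) = pi powr (D / 2) / Gamma (D / 2 + 1) * (a / \<kappa>) powr (D / 2)"
    proof -
      have "D / 2 \<notin> \<int>\<^sub>\<le>\<^sub>0" using D nonpos_Ints_nonpos[of "D / 2"] by auto
      then have G: "Gamma (D / 2 + 1) = D / 2 * Gamma (D / 2)" by (rule Gamma_plus1)
      show ?thesis unfolding G C_def using False \<kappa> D GD by (simp add: powr_divide mult_ac)
    qed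
    finally show ?thesis using False by simp
  qed
  finally show "emeasure ?M X = emeasure (density lborel ?w) X" by (simp add: X eM)
qed

text \<open>
  Polar coordinates in the form used here: \<open>\<kappa> |x|\<^sup>2\<close> under the Gaussian \<open>exp (- \<kappa> |x|\<^sup>2)\<close> is
  distributed according to the Laguerre weight, up to a constant.
\<close>

lemma nn_integral_radial_gaussian:
  fixes \<kappa> :: real and H :: "real \<Rightarrow> ennreal"
  assumes \<kappa>: "\<kappa> > 0" and [measurable]: "H \<in> borel_measurable borel"
  defines "D \<equiv> real DIM('a::euclidean_space)"
  shows "(\<integral>\<^sup>+(x::'a). H (\<kappa> * (norm x)\<^sup>2) * ennreal (exp (- \<kappa> * (norm x)\<^sup>2)) \<partial>lborel) =
         ennreal ((pi / \<kappa>) powr (D / 2)) * (\<integral>\<^sup>+r. H r \<partial>laguerre_measure (D / 2 - 1))"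
proof -
  have D: "D > 0" by (simp add: D_def)
  have GD: "Gamma (D / 2) > 0" using D by (intro Gamma_real_pos) auto
  let ?c = "(pi / \<kappa>) powr (D / 2)"
  have "(\<integral>\<^sup>+(x::'a). H (\<kappa> * (norm x)\<^sup>2) * ennreal (exp (- \<kappa> * (norm x)\<^sup>2)) \<partial>lborel) =
        (\<integral>\<^sup>+r. H r * ennreal (exp (- r)) \<partial>distr (lborel :: 'a measure) borel (\<lambda>x. \<kappa> * (norm x)\<^sup>2))"
    by (subst nn_integral_distr) auto
  also have "\<dots> = (\<integral>\<^sup>+r. ennreal (?c * (indicator {0<..} r * r powr (D / 2 - 1) / Gamma (D / 2))) * (H r * ennreal (exp (- r))) \<partial>lborel)"
    unfolding distr_norm_sq[OF \<kappa>] D_def[symmetric] by (subst nn_integral_density) auto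
  also have "\<dots> = (\<integral>\<^sup>+r. ennreal ?c * (ennreal (gamma_weight (D / 2 - 1) r / Gamma (D / 2 - 1 + 1)) * H r) \<partial>lborel)"
  proof (intro nn_integral_cong)
    fix r
    have "?c * (indicator {0<..} r * r powr (D / 2 - 1) / Gamma (D / 2)) * exp (- r) =
          ?c * (gamma_weight (D / 2 - 1) r / Gamma (D / 2 - 1 + 1))"
      by (simp add: gamma_weight_def)
    then have *: "ennreal (?c * (indicator {0<..} r * r powr (D / 2 - 1) / Gamma (D / 2))) * ennreal (exp (- r)) =
          ennreal ?c * ennreal (gamma_weight (D / 2 - 1) r / Gamma (D / 2 - 1 + 1))"
      using GD by (simp add: gamma_weight_nonneg flip: ennreal_mult)
    have "ennreal (?c * (indicator {0<..} r * r powr (D / 2 - 1) / Gamma (D / 2))) * (H r * ennreal (exp (- r))) =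
      ennreal (?c * (indicator {0<..} r * r powr (D / 2 - 1) / Gamma (D / 2))) * ennreal (exp (- r)) * H r"
      by (simp only: mult_ac)
    also have "\<dots> = ennreal ?c * (ennreal (gamma_weight (D / 2 - 1) r / Gamma (D / 2 - 1 + 1)) * H r)"
      unfolding * by (simp only: mult_ac)
    finally show "ennreal (?c * (indicator {0<..} r * r powr (D / 2 - 1) / Gamma (D / 2))) * (H r * ennreal (exp (- r))) =
      ennreal ?c * (ennreal (gamma_weight (D / 2 - 1) r / Gamma (D / 2 - 1 + 1)) * H r)" .
  qed
  also have "\<dots> = ennreal ?c * (\<integral>\<^sup>+r. ennreal (gamma_weight (D / 2 - 1) r / Gamma (D / 2 - 1 + 1)) * H r \<partial>lborel)"
    by (rule nn_integral_cmult) measurable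
  also have "\<dots> = ennreal ?c * (\<integral>\<^sup>+r. H r \<partial>laguerre_measure (D / 2 - 1))"
    by (simp add: nn_integral_laguerre_measure)
  finally show ?thesis .
qed

lemma nn_integral_lborel_shift:
  fixes y :: "'a::euclidean_space" and F :: "'a \<Rightarrow> ennreal"
  assumes [measurable]: "F \<in> borel_measurable borel"
  shows "(\<integral>\<^sup>+x. F (x - y) \<partial>lborel) = (\<integral>\<^sup>+x. F x \<partial>lborel)"
proof -
  have "(\<integral>\<^sup>+x. F x \<partial>lborel) = (\<integral>\<^sup>+x. F x \<partial>distr lborel borel ((+) (- y)))"
    by (simp only: lborel_distr_plus)
  also have "\<dots> = (\<integral>\<^sup>+x. F (x - y) \<partial>lborel)"
    by (subst nn_integral_distr) (auto simp: algebra_simps)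
  finally show ?thesis by simp
qed

text \<open>
  These functions dominate the kernels and the modes in the limit arguments below.
\<close>

lemma gaussian_moment_L2:
  fixes y :: "'a::euclidean_space"
  assumes \<delta>: "\<delta> > 0"
  shows "(\<lambda>x. of_real ((1 + (norm (x - y))\<^sup>2) ^ m * exp (- \<delta> * (norm (x - y))\<^sup>2))) \<in> L2 lborel"
proof -
  define D where "D = real DIM('a)"
  have D: "D / 2 - 1 > -1" by (simp add: D_def)
  define p where "p = [:1, 1 / (2 * \<delta>):] ^ (2 * m)"
  have p0: "poly p r = (1 + r / (2 * \<delta>)) ^ (2 * m)" for r by (simp add: p_def)
  have pn: "poly p r \<ge> 0" for r unfolding p0 power_mult by simp
  have [measurable]: "poly p \<in> borel_measurable borel"
    by (intro borel_measurable_continuous_onI continuous_intros)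
  have "sqint lborel (\<lambda>x::'a. of_real ((1 + (norm (x - y))\<^sup>2) ^ m * exp (- \<delta> * (norm (x - y))\<^sup>2))) =
        (\<integral>\<^sup>+(x::'a). ennreal (((1 + (norm (x - y))\<^sup>2) ^ m * exp (- \<delta> * (norm (x - y))\<^sup>2))\<^sup>2) \<partial>lborel)"
    unfolding sqint_def norm_of_real power2_abs ..
  also have "\<dots> = (\<integral>\<^sup>+(x::'a). ennreal (((1 + (norm x)\<^sup>2) ^ m * exp (- \<delta> * (norm x)\<^sup>2))\<^sup>2) \<partial>lborel)"
    by (rule nn_integral_lborel_shift) measurable
  also have "\<dots> = (\<integral>\<^sup>+(x::'a). ennreal (poly p (2 * \<delta> * (norm x)\<^sup>2)) * ennreal (exp (- (2 * \<delta>) * (norm x)\<^sup>2)) \<partial>lborel)"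
    using \<delta> pn by (intro nn_integral_cong)
      (simp add: p0 power_mult_distrib flip: ennreal_mult exp_double power_mult, simp add: mult.commute)
  also have "\<dots> = ennreal ((pi / (2 * \<delta>)) powr (D / 2)) * (\<integral>\<^sup>+r. ennreal (poly p r) \<partial>laguerre_measure (D / 2 - 1))"
    unfolding D_def using \<delta> by (intro nn_integral_radial_gaussian) auto
  finally have eq: "sqint lborel (\<lambda>x::'a. of_real ((1 + (norm (x - y))\<^sup>2) ^ m * exp (- \<delta> * (norm (x - y))\<^sup>2))) =
     ennreal ((pi / (2 * \<delta>)) powr (D / 2)) * (\<integral>\<^sup>+r. ennreal (poly p r) \<partial>laguerre_measure (D / 2 - 1))" .
  have "(\<integral>\<^sup>+r. ennreal (poly p r) \<partial>laguerre_measure (D / 2 - 1)) =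
             (\<integral>\<^sup>+r. ennreal (poly p r * gamma_weight (D / 2 - 1) r / Gamma (D / 2 - 1 + 1)) \<partial>lborel)"
    using D pn Gamma_real_pos[of "D / 2 - 1 + 1"]
    by (subst nn_integral_laguerre_measure)
       (auto intro!: nn_integral_cong simp: gamma_weight_nonneg mult.commute simp flip: ennreal_mult)
  also have "\<dots> < \<infinity>"
    using integrable_divide[OF integrable_poly_gamma_weight[OF D, of p], of "Gamma (D / 2 - 1 + 1)"]
      pn D Gamma_real_pos[of "D / 2 - 1 + 1"]
    by (subst (asm) integrable_iff_bounded) (auto simp: gamma_weight_nonneg abs_mult)
  finally have "sqint lborel (\<lambda>x::'a. of_real ((1 + (norm (x - y))\<^sup>2) ^ m * exp (- \<delta> * (norm (x - y))\<^sup>2))) < top"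
    unfolding eq by (simp add: ennreal_mult_less_top)
  then show ?thesis unfolding L2_iff by (intro conjI) measurable
qed

subsection \<open>Differentiation of radial functions\<close>

lemma has_derivative_norm_sq_shift:
  "((\<lambda>x::'a::euclidean_space. (norm (x - y))\<^sup>2) has_derivative (\<lambda>h. 2 * ((x - y) \<bullet> h))) (at x)"
  unfolding power2_norm_eq_inner
  by (auto intro!: derivative_eq_intros simp: inner_commute)

lemma has_derivative_radial:
  fixes H :: "real \<Rightarrow> complex" and y :: "'a::euclidean_space"
  assumes "(H has_vector_derivative H') (at ((norm (x - y))\<^sup>2))"
  shows "((\<lambda>x. H ((norm (x - y))\<^sup>2)) has_derivative (\<lambda>h. (2 * ((x - y) \<bullet> h)) *\<^sub>R H')) (at x)"
  using diff_chain_at[OF has_derivative_norm_sq_shift assms[unfolded has_vector_derivative_def]]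
  by (simp add: o_def)

lemma has_derivative_coordinate_radial:
  fixes K :: "real \<Rightarrow> complex" and y :: "'a::euclidean_space"
  assumes "(K has_vector_derivative K') (at ((norm (x - y))\<^sup>2))"
  shows "((\<lambda>x. (2 * ((x - y) \<bullet> b)) *\<^sub>R K ((norm (x - y))\<^sup>2)) has_derivative
          (\<lambda>h. (2 * ((x - y) \<bullet> b)) *\<^sub>R ((2 * ((x - y) \<bullet> h)) *\<^sub>R K') + (2 * (h \<bullet> b)) *\<^sub>R K ((norm (x - y))\<^sup>2))) (at x)"
  by (rule has_derivative_scaleR[OF _ has_derivative_radial[OF assms]]) (auto intro!: derivative_eq_intros)

context
  fixes H H' H'' :: "real \<Rightarrow> complex" and y :: "'a::euclidean_space"
  assumes H: "\<And>r. (H has_vector_derivative H' r) (at r)"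
    and H': "\<And>r. (H' has_vector_derivative H'' r) (at r)"
begin

lemma partial_deriv_radial:
  "partial_deriv b (\<lambda>x. H ((norm (x - y))\<^sup>2)) = (\<lambda>x. (2 * ((x - y) \<bullet> b)) *\<^sub>R H' ((norm (x - y))\<^sup>2))"
proof
  fix x
  show "partial_deriv b (\<lambda>x. H ((norm (x - y))\<^sup>2)) x = (2 * ((x - y) \<bullet> b)) *\<^sub>R H' ((norm (x - y))\<^sup>2)"
    unfolding partial_deriv_def frechet_derivative_at[OF has_derivative_radial[OF H], symmetric] ..
qed

lemma partial_deriv_partial_deriv_radial:
  "partial_deriv c (partial_deriv b (\<lambda>x. H ((norm (x - y))\<^sup>2))) =
    (\<lambda>x. (2 * ((x - y) \<bullet> b)) *\<^sub>R ((2 * ((x - y) \<bullet> c)) *\<^sub>R H'' ((norm (x - y))\<^sup>2)) + (2 * (c \<bullet> b)) *\<^sub>R H' ((norm (x - y))\<^sup>2))"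
proof
  fix x
  show "partial_deriv c (partial_deriv b (\<lambda>x. H ((norm (x - y))\<^sup>2))) x =
    (2 * ((x - y) \<bullet> b)) *\<^sub>R ((2 * ((x - y) \<bullet> c)) *\<^sub>R H'' ((norm (x - y))\<^sup>2)) + (2 * (c \<bullet> b)) *\<^sub>R H' ((norm (x - y))\<^sup>2)"
    unfolding partial_deriv_radial
    unfolding partial_deriv_def frechet_derivative_at[OF has_derivative_coordinate_radial[OF H'], symmetric] ..
qed

lemma laplacian_radial:
  "laplacian (\<lambda>x. H ((norm (x - y))\<^sup>2)) x =
     (4 * (norm (x - y))\<^sup>2) *\<^sub>R H'' ((norm (x - y))\<^sup>2) + (2 * real DIM('a)) *\<^sub>R H' ((norm (x - y))\<^sup>2)"
proof -
  have "laplacian (\<lambda>x. H ((norm (x - y))\<^sup>2)) x =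
    (\<Sum>b\<in>Basis. (4 * (((x - y) \<bullet> b) * ((x - y) \<bullet> b))) *\<^sub>R H'' ((norm (x - y))\<^sup>2) + 2 *\<^sub>R H' ((norm (x - y))\<^sup>2))"
    unfolding laplacian_def partial_deriv_partial_deriv_radial by (intro sum.cong) auto
  also have "\<dots> = (4 * ((x - y) \<bullet> (x - y))) *\<^sub>R H'' ((norm (x - y))\<^sup>2) + (2 * real DIM('a)) *\<^sub>R H' ((norm (x - y))\<^sup>2)"
    by (subst (3) euclidean_inner) (simp add: sum.distrib sum_distrib_left scaleR_sum_left mult.commute scaleR_conv_of_real)
  finally show ?thesis by (simp only: power2_norm_eq_inner)
qed

lemma test_function_radial:
  assumes cont: "continuous_on UNIV H''" and supp: "\<And>r. R\<^sup>2 \<le> r \<Longrightarrow> H r = 0" and R: "0 \<le> R"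
  shows "test_function (\<lambda>x. H ((norm (x - y))\<^sup>2))"
  unfolding test_function_def
proof (intro conjI ballI)
  have "{x. H ((norm (x - y))\<^sup>2) \<noteq> 0} \<subseteq> cball y R"
  proof
    fix x assume "x \<in> {x. H ((norm (x - y))\<^sup>2) \<noteq> 0}"
    then have "\<not> R\<^sup>2 \<le> (norm (x - y))\<^sup>2" using supp by auto
    then show "x \<in> cball y R"
      using R by (simp add: dist_norm norm_minus_commute power2_le_iff_abs_le not_le)
  qed
  then show "bounded {x. H ((norm (x - y))\<^sup>2) \<noteq> 0}"
    using bounded_cball bounded_subset by blast
  show "(\<lambda>x. H ((norm (x - y))\<^sup>2)) differentiable_on UNIV"
    unfolding differentiable_on_def differentiable_def using has_derivative_radial[OF H] by auto
  fix b assume "b \<in> (Basis :: 'a set)"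
  show "partial_deriv b (\<lambda>x. H ((norm (x - y))\<^sup>2)) differentiable_on UNIV"
    unfolding differentiable_on_def differentiable_def partial_deriv_radial
    using has_derivative_coordinate_radial[OF H'] by blast
  have cH': "continuous_on UNIV H'"
    using H' by (meson continuous_at_imp_continuous_on has_vector_derivative_continuous)
  fix c assume "c \<in> (Basis :: 'a set)"
  show "continuous_on UNIV (partial_deriv c (partial_deriv b (\<lambda>x. H ((norm (x - y))\<^sup>2))))"
    unfolding partial_deriv_partial_deriv_radial
    by (intro continuous_intros continuous_on_compose2[OF cont] continuous_on_compose2[OF cH']) auto
qed

end

section \<open>Uniqueness of weak solutions of the Schroedinger equation\<close>

text \<open>
  Difference quotients along sequences are the form in which dominated convergence applies.
\<close>

lemma has_vector_derivative_iff_quotient: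
  fixes f :: "real \<Rightarrow> complex"
  shows "(f has_vector_derivative v) (at t) \<longleftrightarrow> ((\<lambda>s. (f s - f t) / of_real (s - t)) \<longlongrightarrow> v) (at t)"
proof -
  have "(f has_vector_derivative v) (at t) \<longleftrightarrow>
        ((\<lambda>s. norm ((1 / norm (s - t)) *\<^sub>R (f s - (f t + (s - t) *\<^sub>R v)))) \<longlongrightarrow> 0) (at t)"
    unfolding has_vector_derivative_def has_derivative_within tendsto_norm_zero_iff
    by (simp add: bounded_linear_scaleR_left)
  also have "\<dots> \<longleftrightarrow> ((\<lambda>s. norm ((f s - f t) / of_real (s - t) - v)) \<longlongrightarrow> 0) (at t)"
  proof (rule filterlim_cong[OF refl refl])
    show "\<forall>\<^sub>F s in at t. norm ((1 / norm (s - t)) *\<^sub>R (f s - (f t + (s - t) *\<^sub>R v))) = norm ((f s - f t) / of_real (s - t) - v)"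
      unfolding eventually_at_filter
    proof (intro always_eventually allI impI)
      fix s assume "s \<noteq> t"
      then have "(f s - f t) / of_real (s - t) - v = (f s - (f t + (s - t) *\<^sub>R v)) / of_real (s - t)"
        by (simp add: scaleR_conv_of_real divide_simps)
      then show "norm ((1 / norm (s - t)) *\<^sub>R (f s - (f t + (s - t) *\<^sub>R v))) = norm ((f s - f t) / of_real (s - t) - v)"
        by (simp only: norm_divide norm_of_real norm_scaleR) simp
    qed
  qed
  also have "\<dots> \<longleftrightarrow> ((\<lambda>s. (f s - f t) / of_real (s - t)) \<longlongrightarrow> v) (at t)"
    unfolding tendsto_norm_zero_iff by (rule LIM_zero_iff)
  finally show ?thesis .
qed

lemma vector_derivative_bound:
  fixes f :: "real \<Rightarrow> complex"
  assumes f: "\<And>s. s \<in> S \<Longrightarrow> (f has_vector_derivative f' s) (at s)" and S: "convex S"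
    and B: "\<And>s. s \<in> S \<Longrightarrow> cmod (f' s) \<le> B" and ab: "a \<in> S" "b \<in> S"
  shows "cmod (f b - f a) \<le> B * \<bar>b - a\<bar>"
proof -
  have "norm (f b - f a) \<le> B * norm (b - a)"
  proof (rule differentiable_bound[OF S _ _ ab(2,1)])
    fix x assume x: "x \<in> S"
    show "(f has_derivative (\<lambda>h. h *\<^sub>R f' x)) (at x within S)"
      using f[OF x] by (auto simp: has_vector_derivative_def intro: has_derivative_at_withinI)
    have "0 \<le> B" using B[OF x] norm_ge_zero order_trans by blast
    then show "onorm (\<lambda>h. h *\<^sub>R f' x) \<le> B"
      by (rule onorm_bound) (use B[OF x] in \<open>simp add: mult.commute[of _ "cmod (f' x)"] mult_right_mono\<close>)
  qed
  then show ?thesis by simp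
qed

subsection \<open>Test functions\<close>

lemma continuous_bounded_support_L2:
  fixes \<phi> :: "'a::euclidean_space \<Rightarrow> complex"
  assumes c: "continuous_on UNIV \<phi>" and b: "bounded {x. \<phi> x \<noteq> 0}"
  shows "\<phi> \<in> L2 lborel"
proof -
  have [measurable]: "\<phi> \<in> borel_measurable borel" by (rule borel_measurable_continuous_onI[OF c])
  let ?S = "closure {x. \<phi> x \<noteq> 0}"
  have "integrable lborel (\<lambda>x. indicat_real ?S x *\<^sub>R (cmod (\<phi> x))\<^sup>2)"
    by (intro borel_integrable_compact continuous_intros continuous_on_subset[OF c])
       (use b in \<open>auto simp: compact_closure\<close>)
  also have "(\<lambda>x. indicat_real ?S x *\<^sub>R (cmod (\<phi> x))\<^sup>2) = (\<lambda>x. (cmod (\<phi> x))\<^sup>2)"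
  proof
    fix x
    show "indicat_real ?S x *\<^sub>R (cmod (\<phi> x))\<^sup>2 = (cmod (\<phi> x))\<^sup>2"
      using closure_subset[of "{x. \<phi> x \<noteq> 0}"] by (cases "\<phi> x = 0") (auto simp: indicator_def)
  qed
  finally show ?thesis
    by (auto simp: L2_iff sqint_def integrable_iff_bounded)
qed

text \<open>
  Off the closure of its support the function vanishes near the point.
\<close>

lemma support_partial_deriv:
  "{x. partial_deriv b \<phi> x \<noteq> 0} \<subseteq> closure {x. \<phi> x \<noteq> 0}"
proof
  fix x assume x: "x \<in> {x. partial_deriv b \<phi> x \<noteq> 0}"
  show "x \<in> closure {x. \<phi> x \<noteq> 0}"
  proof (rule ccontr)
    assume "x \<notin> closure {x. \<phi> x \<noteq> 0}"
    then have x': "x \<in> - closure {x. \<phi> x \<noteq> 0}" by simp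
    have "0 = \<phi> y" if "y \<in> - closure {x. \<phi> x \<noteq> 0}" for y
      using that closure_subset[of "{x. \<phi> x \<noteq> 0}"] by auto
    then have d: "(\<phi> has_derivative (\<lambda>_. 0)) (at x)"
      by (rule has_derivative_transform_within_open[OF has_derivative_const open_Compl[OF closed_closure] x'])
    then have "partial_deriv b \<phi> x = 0"
      by (simp add: partial_deriv_def frechet_derivative_at[OF d, symmetric])
    then show False using x by simp
  qed
qed

lemma test_function_continuous: "test_function \<phi> \<Longrightarrow> continuous_on UNIV \<phi>"
  by (auto simp: test_function_def intro: differentiable_imp_continuous_on)

lemma test_function_L2: "test_function \<phi> \<Longrightarrow> \<phi> \<in> L2 lborel"
  by (rule continuous_bounded_support_L2[OF test_function_continuous]) (auto simp: test_function_def)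

lemma laplacian_test_function:
  assumes "test_function \<phi>"
  shows "continuous_on UNIV (laplacian \<phi>)" "bounded {x. laplacian \<phi> x \<noteq> 0}"
proof -
  show "continuous_on UNIV (laplacian \<phi>)"
    using assms unfolding laplacian_def[abs_def] test_function_def by (intro continuous_on_sum) auto
  have b: "bounded {x. \<phi> x \<noteq> 0}" using assms by (simp add: test_function_def)
  have "bounded {x. partial_deriv b (partial_deriv b \<phi>) x \<noteq> 0}" for b
    by (intro bounded_subset[OF bounded_closure[OF bounded_subset[OF bounded_closure[OF b] support_partial_deriv]] support_partial_deriv])
  then have "bounded (\<Union>b\<in>Basis. {x. partial_deriv b (partial_deriv b \<phi>) x \<noteq> 0})" by auto
  moreover have "{x. laplacian \<phi> x \<noteq> 0} \<subseteq> (\<Union>b\<in>Basis. {x. partial_deriv b (partial_deriv b \<phi>) x \<noteq> 0})"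
    unfolding laplacian_def using sum.neutral by fastforce
  ultimately show "bounded {x. laplacian \<phi> x \<noteq> 0}" by (rule bounded_subset)
qed

lemma laplacian_test_function_L2: "test_function \<phi> \<Longrightarrow> laplacian \<phi> \<in> L2 lborel"
  by (intro continuous_bounded_support_L2 laplacian_test_function)

subsection \<open>Pairing a solution with a moving test function\<close>

lemma schroedinger_solution_diff:
  assumes u: "is_schroedinger_solution f u" and v: "is_schroedinger_solution f v"
  shows "is_schroedinger_solution (\<lambda>_. 0) (\<lambda>t x. u t x - v t x)"
  unfolding is_schroedinger_solution_def
proof (intro conjI allI impI)
  have uL: "u t \<in> L2 lborel" and vL: "v t \<in> L2 lborel" for t
    using u v by (auto simp: is_schroedinger_solution_def)
  note [measurable] = uL[THEN L2_measurable] vL[THEN L2_measurable]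
  show "(\<lambda>x. u t x - v t x) \<in> L2 lborel" for t by (intro L2_diff uL vL)
  have "AE x in lborel. u 0 x = f x" "AE x in lborel. v 0 x = f x"
    using u v by (auto simp: is_schroedinger_solution_def)
  then show "AE x in lborel. u 0 x - v 0 x = 0" by eventually_elim simp
  fix t
  have lim: "((\<lambda>s. sqint lborel (\<lambda>x. u s x - u t x)) \<longlongrightarrow> 0) (at t)" "((\<lambda>s. sqint lborel (\<lambda>x. v s x - v t x)) \<longlongrightarrow> 0) (at t)"
    using u v by (simp_all add: is_schroedinger_solution_def tendsto_Lp_norm_2_iff)
  have "((\<lambda>s. 2 * sqint lborel (\<lambda>x. u s x - u t x) + 2 * sqint lborel (\<lambda>x. v s x - v t x)) \<longlongrightarrow> 2 * 0 + 2 * 0) (at t)"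
    by (intro tendsto_add tendsto_mult_ennreal lim tendsto_const) auto
  moreover have "sqint lborel (\<lambda>x. u s x - v s x - (u t x - v t x)) \<le>
     2 * sqint lborel (\<lambda>x. u s x - u t x) + 2 * sqint lborel (\<lambda>x. v s x - v t x)" for s
    using sqint_diff_le[of "\<lambda>x. u s x - u t x" lborel "\<lambda>x. v s x - v t x"] by (simp add: algebra_simps)
  ultimately have "((\<lambda>s. sqint lborel (\<lambda>x. u s x - v s x - (u t x - v t x))) \<longlongrightarrow> 0) (at t)"
    by - (rule tendsto_ennreal_0_le, assumption, assumption, simp)
  then show "((\<lambda>s. Lp_norm lborel 2 (\<lambda>x. u s x - v s x - (u t x - v t x))) \<longlongrightarrow> 0) (at t)"
    by (simp only: tendsto_Lp_norm_2_iff)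
  fix \<phi> :: "'a \<Rightarrow> complex" assume \<phi>: "test_function \<phi>"
  note L = test_function_L2[OF \<phi>] laplacian_test_function_L2[OF \<phi>]
  have eq: "(LINT x|lborel. (u s x - v s x) * \<psi> x) = (LINT x|lborel. u s x * \<psi> x) - (LINT x|lborel. v s x * \<psi> x)"
    if "\<psi> \<in> L2 lborel" for s \<psi>
    using integrable_L2_mult[OF uL that] integrable_L2_mult[OF vL that] by (simp add: left_diff_distrib)
  have "((\<lambda>s. LINT x|lborel. u s x * \<phi> x) has_vector_derivative \<i> * (LINT x|lborel. u t x * laplacian \<phi> x)) (at t)"
       "((\<lambda>s. LINT x|lborel. v s x * \<phi> x) has_vector_derivative \<i> * (LINT x|lborel. v t x * laplacian \<phi> x)) (at t)"
    using u v \<phi> by (auto simp: is_schroedinger_solution_def)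
  from has_vector_derivative_diff[OF this]
  show "((\<lambda>s. LINT x|lborel. (u s x - v s x) * \<phi> x) has_vector_derivative \<i> * (LINT x|lborel. (u t x - v t x) * laplacian \<phi> x)) (at t)"
    by (simp add: eq L right_diff_distrib)
qed

lemma cmod_integral_mult_tendsto_0:
  assumes f: "\<And>n. f n \<in> borel_measurable M" and lim: "(\<lambda>n. sqint M (f n)) \<longlonglongrightarrow> 0"
    and g: "\<And>n. g n \<in> borel_measurable M" and m: "m \<in> L2 M" and gm: "\<And>n x. cmod (g n x) \<le> cmod (m x)"
  shows "(\<lambda>n. LINT x|M. f n x * g n x) \<longlonglongrightarrow> 0"
proof -
  obtain A where A: "A > 0" "sqint M m \<le> ennreal (A\<^sup>2)"
  proof (cases "sqint M m")
    case (real r)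
    have "sqint M m \<le> ennreal ((sqrt (r + 1))\<^sup>2)" using real by (auto intro: ennreal_leI)
    then show thesis using real by (intro that[of "sqrt (r + 1)"]) auto
  next
    case top
    then show thesis using m by (simp add: L2_iff)
  qed
  have gA: "sqint M (g n) \<le> ennreal (A\<^sup>2)" for n
    using sqint_mono_AE[of "g n" m M] gm A(2) by (auto intro: order_trans)
  show ?thesis
  proof (rule LIMSEQ_I)
    fix e :: real assume e: "0 < e"
    have "eventually (\<lambda>n. sqint M (f n) \<le> ennreal ((e / (2 * A))\<^sup>2)) sequentially"
      using lim e A(1) unfolding tendsto_ennreal_0_iff by auto
    then obtain N where N: "\<And>n. n \<ge> N \<Longrightarrow> sqint M (f n) \<le> ennreal ((e / (2 * A))\<^sup>2)"
      by (auto simp: eventually_sequentially)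
    have "norm (LINT x|M. f n x * g n x) < e" if "n \<ge> N" for n
    proof -
      have "cmod (LINT x|M. f n x * g n x) \<le> e / (2 * A) * A"
        using cmod_integral_mult_le[OF f g N[OF that] gA] e A(1) by simp
      also have "\<dots> < e" using e A(1) by simp
      finally show ?thesis .
    qed
    then show "\<exists>N. \<forall>n\<ge>N. norm ((LINT x|M. f n x * g n x) - 0) < e" by auto
  qed
qed

text \<open>
  A product rule. The difference quotient of the pairing splits into the quotient for the fixed test
  function \<open>\<phi> t\<close>, where the weak equation applies, the quotient for the fixed \<open>u t\<close>, where dominated
  convergence applies, and a mixed term that vanishes by continuity of \<open>u\<close> in \<open>L\<^sup>2\<close>.
\<close>

lemma schroedinger_pairing_derivative:
  fixes u \<phi> \<phi>' :: "real \<Rightarrow> 'a::euclidean_space \<Rightarrow> complex"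
  assumes u: "is_schroedinger_solution f u"
    and test: "\<And>s. test_function (\<phi> s)"
    and \<phi>': "\<And>s x. ((\<lambda>s. \<phi> s x) has_vector_derivative \<phi>' s x) (at s)"
    and m: "m \<in> L2 lborel" and bound: "\<And>s x. cmod (\<phi>' s x) \<le> cmod (m x)"
    and meas: "\<And>s. \<phi>' s \<in> borel_measurable borel"
  shows "((\<lambda>s. LINT x|lborel. u s x * \<phi> s x) has_vector_derivative
            (LINT x|lborel. u t x * (\<i> * laplacian (\<phi> t) x + \<phi>' t x))) (at t)"
  unfolding has_vector_derivative_iff_quotient tendsto_at_iff_sequentially o_def
proof (intro allI impI)
  fix X assume X: "\<forall>i. X i \<in> UNIV - {t}" and lim: "X \<longlonglongrightarrow> t"
  have uL: "u t \<in> L2 lborel" for t using u by (auto simp: is_schroedinger_solution_def)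
  have \<phi>L: "\<phi> s \<in> L2 lborel" for s by (rule test_function_L2[OF test])
  note [measurable] = uL[THEN L2_measurable] \<phi>L[THEN L2_measurable] meas
  have \<phi>'L: "\<phi>' t \<in> L2 lborel"
  proof -
    have "sqint lborel (\<phi>' t) \<le> sqint lborel m" by (intro sqint_mono_AE) (use bound in auto)
    then show ?thesis using m by (auto simp: L2_iff intro: le_less_trans)
  qed
  have Xt: "X i \<noteq> t" for i using X by auto
  define q where "q i x = (\<phi> (X i) x - \<phi> t x) / of_real (X i - t)" for i x
  have [measurable]: "q i \<in> borel_measurable borel" for i unfolding q_def by measurable
  have qb: "cmod (q i x) \<le> cmod (m x)" for i x
  proof -
    have "cmod (\<phi> (X i) x - \<phi> t x) \<le> cmod (m x) * \<bar>X i - t\<bar>"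
      by (rule vector_derivative_bound[OF \<phi>' convex_UNIV bound]) auto
    then show ?thesis using Xt[of i] by (simp add: q_def norm_divide divide_simps del: of_real_diff)
  qed
  have qL: "q i \<in> L2 lborel" for i
  proof -
    have "sqint lborel (q i) \<le> sqint lborel m" by (intro sqint_mono_AE) (use qb in auto)
    then show ?thesis using m by (auto simp: L2_iff intro: le_less_trans)
  qed
  have qlim: "(\<lambda>i. q i x) \<longlonglongrightarrow> \<phi>' t x" for x
    using \<phi>'[of x t] X lim
    unfolding has_vector_derivative_iff_quotient tendsto_at_iff_sequentially o_def q_def by blast
  have "(\<lambda>i. ((LINT x|lborel. u (X i) x * \<phi> t x) - (LINT x|lborel. u t x * \<phi> t x)) / of_real (X i - t))
      \<longlonglongrightarrow> \<i> * (LINT x|lborel. u t x * laplacian (\<phi> t) x)"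
    using u test[of t] X lim
    unfolding is_schroedinger_solution_def has_vector_derivative_iff_quotient tendsto_at_iff_sequentially o_def by blast
  moreover have "(\<lambda>i. LINT x|lborel. u t x * q i x) \<longlonglongrightarrow> (LINT x|lborel. u t x * \<phi>' t x)"
  proof (rule integral_dominated_convergence)
    show "integrable lborel (\<lambda>x. cmod (u t x * m x))"
      by (intro integrable_norm integrable_L2_mult uL m)
    show "AE x in lborel. (\<lambda>i. u t x * q i x) \<longlonglongrightarrow> u t x * \<phi>' t x"
      by (intro AE_I2 tendsto_intros qlim)
    show "AE x in lborel. norm (u t x * q i x) \<le> cmod (u t x * m x)" for i
      by (intro AE_I2) (simp add: norm_mult mult_left_mono qb)
  qed measurable
  moreover have "(\<lambda>i. LINT x|lborel. (u (X i) x - u t x) * q i x) \<longlonglongrightarrow> 0"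
  proof (rule cmod_integral_mult_tendsto_0[OF _ _ _ m qb])
    have "((\<lambda>s. sqint lborel (\<lambda>x. u s x - u t x)) \<longlongrightarrow> 0) (at t)"
      using u by (simp add: is_schroedinger_solution_def tendsto_Lp_norm_2_iff)
    then show "(\<lambda>i. sqint lborel (\<lambda>x. u (X i) x - u t x)) \<longlonglongrightarrow> 0"
      using X lim unfolding tendsto_at_iff_sequentially o_def by blast
  qed measurable
  ultimately have "(\<lambda>i. ((LINT x|lborel. u (X i) x * \<phi> t x) - (LINT x|lborel. u t x * \<phi> t x)) / of_real (X i - t)
      + (LINT x|lborel. u t x * q i x) + (LINT x|lborel. (u (X i) x - u t x) * q i x))
      \<longlonglongrightarrow> \<i> * (LINT x|lborel. u t x * laplacian (\<phi> t) x) + (LINT x|lborel. u t x * \<phi>' t x) + 0"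
    by (intro tendsto_add)
  also have "\<i> * (LINT x|lborel. u t x * laplacian (\<phi> t) x) + (LINT x|lborel. u t x * \<phi>' t x) + 0 =
      (LINT x|lborel. u t x * (\<i> * laplacian (\<phi> t) x + \<phi>' t x))"
    using integrable_L2_mult[OF uL[of t] laplacian_test_function_L2[OF test[of t]]] integrable_L2_mult[OF uL[of t] \<phi>'L]
    by (simp add: distrib_left mult.left_commute[of _ "\<i>"])
  also have "(\<lambda>i. ((LINT x|lborel. u (X i) x * \<phi> t x) - (LINT x|lborel. u t x * \<phi> t x)) / of_real (X i - t)
      + (LINT x|lborel. u t x * q i x) + (LINT x|lborel. (u (X i) x - u t x) * q i x)) =
      (\<lambda>i. ((LINT x|lborel. u (X i) x * \<phi> (X i) x) - (LINT x|lborel. u t x * \<phi> t x)) / of_real (X i - t))"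
  proof
    fix i
    let ?h = "complex_of_real (X i - t)"
    have h: "?h \<noteq> 0" using Xt[of i] by simp
    have \<phi>X: "\<phi> (X i) x = \<phi> t x + ?h * q i x" for x
      using h by (simp add: q_def)
    have "(LINT x|lborel. u (X i) x * \<phi> (X i) x) = (LINT x|lborel. u (X i) x * \<phi> t x + ?h * (u (X i) x * q i x))"
      unfolding \<phi>X by (simp only: distrib_left mult_ac)
    also have "\<dots> = (LINT x|lborel. u (X i) x * \<phi> t x) + ?h * (LINT x|lborel. u (X i) x * q i x)"
      using integrable_L2_mult[OF uL[of "X i"] \<phi>L[of t]] integrable_L2_mult[OF uL[of "X i"] qL[of i]] by simp
    finally have 1: "(LINT x|lborel. u (X i) x * \<phi> (X i) x) = (LINT x|lborel. u (X i) x * \<phi> t x) + ?h * (LINT x|lborel. u (X i) x * q i x)" .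
    have 2: "(LINT x|lborel. (u (X i) x - u t x) * q i x) = (LINT x|lborel. u (X i) x * q i x) - (LINT x|lborel. u t x * q i x)"
      using integrable_L2_mult[OF uL[of "X i"] qL[of i]] integrable_L2_mult[OF uL[of t] qL[of i]] by (simp add: left_diff_distrib)
    show "((LINT x|lborel. u (X i) x * \<phi> t x) - (LINT x|lborel. u t x * \<phi> t x)) / ?h
      + (LINT x|lborel. u t x * q i x) + (LINT x|lborel. (u (X i) x - u t x) * q i x) =
      ((LINT x|lborel. u (X i) x * \<phi> (X i) x) - (LINT x|lborel. u t x * \<phi> t x)) / ?h"
      unfolding 1 2 using h by (simp add: add_divide_distrib diff_divide_distrib)
  qed
  finally show "(\<lambda>i. ((LINT x|lborel. u (X i) x * \<phi> (X i) x) - (LINT x|lborel. u t x * \<phi> t x)) / of_real (X i - t))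
     \<longlonglongrightarrow> (LINT x|lborel. u t x * (\<i> * laplacian (\<phi> t) x + \<phi>' t x))" .
qed

text \<open>
  Continuity gives a bound near every time; finitely many neighbourhoods cover \<open>[- S, S]\<close>.
\<close>

lemma schroedinger_solution_locally_bounded:
  assumes u: "is_schroedinger_solution f u"
  obtains B where "B \<ge> 0" "\<And>s. \<bar>s\<bar> \<le> S \<Longrightarrow> sqint lborel (u s) \<le> ennreal (B\<^sup>2)"
proof -
  have uL: "u t \<in> L2 lborel" for t using u by (auto simp: is_schroedinger_solution_def)
  note [measurable] = uL[THEN L2_measurable]
  have "\<exists>U c. open U \<and> t \<in> U \<and> (\<forall>s\<in>U. sqint lborel (u s) \<le> ennreal c) \<and> 0 \<le> c" for t
  proof -
    have "((\<lambda>s. sqint lborel (\<lambda>x. u s x - u t x)) \<longlongrightarrow> 0) (at t)"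
      using u by (simp add: is_schroedinger_solution_def tendsto_Lp_norm_2_iff)
    then have "eventually (\<lambda>s. sqint lborel (\<lambda>x. u s x - u t x) \<le> ennreal 1) (at t)"
      by (simp only: tendsto_ennreal_0_iff zero_less_one)
    then obtain U where U: "open U" "t \<in> U" "\<And>s. s \<in> U \<Longrightarrow> s \<noteq> t \<Longrightarrow> sqint lborel (\<lambda>x. u s x - u t x) \<le> ennreal 1"
      by (auto simp: eventually_at_topological)
    define c where "c = 2 + 2 * enn2real (sqint lborel (u t))"
    have fin: "sqint lborel (u t) = ennreal (enn2real (sqint lborel (u t)))"
      using uL[of t] by (simp add: L2_iff)
    have "sqint lborel (u s) \<le> ennreal c" if s: "s \<in> U" for s
    proof -
      have "sqint lborel (\<lambda>x. u s x - u t x) \<le> 1"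
        using U(3)[OF s] by (cases "s = t") (simp_all add: sqint_def)
      then have "2 * sqint lborel (\<lambda>x. u s x - u t x) + 2 * sqint lborel (u t) \<le> 2 * 1 + 2 * sqint lborel (u t)"
        by (intro add_right_mono mult_left_mono) auto
      moreover have "sqint lborel (u s) \<le> 2 * sqint lborel (\<lambda>x. u s x - u t x) + 2 * sqint lborel (u t)"
        using sqint_add_le[of "\<lambda>x. u s x - u t x" lborel "u t"] by simp
      ultimately have "sqint lborel (u s) \<le> 2 * 1 + 2 * sqint lborel (u t)" by (rule order_trans[rotated])
      also have "\<dots> = ennreal c"
        unfolding c_def by (subst fin) (simp add: ennreal_plus ennreal_mult)
      finally show ?thesis .
    qed
    moreover have "0 \<le> c" by (simp add: c_def)
    ultimately show ?thesis using U(1,2) by blast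
  qed
  then obtain U c where U: "\<And>t. open (U t)" "\<And>t. t \<in> U t" "\<And>t s. s \<in> U t \<Longrightarrow> sqint lborel (u s) \<le> ennreal (c t)"
     and c: "\<And>t::real. 0 \<le> c t" by metis
  obtain C where C: "finite C" "{-S..S} \<subseteq> (\<Union>t\<in>C. U t)"
    by (rule compactE_image[of "{-S..S}" UNIV U]) (use U(1,2) in \<open>simp, simp, blast, blast\<close>)
  define b where "b = (\<Sum>t\<in>C. c t)"
  have "sqint lborel (u s) \<le> ennreal ((sqrt b)\<^sup>2)" if "\<bar>s\<bar> \<le> S" for s
  proof -
    have "s \<in> {-S..S}" using that by auto
    then obtain t where t: "t \<in> C" "s \<in> U t" using C(2) by blast
    have "c t \<le> b" unfolding b_def using C(1) t(1) c by (intro member_le_sum) auto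
    then show ?thesis using U(3)[OF t(2)] c[of t] by (auto intro: order_trans ennreal_leI)
  qed
  then show thesis by (intro that[of "sqrt b"]) (auto simp: b_def intro!: sum_nonneg c)
qed

subsection \<open>The free kernel\<close>

text \<open>
  The heat kernel in dimension \<open>D\<close> at complex time \<open>z\<close>, up to a constant and as a function of \<open>r = |x|\<^sup>2\<close>.
\<close>

definition free_kernel :: "real \<Rightarrow> complex \<Rightarrow> real \<Rightarrow> complex" where
  "free_kernel D z r = z powr (- of_real (D / 2)) * exp (- of_real r / (4 * z))"

lemma free_kernel_space_derivative:
  "z \<noteq> 0 \<Longrightarrow> ((\<lambda>r. free_kernel D z r) has_vector_derivative - (1 / (4 * z)) * free_kernel D z r) (at r)"
  unfolding free_kernel_def
  by (rule has_vector_derivative_real_field[where f = "\<lambda>w. z powr (- of_real (D / 2)) * exp (- w / (4 * z))"])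
     (auto intro!: derivative_eq_intros)

lemma free_kernel_time_derivative:
  assumes "Re z > 0"
  shows "((\<lambda>z. free_kernel D z r) has_field_derivative
           (- of_real (D / 2) / z + of_real r / (4 * z\<^sup>2)) * free_kernel D z r) (at z)"
proof -
  have z: "z \<notin> \<real>\<^sub>\<le>\<^sub>0" "z \<noteq> 0" using assms by (auto simp: complex_nonpos_Reals_iff)
  define e where "e = - complex_of_real (D / 2)"
  have "z powr (e - 1) = z powr e / z" using z by (simp add: powr_diff)
  then have d1: "((\<lambda>z. z powr e) has_field_derivative e / z * z powr e) (at z)"
    using has_field_derivative_powr[OF z(1), of e] by simp
  have d2: "((\<lambda>z. exp (- of_real r / (4 * z))) has_field_derivative of_real r / (4 * z\<^sup>2) * exp (- of_real r / (4 * z))) (at z)"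
    using z by (auto intro!: derivative_eq_intros simp: divide_simps power2_eq_square)
  show ?thesis
    unfolding free_kernel_def e_def[symmetric]
    using DERIV_mult[OF d1 d2] by (simp add: algebra_simps)
qed

lemma norm_free_kernel:
  assumes "Re z > 0"
  shows "cmod (free_kernel D z r) = cmod z powr (- D / 2) * exp (- r * (Re z / (4 * (cmod z)\<^sup>2)))"
proof -
  have z: "z \<noteq> 0" using assms by auto
  have "cmod (z powr (- of_real (D / 2))) = cmod z powr (- D / 2)"
    using z by (simp add: powr_def mult.commute)
  moreover have "Re (- of_real r / (4 * z)) = - r * (Re z / (4 * (cmod z)\<^sup>2))"
  proof -
    have "- of_real r / (4 * z) = of_real (- r / 4) * (1 / z)" by simp
    then have "Re (- of_real r / (4 * z)) = (- r / 4) * Re (1 / z)" by (simp only: Re_complex_of_real times_complex.simps Im_complex_of_real mult_zero_left diff_zero)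
    also have "Re (1 / z) = Re z / (cmod z)\<^sup>2" by (simp add: Re_divide cmod_power2)
    finally show ?thesis by simp
  qed
  ultimately show ?thesis by (simp add: free_kernel_def norm_mult)
qed

lemma has_real_derivative_max_power:
  fixes v :: real
  shows "((\<lambda>v. (max 0 v) ^ Suc (Suc n)) has_real_derivative real (Suc (Suc n)) * (max 0 v) ^ Suc n) (at v)"
proof -
  consider "v > 0" | "v < 0" | "v = 0" by linarith
  then show ?thesis
  proof cases
    case 1
    have "((\<lambda>v. v ^ Suc (Suc n)) has_real_derivative real (Suc (Suc n)) * v ^ Suc n) (at v)"
      using DERIV_pow[of "Suc (Suc n)" v] by simp
    then have "((\<lambda>v. (max 0 v) ^ Suc (Suc n)) has_real_derivative real (Suc (Suc n)) * v ^ Suc n) (at v)"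
      by (rule has_field_derivative_transform_within_open[where S = "{0<..}"]) (use 1 in auto)
    then show ?thesis using 1 by simp
  next
    case 2
    have "((\<lambda>v. 0) has_real_derivative 0) (at v)" by simp
    then have "((\<lambda>v. (max 0 v) ^ Suc (Suc n)) has_real_derivative 0) (at v)"
      by (rule has_field_derivative_transform_within_open[where S = "{..<0}"]) (use 2 in auto)
    then show ?thesis using 2 by simp
  next
    case 3
    have "((\<lambda>v::real. (max 0 v) ^ Suc (Suc n)) has_real_derivative 0) (at 0)"
      unfolding CARAT_DERIV
    proof (intro exI[of _ "\<lambda>v. (max 0 v) ^ Suc n"] conjI allI)
      show "(max 0 z) ^ Suc (Suc n) - (max 0 0) ^ Suc (Suc n) = (max 0 z) ^ Suc n * (z - 0)" for z :: real
        by (cases "z > 0") auto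
      show "isCont (\<lambda>v::real. (max 0 v) ^ Suc n) 0" by (intro continuous_intros)
    qed auto
    then show ?thesis using 3 by simp
  qed
qed

text \<open>
  The third power makes the cutoff twice continuously differentiable at its edge \<open>r = 1 / a\<close>; the two
  functions after it are its first and second derivatives in \<open>r\<close>.
\<close>

definition cutoff :: "real \<Rightarrow> real \<Rightarrow> real" where
  "cutoff a r = (max 0 (1 - a * r)) ^ 3"

definition cutoff' :: "real \<Rightarrow> real \<Rightarrow> real" where
  "cutoff' a r = - 3 * a * (max 0 (1 - a * r)) ^ 2"

definition cutoff'' :: "real \<Rightarrow> real \<Rightarrow> real" where
  "cutoff'' a r = 6 * a\<^sup>2 * max 0 (1 - a * r)"

lemma cutoff_derivative: "(cutoff a has_real_derivative cutoff' a r) (at r)"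
proof -
  have "((\<lambda>r. (max 0 (1 - a * r)) ^ Suc (Suc 1)) has_real_derivative real (Suc (Suc 1)) * (max 0 (1 - a * r)) ^ Suc 1 * (- a)) (at r)"
    by (rule DERIV_chain2[OF has_real_derivative_max_power]) (auto intro!: derivative_eq_intros)
  then show ?thesis by (simp add: cutoff_def[abs_def] cutoff'_def numeral_3_eq_3 numeral_2_eq_2 mult_ac)
qed

lemma cutoff'_derivative: "(cutoff' a has_real_derivative cutoff'' a r) (at r)"
proof -
  have "((\<lambda>r. (max 0 (1 - a * r)) ^ Suc (Suc 0)) has_real_derivative real (Suc (Suc 0)) * (max 0 (1 - a * r)) ^ Suc 0 * (- a)) (at r)"
    by (rule DERIV_chain2[OF has_real_derivative_max_power]) (auto intro!: derivative_eq_intros)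
  then have "((\<lambda>r. (- 3 * a) * (max 0 (1 - a * r)) ^ Suc (Suc 0)) has_real_derivative (- 3 * a) * (real (Suc (Suc 0)) * (max 0 (1 - a * r)) ^ Suc 0 * (- a))) (at r)"
    by (rule DERIV_cmult)
  then show ?thesis by (simp add: cutoff'_def[abs_def] cutoff''_def numeral_2_eq_2 power2_eq_square mult_ac)
qed

lemma continuous_cutoff: "continuous_on UNIV (cutoff a)" "continuous_on UNIV (cutoff' a)" "continuous_on UNIV (cutoff'' a)"
  unfolding cutoff_def[abs_def] cutoff'_def[abs_def] cutoff''_def[abs_def] by (intro continuous_intros)+

lemma cutoff_bounds:
  assumes "0 < a" "a \<le> 1" "0 \<le> r"
  shows "0 \<le> cutoff a r" "cutoff a r \<le> 1" "\<bar>cutoff' a r\<bar> \<le> 3 * a" "\<bar>cutoff'' a r\<bar> \<le> 6 * a"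
proof -
  have m: "0 \<le> max 0 (1 - a * r)" "max 0 (1 - a * r) \<le> 1" using assms by auto
  show "0 \<le> cutoff a r" by (simp add: cutoff_def)
  show "cutoff a r \<le> 1" using power_le_one[OF m, of 3] by (simp add: cutoff_def)
  have "3 * a * (max 0 (1 - a * r))\<^sup>2 \<le> 3 * a * 1"
    using assms power_le_one[OF m, of 2] by (intro mult_left_mono) auto
  then show "\<bar>cutoff' a r\<bar> \<le> 3 * a" using assms by (simp add: cutoff'_def abs_mult)
  have "6 * a\<^sup>2 * max 0 (1 - a * r) \<le> 6 * a * 1"
    using assms m by (intro mult_mono) (auto simp: power2_eq_square mult_left_le)
  then show "\<bar>cutoff'' a r\<bar> \<le> 6 * a" using assms by (simp add: cutoff''_def abs_mult)
qed

text \<open>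
  The free kernel run backwards in time solves the dual equation, so pairing it with a solution
  gives a constant, and this constant is zero for zero initial data. The kernel is not compactly
  supported; cutting it off at \<open>r = 1 / a\<close> costs an error that vanishes with \<open>a\<close>.
\<close>

lemma schroedinger_gaussian_pairing_zero:
  fixes u :: "real \<Rightarrow> 'a::euclidean_space \<Rightarrow> complex" and y :: 'a
  assumes u: "is_schroedinger_solution (\<lambda>_. 0) u" and \<epsilon>: "\<epsilon> > 0"
  shows "(LINT x|lborel. u T x * of_real (exp (- (norm (x - y))\<^sup>2 / (4 * \<epsilon>)))) = 0"
proof -
  define D where "D = real DIM('a)"
  define z where "z s = Complex \<epsilon> (T - s)" for s
  define k where "k s r = free_kernel D (z s) r" for s r
  define \<rho> where "\<rho> x = (norm (x - y))\<^sup>2" for x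
  have uL: "u t \<in> L2 lborel" for t using u by (auto simp: is_schroedinger_solution_def)
  have D: "D > 0" by (simp add: D_def)
  have Rez: "Re (z s) > 0" for s using \<epsilon> by (simp add: z_def)
  have zne: "z s \<noteq> 0" for s using Rez[of s] by auto
  have zge: "cmod (z s) \<ge> \<epsilon>" for s using complex_Re_le_cmod[of "z s"] by (simp add: z_def)
  have \<rho>0: "0 \<le> \<rho> x" for x by (simp add: \<rho>_def)
  have \<rho>m [measurable]: "\<rho> \<in> borel_measurable borel" unfolding \<rho>_def by measurable
  have kr: "(k s has_vector_derivative - (1 / (4 * z s)) * k s r) (at r)" for s r
    unfolding k_def[abs_def] by (rule free_kernel_space_derivative[OF zne])
  have zs: "(z has_vector_derivative - \<i>) (at s)" for s
  proof -
    have "z = (\<lambda>s. of_real \<epsilon> + \<i> * of_real (T - s))" by (auto simp: z_def complex_eq_iff)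
    then show ?thesis by (auto intro!: derivative_eq_intros)
  qed
  have ks: "((\<lambda>s. k s r) has_vector_derivative - \<i> * ((- of_real (D / 2) / z s + of_real r / (4 * (z s)\<^sup>2)) * k s r)) (at s)" for s r
    using field_vector_diff_chain_at[OF zs free_kernel_time_derivative[OF Rez]] by (simp add: k_def[abs_def] o_def)
  have kc: "continuous_on UNIV (k s)" for s
    using kr by (meson continuous_at_imp_continuous_on has_vector_derivative_continuous)
  have knorm: "cmod (k s r) \<le> \<epsilon> powr (- D / 2) * exp (- r * (\<epsilon> / (4 * (cmod (z s))\<^sup>2)))" for s r
    unfolding k_def norm_free_kernel[OF Rez] using \<epsilon> D zge[of s]
    by (intro mult_mono powr_mono2') (auto simp: z_def)
  have knorm1: "cmod (k s r) \<le> \<epsilon> powr (- D / 2)" if "0 \<le> r" for s r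
  proof -
    have "exp (- r * (\<epsilon> / (4 * (cmod (z s))\<^sup>2))) \<le> 1" using that \<epsilon> by simp
    then show ?thesis using knorm[of s r] mult_left_mono[of _ 1 "\<epsilon> powr (- D / 2)"] by fastforce
  qed
  define E where "E x = complex_of_real (exp (- \<rho> x / (4 * \<epsilon>)))" for x
  have kT: "k T r = of_real (\<epsilon> powr (- D / 2)) * of_real (exp (- r / (4 * \<epsilon>)))" for r
  proof -
    have "z T = of_real \<epsilon>" by (simp add: z_def complex_eq_iff)
    moreover have "complex_of_real \<epsilon> powr - complex_of_real (D / 2) = of_real (\<epsilon> powr (- D / 2))"
      using powr_of_real[of \<epsilon> "- D / 2"] \<epsilon> by simp
    moreover have "- complex_of_real r / (4 * of_real \<epsilon>) = of_real (- r / (4 * \<epsilon>))" by simp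
    ultimately show ?thesis
      by (simp only: k_def free_kernel_def exp_of_real)
  qed
  define S where "S = \<bar>T\<bar>"
  obtain B where B: "B \<ge> 0" "\<And>s. \<bar>s\<bar> \<le> S \<Longrightarrow> sqint lborel (u s) \<le> ennreal (B\<^sup>2)"
    using schroedinger_solution_locally_bounded[OF u] by blast
  \<comment> \<open>For \<open>|s| \<le> S\<close> the real part of \<open>1 / (4 z s)\<close> is at least \<open>\<delta>\<close>, since \<open>|T - s| \<le> 2 S\<close>.\<close>
  define \<delta> where "\<delta> = \<epsilon> / (4 * (\<epsilon>\<^sup>2 + (2 * S)\<^sup>2))"
  have \<epsilon>S: "\<epsilon>\<^sup>2 + (2 * S)\<^sup>2 > 0" using \<epsilon> by (simp add: add_pos_nonneg)
  have \<delta>: "\<delta> > 0" using \<epsilon> \<epsilon>S by (simp add: \<delta>_def)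
  have knorm2: "cmod (k s r) \<le> \<epsilon> powr (- D / 2) * exp (- \<delta> * r)" if "\<bar>s\<bar> \<le> S" "0 \<le> r" for s r
  proof -
    have "\<bar>T - s\<bar> \<le> \<bar>2 * S\<bar>" using that by (auto simp: S_def)
    then have "(T - s)\<^sup>2 \<le> (2 * S)\<^sup>2" by (simp only: abs_le_square_iff)
    then have "(cmod (z s))\<^sup>2 \<le> \<epsilon>\<^sup>2 + (2 * S)\<^sup>2"
      by (simp add: cmod_power2 z_def)
    then have "\<delta> \<le> \<epsilon> / (4 * (cmod (z s))\<^sup>2)"
      unfolding \<delta>_def using \<epsilon> zne[of s] by (intro frac_le) auto
    then have "- r * (\<epsilon> / (4 * (cmod (z s))\<^sup>2)) \<le> - \<delta> * r"
      using that(2) mult_left_mono[of \<delta> "\<epsilon> / (4 * (cmod (z s))\<^sup>2)" r] by (simp add: mult.commute)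
    then have "\<epsilon> powr (- D / 2) * exp (- r * (\<epsilon> / (4 * (cmod (z s))\<^sup>2))) \<le> \<epsilon> powr (- D / 2) * exp (- \<delta> * r)"
      by (intro mult_left_mono) (simp_all only: exp_le_cancel_iff powr_ge_zero)
    then show ?thesis using knorm[of s r] by (rule order_trans[rotated])
  qed
  define m where "m x = complex_of_real ((1 + (norm (x - y))\<^sup>2) ^ 1 * exp (- \<delta> * (norm (x - y))\<^sup>2))" for x
  have mL: "m \<in> L2 lborel" unfolding m_def by (rule gaussian_moment_L2[OF \<delta>])
  obtain A where A: "A \<ge> 0" "sqint lborel m \<le> ennreal (A\<^sup>2)"
  proof (cases "sqint lborel m")
    case (real r)
    then show thesis by (intro that[of "sqrt r"]) auto
  next
    case top
    then show thesis using mL by (simp add: L2_iff)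
  qed
  \<comment> \<open>Collects the constants in the bound for \<open>R\<close> below.\<close>
  define C where "C = \<epsilon> powr (- D / 2) * (24 + 6 / \<epsilon> + 6 * D)"
  have C: "C \<ge> 0" using \<epsilon> D by (simp add: C_def)
  have main: "cmod (LINT x|lborel. u T x * (of_real (cutoff a (\<rho> x)) * k T (\<rho> x))) \<le> a * C * A * B * \<bar>T\<bar>"
    if a: "0 < a" "a \<le> 1" for a
  proof -
    define c where "c r = complex_of_real (cutoff a r)" for r
    define c' where "c' r = complex_of_real (cutoff' a r)" for r
    define c'' where "c'' r = complex_of_real (cutoff'' a r)" for r
    have cd: "(c has_vector_derivative c' r) (at r)" "(c' has_vector_derivative c'' r) (at r)" for r
      using cutoff_derivative[of a r] cutoff'_derivative[of a r]
      unfolding c_def[abs_def] c'_def[abs_def] c''_def[abs_def]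
      by (auto intro!: has_vector_derivative_of_real simp: has_real_derivative_iff_has_vector_derivative)
    have cc: "continuous_on UNIV c" "continuous_on UNIV c'" "continuous_on UNIV c''"
      unfolding c_def[abs_def] c'_def[abs_def] c''_def[abs_def]
      by (intro continuous_intros continuous_cutoff)+
    define H where "H s r = c r * k s r" for s r
    define H' where "H' s r = (c' r - c r / (4 * z s)) * k s r" for s r
    define H'' where "H'' s r = (c'' r - c' r / (2 * z s) + c r / (16 * (z s)\<^sup>2)) * k s r" for s r
    define P where "P s r = - \<i> * ((- of_real (D / 2) / z s + of_real r / (4 * (z s)\<^sup>2)) * H s r)" for s r
    have H1: "(H s has_vector_derivative H' s r) (at r)" for s r
      using has_vector_derivative_mult[OF cd(1)[of r] kr[of s r]]
      by (simp add: H_def[abs_def] H'_def algebra_simps)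
    have H2: "(H' s has_vector_derivative H'' s r) (at r)" for s r
    proof -
      have "((\<lambda>r. c' r - c r / (4 * z s)) has_vector_derivative (c'' r - c' r / (4 * z s))) (at r)"
        by (intro has_vector_derivative_diff has_vector_derivative_divide cd)
      from has_vector_derivative_mult[OF this kr[of s r]]
      have "(H' s has_vector_derivative (c' r - c r / (4 * z s)) * (- (1 / (4 * z s)) * k s r) + (c'' r - c' r / (4 * z s)) * k s r) (at r)"
        by (simp add: H'_def[abs_def])
      also have "(c' r - c r / (4 * z s)) * (- (1 / (4 * z s)) * k s r) + (c'' r - c' r / (4 * z s)) * k s r = H'' s r"
        using zne[of s] by (simp add: H''_def field_simps power2_eq_square)
      finally show ?thesis .
    qed
    have H''c: "continuous_on UNIV (H'' s)" for s
      unfolding H''_def[abs_def] using zne[of s] by (intro continuous_intros cc kc) auto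
    have supp: "H s r = 0" if "(sqrt (1 / a))\<^sup>2 \<le> r" for s r
    proof -
      have "1 / a \<le> r" using that a by simp
      then have "1 \<le> a * r" using a by (simp add: field_simps)
      then show ?thesis by (simp add: H_def c_def cutoff_def)
    qed
    have test: "test_function (\<lambda>x. H s (\<rho> x))" for s
      unfolding \<rho>_def by (rule test_function_radial[where R = "sqrt (1 / a)", OF H1 H2 H''c supp]) (use a in auto)
    have P: "((\<lambda>s. H s (\<rho> x)) has_vector_derivative P s (\<rho> x)) (at s)" for s x
    proof -
      have "((\<lambda>s. H s (\<rho> x)) has_vector_derivative c (\<rho> x) * (- \<i> * ((- of_real (D / 2) / z s + of_real (\<rho> x) / (4 * (z s)\<^sup>2)) * k s (\<rho> x)))) (at s)"
        unfolding H_def by (intro has_vector_derivative_mult_right ks)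
      then show ?thesis by (simp add: P_def H_def mult_ac)
    qed
    have Pm: "(\<lambda>x. P s (\<rho> x)) \<in> borel_measurable borel" for s
    proof -
      have [measurable]: "c \<in> borel_measurable borel" "k s \<in> borel_measurable borel"
        by (intro borel_measurable_continuous_onI cc kc)+
      show ?thesis unfolding P_def H_def by measurable
    qed
    define Q where "Q x = complex_of_real ((D / (2 * \<epsilon>) + 1 / a / (4 * \<epsilon>\<^sup>2)) * \<epsilon> powr (- D / 2) * indicator (cball y (sqrt (1 / a))) x)" for x
    have in_ball: "x \<in> cball y (sqrt (1 / a)) \<longleftrightarrow> \<rho> x \<le> 1 / a" for x
    proof -
      have "\<rho> x \<le> 1 / a \<longleftrightarrow> sqrt (\<rho> x) \<le> sqrt (1 / a)" by (simp only: real_sqrt_le_iff)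
      then show ?thesis by (simp add: \<rho>_def dist_norm norm_minus_commute)
    qed
    have QL: "Q \<in> L2 lborel"
    proof -
      have "sqint lborel (\<lambda>x. complex_of_real (indicator (cball y (sqrt (1 / a))) x)) = emeasure lborel (cball y (sqrt (1 / a)))"
      proof -
        have "sqint lborel (\<lambda>x. complex_of_real (indicator (cball y (sqrt (1 / a))) x)) = (\<integral>\<^sup>+x. indicator (cball y (sqrt (1 / a))) x \<partial>lborel)"
          unfolding sqint_def by (intro nn_integral_cong) (auto simp: indicator_def)
        also have "\<dots> = emeasure lborel (cball y (sqrt (1 / a)))" by (rule nn_integral_indicator) simp
        finally show ?thesis .
      qed
      also have "\<dots> < top" using emeasure_bounded_finite[OF bounded_cball] by (simp add: top.not_eq_extremum)
      finally have "sqint lborel (\<lambda>x. complex_of_real (indicator (cball y (sqrt (1 / a))) x)) < top" .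
      moreover have "(\<lambda>x. complex_of_real (indicator (cball y (sqrt (1 / a))) x)) \<in> borel_measurable lborel"
      proof -
        have [measurable]: "cball y (sqrt (1 / a)) \<in> sets borel" by simp
        show ?thesis by measurable
      qed
      ultimately have "(\<lambda>x. complex_of_real (indicator (cball y (sqrt (1 / a))) x)) \<in> L2 lborel"
        unfolding L2_iff by (rule conjI[rotated])
      then show ?thesis unfolding Q_def of_real_mult[of _ "indicator _ _"] by (rule L2_cmult)
    qed
    have PQ: "cmod (P s (\<rho> x)) \<le> cmod (Q x)" for s x
    proof (cases "x \<in> cball y (sqrt (1 / a))")
      case True
      then have \<rho>x: "\<rho> x \<le> 1 / a" by (simp only: in_ball)
      have "cmod (- of_real (D / 2) / z s + of_real (\<rho> x) / (4 * (z s)\<^sup>2)) \<le> D / 2 / cmod (z s) + \<rho> x / (4 * (cmod (z s))\<^sup>2)"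
        using D \<rho>0[of x] by (intro norm_triangle_le add_mono) (auto simp: norm_divide norm_mult norm_power)
      also have "\<dots> \<le> D / 2 / \<epsilon> + 1 / a / (4 * \<epsilon>\<^sup>2)"
        using D \<epsilon> a zge[of s] \<rho>x \<rho>0[of x] by (intro add_mono frac_le mult_left_mono power_mono) auto
      finally have 1: "cmod (- of_real (D / 2) / z s + of_real (\<rho> x) / (4 * (z s)\<^sup>2)) \<le> D / (2 * \<epsilon>) + 1 / a / (4 * \<epsilon>\<^sup>2)" by simp
      have 2: "cmod (H s (\<rho> x)) \<le> 1 * \<epsilon> powr (- D / 2)"
        unfolding H_def norm_mult c_def norm_of_real
        using cutoff_bounds[OF a \<rho>0[of x]] knorm1[OF \<rho>0[of x]] by (intro mult_mono) auto
      have "cmod (P s (\<rho> x)) \<le> (D / (2 * \<epsilon>) + 1 / a / (4 * \<epsilon>\<^sup>2)) * (1 * \<epsilon> powr (- D / 2))"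
        unfolding P_def norm_mult using 1 2 D \<epsilon> a by (simp, intro mult_mono) auto
      also have "\<dots> = cmod (Q x)"
        using True D \<epsilon> a by (simp only: Q_def norm_of_real) (simp add: abs_mult)
      finally show ?thesis .
    next
      case False
      then have "\<not> \<rho> x \<le> 1 / a" by (simp only: in_ball not_False_eq_True)
      then have "H s (\<rho> x) = 0" using a by (intro supp) simp
      then show ?thesis by (simp add: P_def)
    qed
    define I where "I s = (LINT x|lborel. u s x * H s (\<rho> x))" for s
    define I' where "I' s = (LINT x|lborel. u s x * (\<i> * laplacian (\<lambda>x. H s (\<rho> x)) x + P s (\<rho> x)))" for s
    have I: "(I has_vector_derivative I' s) (at s)" for s
      unfolding I_def[abs_def] I'_def by (rule schroedinger_pairing_derivative[OF u test P QL PQ Pm])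
    have "cmod (I' s) \<le> B * (a * C * A)" if s: "s \<in> {-S..S}" for s
    proof -
      \<comment> \<open>What remains of \<open>i \<Delta> + \<partial>\<^sub>t\<close> applied to \<open>H\<close>: every term has a derivative of the cutoff as a factor, hence a factor \<open>a\<close>.\<close>
      define R where "R r = \<i> * (k s r * (4 * of_real r * c'' r - 2 * of_real r * c' r / z s + 2 * of_real D * c' r))" for r
      have eq: "\<i> * laplacian (\<lambda>x. H s (\<rho> x)) x + P s (\<rho> x) = R (\<rho> x)" for x
      proof -
        have L: "laplacian (\<lambda>x. H s (\<rho> x)) x = of_real (4 * \<rho> x) * H'' s (\<rho> x) + of_real (2 * D) * H' s (\<rho> x)"
          using laplacian_radial[OF H1 H2, of s y x, unfolded scaleR_conv_of_real] by (simp add: \<rho>_def D_def)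
        have "\<i> * (of_real (4 * \<rho> x) * H'' s (\<rho> x) + of_real (2 * D) * H' s (\<rho> x)) + P s (\<rho> x) = R (\<rho> x)"
          unfolding R_def P_def H_def H'_def H''_def using zne[of s] by (simp add: field_simps power2_eq_square)
        then show ?thesis by (simp only: L)
      qed
      have [measurable]: "c' \<in> borel_measurable borel" "c'' \<in> borel_measurable borel" "k s \<in> borel_measurable borel"
        by (intro borel_measurable_continuous_onI cc kc)+
      have Rm: "(\<lambda>x. R (\<rho> x)) \<in> borel_measurable lborel" unfolding R_def by measurable
      have Rb: "cmod (R (\<rho> x)) \<le> cmod (of_real (a * C) * m x)" for x
      proof -
        let ?r = "\<rho> x"
        note cb = cutoff_bounds[OF a \<rho>0[of x]]
        have n1: "cmod (4 * of_real ?r * c'' ?r) \<le> 4 * ?r * (6 * a)"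
          using mult_left_mono[OF cb(4), of "4 * ?r"] \<rho>0[of x] by (simp only: norm_mult c''_def norm_of_real) simp
        have n2: "cmod (2 * of_real ?r * c' ?r / z s) \<le> 2 * ?r * (3 * a) / \<epsilon>"
          unfolding norm_divide norm_mult c'_def norm_of_real
          using cb \<rho>0[of x] zge[of s] \<epsilon> a by (intro frac_le mult_mono) auto
        have n3: "cmod (2 * of_real D * c' ?r) \<le> 2 * D * (3 * a)"
          using mult_left_mono[OF cb(3), of "2 * D"] D by (simp only: norm_mult c'_def norm_of_real) simp
        have "cmod (4 * of_real ?r * c'' ?r - 2 * of_real ?r * c' ?r / z s + 2 * of_real D * c' ?r)
           \<le> 4 * ?r * (6 * a) + 2 * ?r * (3 * a) / \<epsilon> + 2 * D * (3 * a)"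
          by (intro norm_triangle_le add_mono norm_triangle_le_diff n1 n2 n3)
        also have "\<dots> \<le> (4 * ?r * (6 * a) + 2 * ?r * (3 * a) / \<epsilon> + 2 * D * (3 * a)) + (24 * a + 6 * a / \<epsilon> + 6 * D * a * ?r)"
          using a \<epsilon> D \<rho>0[of x] by simp
        also have "\<dots> = a * (24 + 6 / \<epsilon> + 6 * D) * (1 + ?r)"
          using \<epsilon> by (simp add: field_simps)
        finally have 1: "cmod (4 * of_real ?r * c'' ?r - 2 * of_real ?r * c' ?r / z s + 2 * of_real D * c' ?r)
           \<le> a * (24 + 6 / \<epsilon> + 6 * D) * (1 + ?r)" .
        have "\<bar>s\<bar> \<le> S" using s by auto
        then have 2: "cmod (k s ?r) \<le> \<epsilon> powr (- D / 2) * exp (- \<delta> * ?r)" by (rule knorm2) (rule \<rho>0)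
        have "cmod (R ?r) \<le> (\<epsilon> powr (- D / 2) * exp (- \<delta> * ?r)) * (a * (24 + 6 / \<epsilon> + 6 * D) * (1 + ?r))"
          unfolding R_def norm_mult using 1 2 by (simp add: norm_mult, intro mult_mono) auto
        also have "\<dots> = a * C * ((1 + ?r) * exp (- \<delta> * ?r))"
          by (simp only: C_def mult_ac)
        also have "\<dots> = cmod (of_real (a * C) * m x)"
          using a C \<rho>0[of x] by (simp only: norm_mult norm_of_real m_def \<rho>_def[symmetric]) (simp add: abs_mult)
        finally show ?thesis .
      qed
      have "sqint lborel (\<lambda>x. R (\<rho> x)) \<le> sqint lborel (\<lambda>x. of_real (a * C) * m x)"
        by (intro sqint_mono_AE AE_I2 Rb)
      also have "\<dots> = ennreal ((a * C)\<^sup>2) * sqint lborel m"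
        using L2_measurable[OF mL] by (simp only: sqint_cmult norm_of_real power2_abs)
      also have "\<dots> \<le> ennreal ((a * C)\<^sup>2) * ennreal (A\<^sup>2)" by (intro mult_left_mono A) auto
      also have "\<dots> = ennreal ((a * C * A)\<^sup>2)" by (simp add: ennreal_mult power_mult_distrib)
      finally have Rn: "sqint lborel (\<lambda>x. R (\<rho> x)) \<le> ennreal ((a * C * A)\<^sup>2)" .
      have sS: "\<bar>s\<bar> \<le> S" using s by auto
      show ?thesis
        unfolding I'_def eq
        by (rule cmod_integral_mult_le[OF L2_measurable[OF uL] Rm B(2)[OF sS] Rn B(1)]) (use a C A(1) in simp)
    qed
    then have "cmod (I T - I 0) \<le> B * (a * C * A) * \<bar>T - 0\<bar>"
      by (intro vector_derivative_bound[of "{-S..S}" I I']) (auto simp: I S_def)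
    moreover have "I 0 = 0"
    proof -
      have "AE x in lborel. u 0 x = 0" using u by (simp add: is_schroedinger_solution_def)
      then have "AE x in lborel. u 0 x * H 0 (\<rho> x) = 0" by eventually_elim simp
      then show ?thesis unfolding I_def by (rule integral_eq_zero_AE)
    qed
    ultimately show ?thesis by (simp add: I_def H_def c_def mult_ac)
  qed
  define J where "J n = (LINT x|lborel. u T x * (of_real (cutoff (1 / real (Suc n)) (\<rho> x)) * k T (\<rho> x)))" for n
  have "J \<longlonglongrightarrow> 0"
  proof (rule Lim_null_comparison)
    show "\<forall>\<^sub>F n in sequentially. norm (J n) \<le> 1 / real (Suc n) * C * A * B * \<bar>T\<bar>"
      unfolding J_def by (intro always_eventually allI main) auto
    have "(\<lambda>n. 1 / real (Suc n) * (C * A * B * \<bar>T\<bar>)) \<longlonglongrightarrow> 0 * (C * A * B * \<bar>T\<bar>)"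
      using LIMSEQ_inverse_real_of_nat by (intro tendsto_intros) (simp add: inverse_eq_divide)
    then show "(\<lambda>n. 1 / real (Suc n) * C * A * B * \<bar>T\<bar>) \<longlonglongrightarrow> 0" by (simp add: mult_ac)
  qed
  moreover have "J \<longlonglongrightarrow> (LINT x|lborel. u T x * k T (\<rho> x))"
    unfolding J_def
  proof (rule integral_dominated_convergence)
    have [measurable]: "k T \<in> borel_measurable borel" by (intro borel_measurable_continuous_onI kc)
    have [measurable]: "u T \<in> borel_measurable lborel" by (rule L2_measurable[OF uL])
    have [measurable]: "cutoff a \<in> borel_measurable borel" for a by (intro borel_measurable_continuous_onI continuous_cutoff)
    show "(\<lambda>x. u T x * k T (\<rho> x)) \<in> borel_measurable lborel" by measurable
    show "(\<lambda>x. u T x * (of_real (cutoff (1 / real (Suc n)) (\<rho> x)) * k T (\<rho> x))) \<in> borel_measurable lborel" for n by measurable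
    have ET: "(\<lambda>x. of_real (\<epsilon> powr (- D / 2)) * m x) \<in> L2 lborel" by (intro L2_cmult mL)
    show "integrable lborel (\<lambda>x. cmod (u T x * (of_real (\<epsilon> powr (- D / 2)) * m x)))"
      by (intro integrable_norm integrable_L2_mult uL ET)
    show "AE x in lborel. (\<lambda>n. u T x * (of_real (cutoff (1 / real (Suc n)) (\<rho> x)) * k T (\<rho> x))) \<longlonglongrightarrow> u T x * k T (\<rho> x)"
    proof (rule AE_I2)
      fix x
      have "(\<lambda>n. cutoff (1 / real (Suc n)) (\<rho> x)) \<longlonglongrightarrow> (max 0 (1 - 0 * \<rho> x)) ^ 3"
        unfolding cutoff_def using LIMSEQ_inverse_real_of_nat by (intro tendsto_intros) (simp add: inverse_eq_divide)
      then have "(\<lambda>n. u T x * (of_real (cutoff (1 / real (Suc n)) (\<rho> x)) * k T (\<rho> x))) \<longlonglongrightarrow> u T x * (of_real 1 * k T (\<rho> x))"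
        by (intro tendsto_intros) simp
      then show "(\<lambda>n. u T x * (of_real (cutoff (1 / real (Suc n)) (\<rho> x)) * k T (\<rho> x))) \<longlonglongrightarrow> u T x * k T (\<rho> x)" by simp
    qed
    show "AE x in lborel. norm (u T x * (of_real (cutoff (1 / real (Suc n)) (\<rho> x)) * k T (\<rho> x))) \<le> cmod (u T x * (of_real (\<epsilon> powr (- D / 2)) * m x))" for n
    proof (rule AE_I2)
      fix x
      have c1: "0 \<le> cutoff (1 / real (Suc n)) (\<rho> x)" "cutoff (1 / real (Suc n)) (\<rho> x) \<le> 1"
        using cutoff_bounds[of "1 / real (Suc n)" "\<rho> x"] \<rho>0[of x] by auto
      have "cmod (of_real (cutoff (1 / real (Suc n)) (\<rho> x)) * k T (\<rho> x)) \<le> 1 * (\<epsilon> powr (- D / 2) * exp (- \<delta> * \<rho> x))"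
        unfolding norm_mult using c1 knorm2[of T "\<rho> x"] \<rho>0[of x] by (intro mult_mono) (auto simp: S_def)
      also have "\<dots> \<le> \<epsilon> powr (- D / 2) * ((1 + \<rho> x) ^ 1 * exp (- \<delta> * \<rho> x))"
        using \<rho>0[of x] by (simp add: mult_left_mono)
      also have "\<dots> = cmod (of_real (\<epsilon> powr (- D / 2)) * m x)"
        using \<rho>0[of x] by (simp only: norm_mult norm_of_real m_def \<rho>_def[symmetric]) (simp add: abs_mult)
      finally show "norm (u T x * (of_real (cutoff (1 / real (Suc n)) (\<rho> x)) * k T (\<rho> x))) \<le> cmod (u T x * (of_real (\<epsilon> powr (- D / 2)) * m x))"
        unfolding norm_mult[of "u T x"] by (intro mult_left_mono) auto
    qed
  qed
  ultimately have "(LINT x|lborel. u T x * k T (\<rho> x)) = 0" using LIMSEQ_unique by blast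
  then have "of_real (\<epsilon> powr (- D / 2)) * (LINT x|lborel. u T x * of_real (exp (- \<rho> x / (4 * \<epsilon>)))) = 0"
    unfolding kT by (simp only: mult.left_commute[of "u T _"] integral_mult_right_zero)
  then show ?thesis using \<epsilon> by (simp add: \<rho>_def)
qed

subsection \<open>Gaussian averages determine a function\<close>

lemma lborel_integral_scale_shift:
  fixes f :: "'a::euclidean_space \<Rightarrow> complex"
  assumes [measurable]: "f \<in> borel_measurable borel" and c: "c > 0"
  shows "(LINT x|lborel. f x) = of_real (c ^ DIM('a)) * (LINT v|lborel. f (y + c *\<^sub>R v))"
proof -
  have "(LINT x|lborel. f x) = (LINT x|density (distr lborel borel (\<lambda>x. y + c *\<^sub>R x)) (\<lambda>_. \<bar>c\<bar> ^ DIM('a)). f x)"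
    using c by (subst lborel_affine[of c y]) auto
  also have "\<dots> = (LINT x|distr lborel borel (\<lambda>x. y + c *\<^sub>R x). (\<bar>c\<bar> ^ DIM('a)) *\<^sub>R f x)"
    by (rule integral_density) auto
  also have "\<dots> = (LINT v|lborel. (\<bar>c\<bar> ^ DIM('a)) *\<^sub>R f (y + c *\<^sub>R v))"
    by (rule integral_distr) auto
  finally show ?thesis using c by (simp add: scaleR_conv_of_real)
qed

lemma integrable_lborel_shift:
  fixes f :: "'a::euclidean_space \<Rightarrow> complex"
  assumes "integrable lborel f"
  shows "integrable lborel (\<lambda>x. f (y + x))"
proof -
  have "integrable (distr lborel borel ((+) y)) f" using assms by (simp only: lborel_distr_plus)
  then show ?thesis by (subst (asm) integrable_distr_eq) (use assms in auto)
qed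

lemma lborel_integral_shift:
  fixes f :: "'a::euclidean_space \<Rightarrow> complex"
  assumes [measurable]: "f \<in> borel_measurable borel"
  shows "(LINT x|lborel. f (y + x)) = (LINT x|lborel. f x)"
  using lborel_integral_scale_shift[OF assms, of 1 y] by simp

text \<open>
  The closed sets are stable under intersection and generate the Borel sets.
\<close>

lemma AE_zero_of_closed_set_integrals:
  fixes w :: "'a::euclidean_space \<Rightarrow> complex"
  assumes w: "integrable lborel w"
    and closed: "\<And>A. closed A \<Longrightarrow> (LINT x:A|lborel. w x) = 0"
  shows "AE x in lborel. w x = 0"
proof (rule sigma_finite_measure.density_zero[OF sigma_finite_lborel w])
  fix A :: "'a set" assume "A \<in> sets lborel"
  then have A: "A \<in> sigma_sets UNIV (Collect closed)" by (simp add: borel_eq_closed)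
  have si: "set_integrable lborel B w" if "B \<in> sets borel" for B
    unfolding set_integrable_def by (rule integrable_mult_indicator[OF _ w]) (use that in simp)
  have sb: "B \<in> sets borel" if "B \<in> sigma_sets UNIV (Collect closed)" for B :: "'a set"
    using that by (simp add: borel_eq_closed)
  have U: "(LINT x:UNIV|lborel. w x) = 0" by (rule closed) simp
  show "(LINT x:A|lborel. w x) = 0"
    using _ _ A
  proof (rule sigma_sets_induct_disjoint)
    show "Int_stable (Collect closed)" by (auto simp: Int_stable_def)
    show "(LINT x:{}|lborel. w x) = 0" by (simp add: set_lebesgue_integral_def)
    fix B :: "'a set" assume B: "B \<in> sigma_sets UNIV (Collect closed)" "(LINT x:B|lborel. w x) = 0"
    have "(LINT x:B \<union> (UNIV - B)|lborel. w x) = (LINT x:B|lborel. w x) + (LINT x:UNIV - B|lborel. w x)"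
      by (rule set_integral_Un) (use B sb si in auto)
    then show "(LINT x:UNIV - B|lborel. w x) = 0" using B U by simp
  next
    fix F :: "nat \<Rightarrow> 'a set"
    assume F: "disjoint_family F" "range F \<subseteq> sigma_sets UNIV (Collect closed)" "\<And>i. (LINT x:F i|lborel. w x) = 0"
    have Fs: "F i \<in> sets borel" for i using F(2) sb by auto
    have "(LINT x:(\<Union>i. F i)|lborel. w x) = (\<Sum>i. LINT x:F i|lborel. w x)"
      by (rule lebesgue_integral_countable_add) (use F Fs si in \<open>auto simp: disjoint_family_on_def\<close>)
    then show "(LINT x:(\<Union>i. F i)|lborel. w x) = 0" using F(3) by simp
  qed (use closed in auto)
qed

text \<open>
  The indicator of a closed set is a limit of bounded continuous functions of the distance to the set.
\<close>

lemma AE_zero_of_continuous_pairings: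
  fixes w :: "'a::euclidean_space \<Rightarrow> complex"
  assumes w: "integrable lborel w"
    and pair: "\<And>\<phi>::'a \<Rightarrow> real. continuous_on UNIV \<phi> \<Longrightarrow> (\<And>x. \<bar>\<phi> x\<bar> \<le> 1) \<Longrightarrow> (LINT x|lborel. of_real (\<phi> x) * w x) = 0"
  shows "AE x in lborel. w x = 0"
proof (rule AE_zero_of_closed_set_integrals[OF w])
  fix A :: "'a set" assume A: "closed A"
  note [measurable] = borel_measurable_integrable[OF w] borel_closed[OF A]
  show "(LINT x:A|lborel. w x) = 0"
  proof (cases "A = {}")
    case False
    define \<phi> where "\<phi> n x = max 0 (1 - real n * infdist x A)" for n x
    have c: "continuous_on UNIV (\<phi> n)" for n unfolding \<phi>_def by (intro continuous_intros)
    have [measurable]: "\<phi> n \<in> borel_measurable borel" for n by (rule borel_measurable_continuous_onI[OF c])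
    have b: "\<bar>\<phi> n x\<bar> \<le> 1" for n x by (auto simp: \<phi>_def infdist_nonneg)
    have lim: "(\<lambda>n. \<phi> n x) \<longlonglongrightarrow> indicator A x" for x
    proof (cases "x \<in> A")
      case True
      then show ?thesis by (simp add: \<phi>_def)
    next
      case nA: False
      then have "infdist x A > 0"
        using in_closed_iff_infdist_zero[OF A False, of x] infdist_nonneg[of x A] by linarith
      then obtain N where N: "1 < real N * infdist x A" using reals_Archimedean3 by blast
      have "\<phi> n x = 0" if "n \<ge> N" for n
      proof -
        have "real N * infdist x A \<le> real n * infdist x A"
          using that by (intro mult_right_mono infdist_nonneg) auto
        then show ?thesis using N by (simp add: \<phi>_def)
      qed
      then have "eventually (\<lambda>n. \<phi> n x = 0) sequentially" by (auto simp: eventually_sequentially)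
      then show ?thesis using nA by (simp add: tendsto_eventually)
    qed
    have "(\<lambda>n. LINT x|lborel. of_real (\<phi> n x) * w x) \<longlonglongrightarrow> (LINT x|lborel. of_real (indicator A x) * w x)"
    proof (rule integral_dominated_convergence)
      show "integrable lborel (\<lambda>x. cmod (w x))" using w by simp
      show "AE x in lborel. (\<lambda>n. of_real (\<phi> n x) * w x) \<longlonglongrightarrow> of_real (indicator A x) * w x"
        by (intro AE_I2 tendsto_intros lim)
      show "AE x in lborel. norm (of_real (\<phi> n x) * w x) \<le> cmod (w x)" for n
      proof (rule AE_I2)
        fix x show "norm (of_real (\<phi> n x) * w x) \<le> cmod (w x)"
          using mult_right_mono[OF b[of n x], of "cmod (w x)"] by (simp add: norm_mult)
      qed
    qed measurable
    moreover have "(LINT x|lborel. of_real (\<phi> n x) * w x) = 0" for n by (rule pair[OF c b])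
    ultimately have "(\<lambda>n::nat. 0) \<longlonglongrightarrow> (LINT x|lborel. of_real (indicator A x) * w x)"
      by (simp only:)
    then have "(LINT x|lborel. of_real (indicator A x) * w x) = 0"
      by (simp only: LIMSEQ_const_iff)
    then show ?thesis by (simp add: set_lebesgue_integral_def scaleR_conv_of_real)
  qed (simp add: set_lebesgue_integral_def)
qed

text \<open>
  Averaging \<open>w\<close> against a Gaussian of width \<open>h\<close> around every point, then against \<open>\<phi>\<close>, is the same as
  averaging the pairings of \<open>w\<close> with translates of \<open>\<phi>\<close> by \<open>h v\<close>; let \<open>h\<close> tend to zero.
\<close>

lemma AE_zero_of_gaussian_averages_integrable:
  fixes w :: "'a::euclidean_space \<Rightarrow> complex"
  assumes w: "integrable lborel w"
    and avg: "\<And>b y. b > 0 \<Longrightarrow> (LINT x|lborel. w x * of_real (exp (- b * (norm (x - y))\<^sup>2))) = 0"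
  shows "AE x in lborel. w x = 0"
proof (rule AE_zero_of_continuous_pairings[OF w])
  fix \<phi> :: "'a \<Rightarrow> real" assume c: "continuous_on UNIV \<phi>" and b: "\<And>x. \<bar>\<phi> x\<bar> \<le> 1"
  note [measurable] = borel_measurable_integrable[OF w] borel_measurable_continuous_onI[OF c]
  define G where "G v = exp (- (norm v)\<^sup>2)" for v :: 'a
  have Gm [measurable]: "G \<in> borel_measurable borel" unfolding G_def by measurable
  have G0: "0 \<le> G v" for v by (simp add: G_def)
  have Gint: "integrable lborel G"
  proof -
    have "(\<lambda>x::'a. of_real ((1 + (norm (x - 0))\<^sup>2) ^ 0 * exp (- (1 / 2) * (norm (x - 0))\<^sup>2))) \<in> L2 lborel"
      by (rule gaussian_moment_L2) simp
    from integrable_cmod_sq[OF this] show ?thesis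
      by (simp add: G_def[abs_def] exp_double[symmetric])
  qed
  have Gpos: "(LINT v|lborel. G v) > 0"
  proof -
    have "(LINT v|lborel. G v) \<noteq> 0"
    proof
      assume "(LINT v|lborel. G v) = 0"
      then have "AE v in lborel. G v = 0"
        using integral_nonneg_eq_0_iff_AE[OF Gint] G0 by auto
      then have "AE v in (lborel :: 'a measure). False" by (simp add: G_def)
      then have "emeasure (lborel :: 'a measure) UNIV = 0"
        using AE_iff_measurable[of "UNIV :: 'a set" lborel "\<lambda>_. False"] by simp
      then show False by (simp add: emeasure_lborel_UNIV)
    qed
    moreover have "(LINT v|lborel. G v) \<ge> 0" by (intro integral_nonneg_AE) (use G0 in auto)
    ultimately show ?thesis by simp
  qed
  have zero: "(LINT v|lborel. of_real (G v) * (LINT x|lborel. of_real (\<phi> (x - h *\<^sub>R v)) * w x)) = 0" if h: "h > 0" for h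
  proof -
    define F where "F v y = of_real (\<phi> y) * w (y + h *\<^sub>R v) * complex_of_real (G v)" for v y
    have Fm [measurable]: "(\<lambda>(v, y). F v y) \<in> borel_measurable (lborel \<Otimes>\<^sub>M lborel)"
      unfolding F_def by measurable
    have wsh: "integrable lborel (\<lambda>y. w (y + h *\<^sub>R v))" for v
      using integrable_lborel_shift[OF w, of "h *\<^sub>R v"] by (simp add: add.commute)
    have Fi: "integrable lborel (F v)" for v
      unfolding F_def
    proof (intro integrable_mult_left)
      show "integrable lborel (\<lambda>y. of_real (\<phi> y) * w (y + h *\<^sub>R v))"
      proof (rule Bochner_Integration.integrable_bound[OF wsh[of v]])
        show "AE y in lborel. norm (of_real (\<phi> y) * w (y + h *\<^sub>R v)) \<le> norm (w (y + h *\<^sub>R v))"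
          using mult_right_mono[OF b, of "cmod _"] by (auto simp: norm_mult)
      qed measurable
    qed
    have Fb: "norm (LINT y|lborel. norm (F v y)) \<le> norm (G v * (LINT x|lborel. cmod (w x)))" for v
    proof -
      have "(LINT y|lborel. norm (F v y)) \<le> (LINT y|lborel. cmod (w (y + h *\<^sub>R v)) * G v)"
      proof (rule integral_mono)
        show "integrable lborel (\<lambda>y. norm (F v y))" using Fi[of v] by simp
        show "integrable lborel (\<lambda>y. cmod (w (y + h *\<^sub>R v)) * G v)" using wsh[of v] by simp
        fix y
        show "norm (F v y) \<le> cmod (w (y + h *\<^sub>R v)) * G v"
          using mult_right_mono[OF b[of y], of "cmod (w (y + h *\<^sub>R v)) * G v"] G0[of v]
          by (simp add: F_def norm_mult mult.assoc)
      qed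
      also have "(LINT y|lborel. cmod (w (y + h *\<^sub>R v)) * G v) = (LINT y|lborel. cmod (w (y + h *\<^sub>R v))) * G v" by simp
      also have "(LINT y|lborel. cmod (w (y + h *\<^sub>R v))) = (LINT x|lborel. cmod (w x))"
      proof -
        have "complex_of_real (LINT y|lborel. cmod (w (y + h *\<^sub>R v))) = (LINT y|lborel. complex_of_real (cmod (w (h *\<^sub>R v + y))))"
          by (simp add: add.commute)
        also have "\<dots> = (LINT x|lborel. complex_of_real (cmod (w x)))"
          by (rule lborel_integral_shift[of "\<lambda>x. complex_of_real (cmod (w x))"]) measurable
        finally show ?thesis by (simp only: integral_complex_of_real of_real_eq_iff)
      qed
      finally have "(LINT y|lborel. norm (F v y)) \<le> G v * (LINT x|lborel. cmod (w x))" by (simp add: mult.commute)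
      moreover have "0 \<le> (LINT y|lborel. norm (F v y))" by (intro integral_nonneg_AE) auto
      ultimately show ?thesis by simp
    qed
    have FF: "integrable (lborel \<Otimes>\<^sub>M lborel) (\<lambda>(v, y). F v y)"
    proof (rule lborel_pair.Fubini_integrable[OF Fm])
      show "AE v in lborel. integrable lborel (\<lambda>y. case (v, y) of (v, y) \<Rightarrow> F v y)" using Fi by simp
      show "integrable lborel (\<lambda>v. LINT y|lborel. norm (case (v, y) of (v, y) \<Rightarrow> F v y))"
      proof (rule Bochner_Integration.integrable_bound)
        show "integrable lborel (\<lambda>v. G v * (LINT x|lborel. cmod (w x)))" using Gint by simp
        show "AE v in lborel. norm (LINT y|lborel. norm (case (v, y) of (v, y) \<Rightarrow> F v y)) \<le> norm (G v * (LINT x|lborel. cmod (w x)))"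
          using Fb by simp
      qed measurable
    qed
    have "(LINT y|lborel. LINT v|lborel. F v y) = 0"
    proof -
      have "(LINT v|lborel. F v y) = 0" for y
      proof -
        have m: "(\<lambda>x. w x * of_real (exp (- (1 / h\<^sup>2) * (norm (x - y))\<^sup>2))) \<in> borel_measurable borel" by measurable
        have "0 = (LINT x|lborel. w x * of_real (exp (- (1 / h\<^sup>2) * (norm (x - y))\<^sup>2)))"
          using avg[of "1 / h\<^sup>2" y] h by simp
        also have "\<dots> = of_real (h ^ DIM('a)) * (LINT v|lborel. w (y + h *\<^sub>R v) * of_real (exp (- (1 / h\<^sup>2) * (norm (y + h *\<^sub>R v - y))\<^sup>2)))"
          by (rule lborel_integral_scale_shift[OF m h])
        also have "(\<lambda>v. w (y + h *\<^sub>R v) * of_real (exp (- (1 / h\<^sup>2) * (norm (y + h *\<^sub>R v - y))\<^sup>2))) =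
                   (\<lambda>v. w (y + h *\<^sub>R v) * of_real (G v))"
          using h by (simp add: G_def power_mult_distrib)
        finally have "(LINT v|lborel. w (y + h *\<^sub>R v) * complex_of_real (G v)) = 0" using h by simp
        then show ?thesis by (simp add: F_def mult.assoc)
      qed
      then show ?thesis by simp
    qed
    then have "(LINT v|lborel. LINT y|lborel. F v y) = 0"
      using lborel_pair.Fubini_integral[OF FF] by simp
    moreover have "(LINT y|lborel. F v y) = of_real (G v) * (LINT x|lborel. of_real (\<phi> (x - h *\<^sub>R v)) * w x)" for v
    proof -
      have "(LINT y|lborel. F v y) = (LINT y|lborel. (of_real (\<phi> (h *\<^sub>R v + y - h *\<^sub>R v)) * w (h *\<^sub>R v + y)) * of_real (G v))"
        unfolding F_def by (simp add: add.commute)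
      also have "\<dots> = (LINT y|lborel. of_real (\<phi> (h *\<^sub>R v + y - h *\<^sub>R v)) * w (h *\<^sub>R v + y)) * of_real (G v)"
        by (rule integral_mult_left_zero)
      also have "(LINT y|lborel. of_real (\<phi> (h *\<^sub>R v + y - h *\<^sub>R v)) * w (h *\<^sub>R v + y)) = (LINT x|lborel. of_real (\<phi> (x - h *\<^sub>R v)) * w x)"
        by (rule lborel_integral_shift[of "\<lambda>x. of_real (\<phi> (x - h *\<^sub>R v)) * w x"]) measurable
      finally show ?thesis by (simp only: mult.commute)
    qed
    ultimately show ?thesis by simp
  qed
  \<comment> \<open>The pairing of \<open>w\<close> with the translate of \<open>\<phi>\<close> by \<open>h v\<close>; it is bounded by the integral of \<open>|w|\<close>.\<close>
  define K where "K h v = (LINT x|lborel. of_real (\<phi> (x - h *\<^sub>R v)) * w x)" for h v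
  define W where "W = (LINT x|lborel. cmod (w x))"
  have Kmeas: "K h \<in> borel_measurable lborel" for h
    unfolding K_def by measurable
  have Kb: "cmod (K h v) \<le> W" for h v
  proof -
    have "cmod (K h v) \<le> (LINT x|lborel. norm (of_real (\<phi> (x - h *\<^sub>R v)) * w x))"
      unfolding K_def by (rule integral_norm_bound)
    also have "\<dots> \<le> W"
      unfolding W_def
    proof (rule integral_mono')
      show "integrable lborel (\<lambda>x. cmod (w x))" using w by simp
      show "norm (of_real (\<phi> (x - h *\<^sub>R v)) * w x) \<le> cmod (w x)" for x
        using mult_right_mono[OF b[of "x - h *\<^sub>R v"], of "cmod (w x)"] by (simp add: norm_mult)
    qed simp
    finally show ?thesis .
  qed
  have hl: "(\<lambda>n. 1 / real (Suc n)) \<longlonglongrightarrow> 0"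
    using LIMSEQ_inverse_real_of_nat by (simp add: inverse_eq_divide)
  have Klim: "(\<lambda>n. K (1 / real (Suc n)) v) \<longlonglongrightarrow> (LINT x|lborel. of_real (\<phi> x) * w x)" for v
    unfolding K_def
  proof (rule integral_dominated_convergence)
    show "integrable lborel (\<lambda>x. cmod (w x))" using w by simp
    show "AE x in lborel. (\<lambda>n. of_real (\<phi> (x - (1 / real (Suc n)) *\<^sub>R v)) * w x) \<longlonglongrightarrow> of_real (\<phi> x) * w x"
    proof (rule AE_I2)
      fix x
      have "(\<lambda>n. x - (1 / real (Suc n)) *\<^sub>R v) \<longlonglongrightarrow> x - 0 *\<^sub>R v" by (intro tendsto_intros hl)
      then have "(\<lambda>n. \<phi> (x - (1 / real (Suc n)) *\<^sub>R v)) \<longlonglongrightarrow> \<phi> x"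
        using c by (intro continuous_on_tendsto_compose[OF c]) auto
      then show "(\<lambda>n. of_real (\<phi> (x - (1 / real (Suc n)) *\<^sub>R v)) * w x) \<longlonglongrightarrow> of_real (\<phi> x) * w x"
        by (intro tendsto_intros)
    qed
    show "AE x in lborel. norm (of_real (\<phi> (x - (1 / real (Suc n)) *\<^sub>R v)) * w x) \<le> cmod (w x)" for n
    proof (rule AE_I2)
      fix x show "norm (of_real (\<phi> (x - (1 / real (Suc n)) *\<^sub>R v)) * w x) \<le> cmod (w x)"
        using mult_right_mono[OF b[of "x - (1 / real (Suc n)) *\<^sub>R v"], of "cmod (w x)"] by (simp add: norm_mult)
    qed
  qed measurable
  have "(\<lambda>n. LINT v|lborel. of_real (G v) * K (1 / real (Suc n)) v) \<longlonglongrightarrow>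
        (LINT v|lborel. of_real (G v) * (LINT x|lborel. of_real (\<phi> x) * w x))"
  proof (rule integral_dominated_convergence)
    show "integrable lborel (\<lambda>v. G v * W)" using Gint by simp
    show "AE v in lborel. (\<lambda>n. of_real (G v) * K (1 / real (Suc n)) v) \<longlonglongrightarrow> of_real (G v) * (LINT x|lborel. of_real (\<phi> x) * w x)"
      by (intro AE_I2 tendsto_intros Klim)
    show "AE v in lborel. norm (of_real (G v) * K (1 / real (Suc n)) v) \<le> G v * W" for n
      using mult_left_mono[OF Kb G0] G0 by (auto simp: norm_mult)
    show "(\<lambda>v. of_real (G v) * K (1 / real (Suc n)) v) \<in> borel_measurable lborel" for n
      using Kmeas by measurable
  qed measurable
  moreover have "(LINT v|lborel. of_real (G v) * K (1 / real (Suc n)) v) = 0" for n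
    unfolding K_def by (rule zero) simp
  ultimately have "(\<lambda>n::nat. 0) \<longlonglongrightarrow> (LINT v|lborel. of_real (G v) * (LINT x|lborel. of_real (\<phi> x) * w x))"
    by (simp only:)
  then have "(LINT v|lborel. of_real (G v) * (LINT x|lborel. of_real (\<phi> x) * w x)) = 0"
    by (simp only: LIMSEQ_const_iff)
  then have "(LINT v|lborel. complex_of_real (G v)) * (LINT x|lborel. of_real (\<phi> x) * w x) = 0" by simp
  then show "(LINT x|lborel. of_real (\<phi> x) * w x) = 0"
    using Gpos by (simp add: integral_complex_of_real)
qed

text \<open>
  For \<open>u \<in> L\<^sup>2\<close> the previous lemma applies to \<open>u(x) exp (- |x|\<^sup>2)\<close>, because a product of two Gaussians is
  a multiple of a Gaussian.
\<close>

lemma AE_zero_of_gaussian_averages: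
  fixes u :: "'a::euclidean_space \<Rightarrow> complex"
  assumes u: "u \<in> L2 lborel"
    and avg: "\<And>b y. b > 0 \<Longrightarrow> (LINT x|lborel. u x * of_real (exp (- b * (norm (x - y))\<^sup>2))) = 0"
  shows "AE x in lborel. u x = 0"
proof -
  define w where "w x = u x * of_real (exp (- (norm x)\<^sup>2))" for x
  have "(\<lambda>x::'a. of_real ((1 + (norm (x - 0))\<^sup>2) ^ 0 * exp (- 1 * (norm (x - 0))\<^sup>2))) \<in> L2 lborel"
    by (rule gaussian_moment_L2) simp
  from integrable_L2_mult[OF u this] have w: "integrable lborel w" by (simp add: w_def[abs_def])
  have "AE x in lborel. w x = 0"
  proof (rule AE_zero_of_gaussian_averages_integrable[OF w])
    fix b :: real and y :: 'a assume b: "b > 0"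
    \<comment> \<open>Completing the square in \<open>|x|\<^sup>2 + b |x - y|\<^sup>2\<close> moves the centre to \<open>y'\<close>.\<close>
    define y' where "y' = (b / (1 + b)) *\<^sub>R y"
    have sq: "(norm x)\<^sup>2 + b * (norm (x - y))\<^sup>2 = (1 + b) * (norm (x - y'))\<^sup>2 + (b / (1 + b)) * (norm y)\<^sup>2" for x
    proof -
      have "(1 + b) * (norm (x - y'))\<^sup>2 = (1 + b) * (norm x)\<^sup>2 - 2 * b * (x \<bullet> y) + b\<^sup>2 / (1 + b) * (norm y)\<^sup>2"
        using b unfolding power2_norm_eq_inner y'_def
        by (simp add: inner_diff inner_commute power2_eq_square divide_simps) (simp add: algebra_simps)
      moreover have "b\<^sup>2 / (1 + b) + b / (1 + b) = b" using b by (simp add: power2_eq_square divide_simps) (simp add: algebra_simps)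
      then have "b\<^sup>2 / (1 + b) * (norm y)\<^sup>2 + b / (1 + b) * (norm y)\<^sup>2 = b * (norm y)\<^sup>2" by (metis distrib_right)
      moreover have "b * (norm (x - y))\<^sup>2 = b * ((norm x)\<^sup>2 - 2 * (x \<bullet> y) + (norm y)\<^sup>2)"
        unfolding power2_norm_eq_inner by (simp add: inner_diff inner_commute)
      ultimately show ?thesis by (simp add: algebra_simps)
    qed
    have "w x * of_real (exp (- b * (norm (x - y))\<^sup>2)) =
      of_real (exp (- (b / (1 + b)) * (norm y)\<^sup>2)) * (u x * of_real (exp (- (1 + b) * (norm (x - y'))\<^sup>2)))" for x
    proof -
      have "exp (- (norm x)\<^sup>2) * exp (- b * (norm (x - y))\<^sup>2) = exp (- ((norm x)\<^sup>2 + b * (norm (x - y))\<^sup>2))"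
        by (simp add: exp_add[symmetric])
      also have "\<dots> = exp (- (b / (1 + b)) * (norm y)\<^sup>2) * exp (- (1 + b) * (norm (x - y'))\<^sup>2)"
        unfolding sq by (simp add: exp_add[symmetric] algebra_simps)
      finally show ?thesis
        unfolding w_def mult.assoc of_real_mult[symmetric] by (simp only: of_real_mult mult.left_commute)
    qed
    then have "(LINT x|lborel. w x * of_real (exp (- b * (norm (x - y))\<^sup>2))) =
       of_real (exp (- (b / (1 + b)) * (norm y)\<^sup>2)) * (LINT x|lborel. u x * of_real (exp (- (1 + b) * (norm (x - y'))\<^sup>2)))"
      by (simp only: integral_mult_right_zero)
    then show "(LINT x|lborel. w x * of_real (exp (- b * (norm (x - y))\<^sup>2))) = 0"
      using avg[of "1 + b" y'] b by simp
  qed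
  then show ?thesis by eventually_elim (simp add: w_def)
qed

lemma schroedinger_solution_unique:
  fixes u v :: "real \<Rightarrow> 'a::euclidean_space \<Rightarrow> complex"
  assumes u: "is_schroedinger_solution f u" and v: "is_schroedinger_solution f v"
  shows "AE x in lborel. u t x = v t x"
proof -
  have d: "is_schroedinger_solution (\<lambda>_. 0) (\<lambda>t x. u t x - v t x)"
    by (rule schroedinger_solution_diff[OF u v])
  have "AE x in lborel. u t x - v t x = 0"
  proof (rule AE_zero_of_gaussian_averages)
    show "(\<lambda>x. u t x - v t x) \<in> L2 lborel" using d by (simp add: is_schroedinger_solution_def)
    fix b :: real and y :: 'a assume "b > 0"
    then show "(LINT x|lborel. (u t x - v t x) * of_real (exp (- b * (norm (x - y))\<^sup>2))) = 0"
      using schroedinger_gaussian_pairing_zero[OF d, of "1 / (4 * b)" t y] by (simp add: mult.commute)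
  qed
  then show ?thesis by simp
qed

section \<open>Existence: the lens transform\<close>

subsection \<open>Integration by parts\<close>

text \<open>
  The difference quotients of \<open>F\<close> in direction \<open>b\<close> integrate to zero by translation invariance.
\<close>

lemma integral_directional_derivative_zero:
  fixes F F' :: "'a::euclidean_space \<Rightarrow> complex"
  assumes F: "\<And>x. \<exists>D. (F has_derivative D) (at x) \<and> D b = F' x"
    and bF: "bounded {x. F x \<noteq> 0}" and cF': "continuous_on UNIV F'" and bF': "bounded {x. F' x \<noteq> 0}"
  shows "(LINT x|lborel. F' x) = 0"
proof -
  have Fd: "F differentiable (at x)" for x using F[of x] by (auto simp: differentiable_def)
  then have cF: "continuous_on UNIV F"
    by (meson continuous_at_imp_continuous_on differentiable_imp_continuous_within)
  have [measurable]: "F \<in> borel_measurable borel" "F' \<in> borel_measurable borel"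
    by (intro borel_measurable_continuous_onI cF cF')+
  have "bounded (F' ` closure {x. F' x \<noteq> 0})"
    using bF' by (intro compact_imp_bounded compact_continuous_image continuous_on_subset[OF cF']) (auto simp: compact_closure)
  then obtain B where B: "\<And>x. x \<in> closure {x. F' x \<noteq> 0} \<Longrightarrow> cmod (F' x) \<le> B"
    unfolding bounded_iff by blast
  have B': "cmod (F' x) \<le> \<bar>B\<bar>" for x
    using B[of x] closure_subset[of "{x. F' x \<noteq> 0}"] by (cases "F' x = 0") auto
  have line: "((\<lambda>s. F (x + s *\<^sub>R b)) has_vector_derivative F' (x + s *\<^sub>R b)) (at s)" for x s
  proof -
    obtain D where D: "(F has_derivative D) (at (x + s *\<^sub>R b))" "D b = F' (x + s *\<^sub>R b)" using F by blast
    have "((\<lambda>s. x + s *\<^sub>R b) has_derivative (\<lambda>h. h *\<^sub>R b)) (at s)" by (auto intro!: derivative_eq_intros)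
    from diff_chain_at[OF this D(1)] have "((\<lambda>s. F (x + s *\<^sub>R b)) has_derivative (\<lambda>h. D (h *\<^sub>R b))) (at s)"
      by (simp add: o_def)
    then show ?thesis
      using D has_derivative_bounded_linear[OF D(1)]
      by (simp add: has_vector_derivative_def linear_simps)
  qed
  obtain R where R: "\<And>x. F x \<noteq> 0 \<Longrightarrow> norm x \<le> R" using bF by (auto simp: bounded_iff)
  define h where "h n = 1 / real (Suc n)" for n
  have h: "0 < h n" "h n \<le> 1" for n by (auto simp: h_def)
  have hl: "h \<longlonglongrightarrow> 0" unfolding h_def using LIMSEQ_inverse_real_of_nat by (simp add: inverse_eq_divide)
  define q where "q n x = (F (x + h n *\<^sub>R b) - F x) / of_real (h n)" for n x
  have Fint: "integrable lborel F"
  proof -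
    have "integrable lborel (\<lambda>x. indicat_real (cball 0 R) x *\<^sub>R F x)"
      by (intro borel_integrable_compact continuous_on_subset[OF cF]) auto
    also have "(\<lambda>x. indicat_real (cball 0 R) x *\<^sub>R F x) = F"
      using R by (fastforce simp: indicator_def)
    finally show ?thesis .
  qed
  have q0: "(LINT x|lborel. q n x) = 0" for n
  proof -
    have i: "integrable lborel (\<lambda>x. F (x + h n *\<^sub>R b))"
      using integrable_lborel_shift[OF Fint, of "h n *\<^sub>R b"] by (simp add: add.commute)
    have "(LINT x|lborel. F (x + h n *\<^sub>R b)) = (LINT x|lborel. F x)"
      using lborel_integral_shift[of F "h n *\<^sub>R b"] by (simp add: add.commute)
    then show ?thesis unfolding q_def using Fint i by simp
  qed
  have "(\<lambda>n. LINT x|lborel. q n x) \<longlonglongrightarrow> (LINT x|lborel. F' x)"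
  proof (rule integral_dominated_convergence)
    show "integrable lborel (\<lambda>x. indicat_real (cball (0::'a) (R + norm b)) x *\<^sub>R \<bar>B\<bar>)"
      by (intro borel_integrable_compact) auto
    show "AE x in lborel. (\<lambda>n. q n x) \<longlonglongrightarrow> F' x"
    proof (rule AE_I2)
      fix x
      show "(\<lambda>n. q n x) \<longlonglongrightarrow> F' x"
        using line[of x 0] h hl
        unfolding has_vector_derivative_iff_quotient tendsto_at_iff_sequentially o_def q_def
        by (auto dest!: spec[of _ h] simp: less_imp_neq[OF h(1), symmetric])
    qed
    show "AE x in lborel. norm (q n x) \<le> indicat_real (cball 0 (R + norm b)) x *\<^sub>R \<bar>B\<bar>" for n
    proof (rule AE_I2)
      fix x
      show "norm (q n x) \<le> indicat_real (cball 0 (R + norm b)) x *\<^sub>R \<bar>B\<bar>"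
      proof (cases "x \<in> cball 0 (R + norm b)")
        case True
        have "cmod (F (x + h n *\<^sub>R b) - F (x + 0 *\<^sub>R b)) \<le> \<bar>B\<bar> * \<bar>h n - 0\<bar>"
          by (rule vector_derivative_bound[OF line convex_UNIV B']) auto
        then have "norm (q n x) \<le> \<bar>B\<bar>"
          using h[of n] by (simp add: q_def norm_divide divide_simps)
        then show ?thesis using True by simp
      next
        case False
        have "F x = 0"
        proof (rule ccontr)
          assume "F x \<noteq> 0"
          then have "norm x \<le> R + norm b" using R[of x] norm_ge_zero[of b] by linarith
          then show False using False by simp
        qed
        moreover have "F (x + h n *\<^sub>R b) = 0"
        proof (rule ccontr)
          assume "F (x + h n *\<^sub>R b) \<noteq> 0"
          then have "norm (x + h n *\<^sub>R b) \<le> R" by (rule R)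
          moreover have "norm (h n *\<^sub>R b) \<le> norm b" using h[of n] mult_right_mono[of "h n" 1 "norm b"] by simp
          ultimately have "norm x \<le> R + norm b"
            using norm_triangle_ineq4[of "x + h n *\<^sub>R b" "h n *\<^sub>R b"] by simp
          then show False using False by simp
        qed
        ultimately show ?thesis by (simp add: q_def)
      qed
    qed
    show "q n \<in> borel_measurable lborel" for n unfolding q_def by measurable
  qed measurable
  then have "(\<lambda>n::nat. 0) \<longlonglongrightarrow> (LINT x|lborel. F' x)" unfolding q0 .
  then show ?thesis by (simp only: LIMSEQ_const_iff)
qed

text \<open>
  For each \<open>b\<close> the difference of the two integrands is the derivative in direction \<open>b\<close> of
  \<open>\<partial>\<^sub>b v * \<phi> - v * \<partial>\<^sub>b \<phi>\<close>, which has bounded support.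
\<close>

lemma green_identity:
  fixes v \<phi> :: "'a::euclidean_space \<Rightarrow> complex"
  assumes v: "v differentiable_on UNIV" "\<And>b. b \<in> Basis \<Longrightarrow> partial_deriv b v differentiable_on UNIV"
    "\<And>b. b \<in> Basis \<Longrightarrow> continuous_on UNIV (partial_deriv b (partial_deriv b v))"
    and \<phi>: "test_function \<phi>"
  shows "(LINT x|lborel. laplacian v x * \<phi> x) = (LINT x|lborel. v x * laplacian \<phi> x)"
proof -
  have cv: "continuous_on UNIV v" and c\<phi>: "continuous_on UNIV \<phi>"
    using differentiable_imp_continuous_on[OF v(1)] test_function_continuous[OF \<phi>] by auto
  have d\<phi>: "\<phi> differentiable_on UNIV" "\<And>b. b \<in> Basis \<Longrightarrow> partial_deriv b \<phi> differentiable_on UNIV"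
    "\<And>b. b \<in> Basis \<Longrightarrow> continuous_on UNIV (partial_deriv b (partial_deriv b \<phi>))" "bounded {x. \<phi> x \<noteq> 0}"
    using \<phi> by (auto simp: test_function_def)
  have s1: "bounded {x. partial_deriv b \<phi> x \<noteq> 0}" for b
    by (rule bounded_subset[OF bounded_closure[OF d\<phi>(4)] support_partial_deriv])
  have s2: "bounded {x. partial_deriv b (partial_deriv b \<phi>) x \<noteq> 0}" for b
    by (rule bounded_subset[OF bounded_closure[OF s1] support_partial_deriv])
  have der: "(g has_derivative frechet_derivative g (at x)) (at x)" if "g differentiable_on UNIV" for g :: "'a \<Rightarrow> complex" and x
    using that frechet_derivative_works by (auto simp: differentiable_on_def)
  have L: "integrable lborel g" if g: "continuous_on UNIV g" "bounded {x. g x \<noteq> 0}" for g :: "'a \<Rightarrow> complex"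
  proof -
    obtain R where R: "\<And>x. g x \<noteq> 0 \<Longrightarrow> norm x \<le> R" using g(2) by (auto simp: bounded_iff)
    have "integrable lborel (\<lambda>x. indicat_real (cball 0 R) x *\<^sub>R g x)"
      by (intro borel_integrable_compact continuous_on_subset[OF g(1)]) auto
    also have "(\<lambda>x. indicat_real (cball 0 R) x *\<^sub>R g x) = g"
      using R by (fastforce simp: indicator_def)
    finally show ?thesis .
  qed
  have part: "(LINT x|lborel. partial_deriv b (partial_deriv b v) x * \<phi> x) = (LINT x|lborel. v x * partial_deriv b (partial_deriv b \<phi>) x)"
    and i1: "integrable lborel (\<lambda>x. partial_deriv b (partial_deriv b v) x * \<phi> x)"
    and i2: "integrable lborel (\<lambda>x. v x * partial_deriv b (partial_deriv b \<phi>) x)" if b: "b \<in> Basis" for b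
  proof -
    define F where "F x = partial_deriv b v x * \<phi> x - v x * partial_deriv b \<phi> x" for x
    define F' where "F' x = partial_deriv b (partial_deriv b v) x * \<phi> x - v x * partial_deriv b (partial_deriv b \<phi>) x" for x
    have b1: "bounded {x. partial_deriv b (partial_deriv b v) x * \<phi> x \<noteq> 0}"
      by (rule bounded_subset[OF d\<phi>(4)]) auto
    have b2: "bounded {x. v x * partial_deriv b (partial_deriv b \<phi>) x \<noteq> 0}"
      by (rule bounded_subset[OF s2]) auto
    have c1: "continuous_on UNIV (\<lambda>x. partial_deriv b (partial_deriv b v) x * \<phi> x)"
      by (intro continuous_intros v(3) b c\<phi>)
    have c2: "continuous_on UNIV (\<lambda>x. v x * partial_deriv b (partial_deriv b \<phi>) x)"
      by (intro continuous_intros cv d\<phi>(3) b)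
    show i1: "integrable lborel (\<lambda>x. partial_deriv b (partial_deriv b v) x * \<phi> x)" by (rule L[OF c1 b1])
    show i2: "integrable lborel (\<lambda>x. v x * partial_deriv b (partial_deriv b \<phi>) x)" by (rule L[OF c2 b2])
    have "(LINT x|lborel. F' x) = 0"
    proof (rule integral_directional_derivative_zero[where F = F and b = b])
      fix x
      let ?D = "\<lambda>h. partial_deriv b v x * frechet_derivative \<phi> (at x) h + frechet_derivative (partial_deriv b v) (at x) h * \<phi> x
          - (v x * frechet_derivative (partial_deriv b \<phi>) (at x) h + frechet_derivative v (at x) h * partial_deriv b \<phi> x)"
      have "(F has_derivative ?D) (at x)"
        unfolding F_def[abs_def]
        by (intro has_derivative_diff has_derivative_mult der v d\<phi> b)
      moreover have "?D b = F' x"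
        unfolding F'_def by (simp add: partial_deriv_def)
      ultimately show "\<exists>D. (F has_derivative D) (at x) \<and> D b = F' x" by blast
    next
      have "{x. F x \<noteq> 0} \<subseteq> {x. \<phi> x \<noteq> 0} \<union> {x. partial_deriv b \<phi> x \<noteq> 0}" by (auto simp: F_def)
      then show "bounded {x. F x \<noteq> 0}" by (rule bounded_subset[rotated]) (use d\<phi>(4) s1 in auto)
      have "{x. F' x \<noteq> 0} \<subseteq> {x. \<phi> x \<noteq> 0} \<union> {x. partial_deriv b (partial_deriv b \<phi>) x \<noteq> 0}" by (auto simp: F'_def)
      then show "bounded {x. F' x \<noteq> 0}" by (rule bounded_subset[rotated]) (use d\<phi>(4) s2 in auto)
      show "continuous_on UNIV F'" unfolding F'_def[abs_def] by (intro continuous_on_diff c1 c2)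
    qed
    then show "(LINT x|lborel. partial_deriv b (partial_deriv b v) x * \<phi> x) = (LINT x|lborel. v x * partial_deriv b (partial_deriv b \<phi>) x)"
      unfolding F'_def using i1 i2 by simp
  qed
  have "(LINT x|lborel. laplacian v x * \<phi> x) = (\<Sum>b\<in>Basis. LINT x|lborel. partial_deriv b (partial_deriv b v) x * \<phi> x)"
    unfolding laplacian_def sum_distrib_right using i1 by (intro Bochner_Integration.integral_sum) auto
  also have "\<dots> = (\<Sum>b\<in>Basis. LINT x|lborel. v x * partial_deriv b (partial_deriv b \<phi>) x)"
    by (intro sum.cong refl part)
  also have "\<dots> = (LINT x|lborel. v x * laplacian \<phi> x)"
    unfolding laplacian_def sum_distrib_left using i2 by (intro Bochner_Integration.integral_sum[symmetric]) auto
  finally show ?thesis .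
qed

lemma green_identity_radial:
  fixes \<phi> :: "'a::euclidean_space \<Rightarrow> complex"
  assumes H: "\<And>r. (H has_vector_derivative H' r) (at r)" and H': "\<And>r. (H' has_vector_derivative H'' r) (at r)"
    and c: "continuous_on UNIV H''" and \<phi>: "test_function \<phi>"
  shows "(LINT x|lborel. ((4 * (norm x)\<^sup>2) *\<^sub>R H'' ((norm x)\<^sup>2) + (2 * real DIM('a)) *\<^sub>R H' ((norm x)\<^sup>2)) * \<phi> x) =
         (LINT x|lborel. H ((norm x)\<^sup>2) * laplacian \<phi> x)"
proof -
  have cH': "continuous_on UNIV H'"
    using H' by (meson continuous_at_imp_continuous_on has_vector_derivative_continuous)
  have "(LINT x|lborel. laplacian (\<lambda>x. H ((norm (x - 0))\<^sup>2)) x * \<phi> x) = (LINT x|lborel. H ((norm (x - 0))\<^sup>2) * laplacian \<phi> x)"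
  proof (rule green_identity[OF _ _ _ \<phi>])
    show "(\<lambda>x::'a. H ((norm (x - 0))\<^sup>2)) differentiable_on UNIV"
      unfolding differentiable_on_def differentiable_def using has_derivative_radial[OF H] by blast
    show "partial_deriv b (\<lambda>x::'a. H ((norm (x - 0))\<^sup>2)) differentiable_on UNIV" for b
      unfolding differentiable_on_def differentiable_def partial_deriv_radial[OF H H']
      using has_derivative_coordinate_radial[OF H'] by blast
    show "continuous_on UNIV (partial_deriv b (partial_deriv b (\<lambda>x::'a. H ((norm (x - 0))\<^sup>2))))" for b
      unfolding partial_deriv_partial_deriv_radial[OF H H']
      by (intro continuous_intros continuous_on_compose2[OF c] continuous_on_compose2[OF cH']) auto
  qed
  then show ?thesis unfolding laplacian_radial[OF H H'] by simp
qed

subsection \<open>The lens transform of a radial profile\<close>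

text \<open>
  The complex time \<open>z = 1 / (4 \<pi>) + i t\<close> is chosen so that the kernel at \<open>t = 0\<close> is the Gaussian
  \<open>exp (- \<pi> |x|\<^sup>2)\<close> of the basis functions. Then \<open>1 + 4 \<pi> i t = 4 \<pi> z\<close>, and \<open>lens_width t\<close> and
  \<open>- \<pi> * lens_phase t\<close> are its squared modulus and its argument.
\<close>

definition lens_time :: "real \<Rightarrow> complex" where
  "lens_time t = Complex (1 / (4 * pi)) t"

definition lens_width :: "real \<Rightarrow> real" where
  "lens_width t = 1 + (4 * pi * t)\<^sup>2"

definition lens_phase :: "real \<Rightarrow> real" where
  "lens_phase t = - arctan (4 * pi * t) / pi"

definition lens_kernel :: "real \<Rightarrow> real \<Rightarrow> real \<Rightarrow> complex" where
  "lens_kernel D t r = of_real ((4 * pi) powr (- D / 2)) * free_kernel D (lens_time t) r"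

definition lens :: "real \<Rightarrow> (real \<Rightarrow> complex) \<Rightarrow> 'a::euclidean_space \<Rightarrow> complex" where
  "lens t F x = F (2 * pi / lens_width t * (norm x)\<^sup>2) * lens_kernel (real DIM('a)) t ((norm x)\<^sup>2)"

lemma lens_width_ge_1: "1 \<le> lens_width t"
  by (simp add: lens_width_def)

lemma lens_width_pos: "0 < lens_width t"
  using lens_width_ge_1[of t] by simp

lemma Re_lens_time_pos: "Re (lens_time t) > 0"
  by (simp add: lens_time_def)

lemma lens_time_nonzero: "lens_time t \<noteq> 0"
  using Re_lens_time_pos[of t] by auto

lemma cmod_lens_time: "cmod (lens_time t) = sqrt (lens_width t) / (4 * pi)"
proof -
  have "(1 / (4 * pi))\<^sup>2 + t\<^sup>2 = lens_width t / (4 * pi)\<^sup>2"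
    by (simp add: lens_width_def power_mult_distrib divide_simps)
  then have "cmod (lens_time t) = sqrt (lens_width t) / sqrt ((4 * pi)\<^sup>2)"
    unfolding lens_time_def complex_norm complex.sel by (simp only: real_sqrt_divide)
  then show ?thesis by (simp only: real_sqrt_abs abs_of_pos[OF mult_pos_pos[OF zero_less_numeral pi_gt_zero]])
qed

lemma inverse_lens_time:
  "1 / lens_time t = of_real (4 * pi / lens_width t) * (1 - \<i> * of_real (4 * pi * t))"
proof -
  have z: "lens_time t = (1 + \<i> * of_real (4 * pi * t)) / of_real (4 * pi)"
    by (simp add: lens_time_def complex_eq_iff)
  have "(1 + \<i> * of_real (4 * pi * t)) * (1 - \<i> * of_real (4 * pi * t)) = complex_of_real (lens_width t)"
    by (simp add: lens_width_def algebra_simps power2_eq_square)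
  moreover have "lens_time t * (of_real (4 * pi / lens_width t) * (1 - \<i> * of_real (4 * pi * t))) =
      (1 + \<i> * of_real (4 * pi * t)) * (1 - \<i> * of_real (4 * pi * t)) / of_real (lens_width t)"
    unfolding z by simp
  ultimately have "lens_time t * (of_real (4 * pi / lens_width t) * (1 - \<i> * of_real (4 * pi * t))) = 1"
    using lens_width_pos[of t] by simp
  then show ?thesis using lens_time_nonzero[of t] by (simp add: field_simps)
qed

lemma norm_lens_kernel:
  "cmod (lens_kernel D t r) = lens_width t powr (- D / 4) * exp (- pi / lens_width t * r)"
proof -
  let ?\<sigma> = "lens_width t"
  have \<sigma>: "?\<sigma> > 0" by (rule lens_width_pos)
  have e: "Re (lens_time t) / (4 * (cmod (lens_time t))\<^sup>2) = pi / ?\<sigma>"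
  proof -
    have R: "Re (lens_time t) = 1 / (4 * pi)" by (simp add: lens_time_def)
    show ?thesis
      unfolding R cmod_lens_time using \<sigma> by (simp add: power_divide power_mult_distrib divide_simps power2_eq_square)
  qed
  have "(4 * pi) powr (- D / 2) * (sqrt ?\<sigma> / (4 * pi)) powr (- D / 2) = (sqrt ?\<sigma>) powr (- D / 2)"
    using \<sigma> by (simp add: powr_divide)
  also have "\<dots> = ?\<sigma> powr (- D / 4)"
    using \<sigma> by (simp add: powr_half_sqrt[symmetric] powr_powr)
  finally have p: "(4 * pi) powr (- D / 2) * (sqrt ?\<sigma> / (4 * pi)) powr (- D / 2) = ?\<sigma> powr (- D / 4)" .
  have "cmod (lens_kernel D t r) = (4 * pi) powr (- D / 2) * (cmod (lens_time t) powr (- D / 2) * exp (- r * (pi / ?\<sigma>)))"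
    unfolding lens_kernel_def norm_mult norm_free_kernel[OF Re_lens_time_pos] e
    by (simp only: norm_of_real abs_of_nonneg[OF powr_ge_zero])
  also have "\<dots> = ?\<sigma> powr (- D / 4) * exp (- r * (pi / ?\<sigma>))"
    unfolding cmod_lens_time mult.assoc[symmetric] p ..
  finally show ?thesis by (simp add: mult.commute)
qed

lemma continuous_lens_kernel: "continuous_on UNIV (lens_kernel D t)"
  unfolding lens_kernel_def[abs_def] free_kernel_def using lens_time_nonzero[of t] by (intro continuous_intros) auto

lemma lens_measurable [measurable]:
  assumes [measurable]: "F \<in> borel_measurable borel"
  shows "(lens t F :: 'a::euclidean_space \<Rightarrow> complex) \<in> borel_measurable borel"
proof -
  have [measurable]: "lens_kernel D t \<in> borel_measurable borel" for D by (intro borel_measurable_continuous_onI continuous_lens_kernel)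
  show ?thesis unfolding lens_def[abs_def] by measurable
qed

text \<open>
  In the variable \<open>|x|\<^sup>2\<close> the modulus of the lens transform is \<open>|F|\<close> times a Gaussian, dilated by
  \<open>lens_width t\<close> and lowered accordingly; this is where the dispersive decay comes from.
\<close>

lemma nn_integral_lens:
  fixes F :: "real \<Rightarrow> complex"
  assumes p: "p > 0" and [measurable]: "F \<in> borel_measurable borel"
  defines "D \<equiv> real DIM('a::euclidean_space)"
  shows "(\<integral>\<^sup>+(x::'a). ennreal (cmod (lens t F x) powr p) \<partial>lborel) =
         ennreal (p powr (- D / 2) * lens_width t powr (D / 2 - D * p / 4)) *
           (\<integral>\<^sup>+y. ennreal (cmod (F (2 / p * y)) powr p) \<partial>laguerre_measure (D / 2 - 1))"
proof -
  let ?\<sigma> = "lens_width t"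
  have \<sigma>: "?\<sigma> > 0" by (rule lens_width_pos)
  define \<kappa> where "\<kappa> = p * pi / ?\<sigma>"
  have \<kappa>: "\<kappa> > 0" using p \<sigma> by (simp add: \<kappa>_def)
  define c where "c = ?\<sigma> powr (- D * p / 4)"
  have c: "c \<ge> 0" by (simp add: c_def)
  define H where "H y = ennreal c * ennreal (cmod (F (2 / p * y)) powr p)" for y
  have [measurable]: "H \<in> borel_measurable borel" unfolding H_def by measurable
  have "ennreal (cmod (lens t F x) powr p) = H (\<kappa> * (norm x)\<^sup>2) * ennreal (exp (- \<kappa> * (norm x)\<^sup>2))" for x :: 'a
  proof -
    have "cmod (lens t F x) powr p =
      cmod (F (2 * pi / ?\<sigma> * (norm x)\<^sup>2)) powr p * ((?\<sigma> powr (- D / 4)) powr p * exp (- pi / ?\<sigma> * (norm x)\<^sup>2) powr p)"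
      unfolding lens_def norm_mult norm_lens_kernel D_def[symmetric] by (simp add: powr_mult)
    also have "2 * pi / ?\<sigma> * (norm x)\<^sup>2 = 2 / p * (\<kappa> * (norm x)\<^sup>2)"
      using p by (simp add: \<kappa>_def)
    also have "(?\<sigma> powr (- D / 4)) powr p = c"
      by (simp add: c_def powr_powr)
    also have "exp (- pi / ?\<sigma> * (norm x)\<^sup>2) powr p = exp (- \<kappa> * (norm x)\<^sup>2)"
      by (simp add: \<kappa>_def exp_powr_real)
    finally have "cmod (lens t F x) powr p = c * cmod (F (2 / p * (\<kappa> * (norm x)\<^sup>2))) powr p * exp (- \<kappa> * (norm x)\<^sup>2)"
      by (simp only: mult_ac)
    then show ?thesis
      unfolding H_def using c by (simp only: ennreal_mult mult_nonneg_nonneg powr_ge_zero exp_ge_zero)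
  qed
  then have "(\<integral>\<^sup>+(x::'a). ennreal (cmod (lens t F x) powr p) \<partial>lborel) =
     (\<integral>\<^sup>+(x::'a). H (\<kappa> * (norm x)\<^sup>2) * ennreal (exp (- \<kappa> * (norm x)\<^sup>2)) \<partial>lborel)" by simp
  also have "\<dots> = ennreal ((pi / \<kappa>) powr (D / 2)) * (\<integral>\<^sup>+y. H y \<partial>laguerre_measure (D / 2 - 1))"
    unfolding D_def by (rule nn_integral_radial_gaussian[OF \<kappa>]) measurable
  also have "(\<integral>\<^sup>+y. H y \<partial>laguerre_measure (D / 2 - 1)) =
     ennreal c * (\<integral>\<^sup>+y. ennreal (cmod (F (2 / p * y)) powr p) \<partial>laguerre_measure (D / 2 - 1))"
    unfolding H_def by (rule nn_integral_cmult) measurable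
  also have "ennreal ((pi / \<kappa>) powr (D / 2)) * (ennreal c * (\<integral>\<^sup>+y. ennreal (cmod (F (2 / p * y)) powr p) \<partial>laguerre_measure (D / 2 - 1))) =
     ennreal ((pi / \<kappa>) powr (D / 2) * c) * (\<integral>\<^sup>+y. ennreal (cmod (F (2 / p * y)) powr p) \<partial>laguerre_measure (D / 2 - 1))"
    using c by (simp add: ennreal_mult mult.assoc)
  also have "(pi / \<kappa>) powr (D / 2) * c = p powr (- D / 2) * ?\<sigma> powr (D / 2 - D * p / 4)"
  proof -
    have "pi / \<kappa> = ?\<sigma> / p" using p \<sigma> by (simp add: \<kappa>_def)
    then have "(pi / \<kappa>) powr (D / 2) = ?\<sigma> powr (D / 2) / p powr (D / 2)"
      by (simp only: powr_divide)
    moreover have "p powr (- D / 2) = 1 / p powr (D / 2)"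
      using powr_minus[of p "D / 2"] by (simp add: inverse_eq_divide)
    moreover have "?\<sigma> powr (D / 2) * c = ?\<sigma> powr (D / 2 - D * p / 4)"
      by (simp add: c_def powr_add[symmetric])
    ultimately show ?thesis by (simp add: mult_ac)
  qed
  finally show ?thesis .
qed

text \<open>
  For exponent 2 the power of the width cancels: the lens transform is a multiple of an isometry at every time.
\<close>

lemma sqint_lens:
  fixes F :: "real \<Rightarrow> complex"
  assumes [measurable]: "F \<in> borel_measurable borel"
  defines "D \<equiv> real DIM('a::euclidean_space)"
  shows "sqint lborel (lens t F :: 'a \<Rightarrow> complex) = ennreal (2 powr (- D / 2)) * sqint (laguerre_measure (D / 2 - 1)) F"
proof -
  have sq: "cmod z powr 2 = (cmod z)\<^sup>2" for z
    by (cases "z = 0") simp_all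
  have h: "2 / 2 * y = y" for y :: real by simp
  have s: "lens_width t powr (D / 2 - D * 2 / 4) = 1" using lens_width_pos[of t] by simp
  have "(\<integral>\<^sup>+(x::'a). ennreal (cmod (lens t F x) powr 2) \<partial>lborel) =
         ennreal (2 powr (- D / 2) * lens_width t powr (D / 2 - D * 2 / 4)) *
           (\<integral>\<^sup>+y. ennreal (cmod (F (2 / 2 * y)) powr 2) \<partial>laguerre_measure (D / 2 - 1))"
    unfolding D_def by (rule nn_integral_lens) auto
  then show ?thesis unfolding s h sq mult_1_right sqint_def .
qed

lemma lens_diff: "lens t F x - lens t G x = lens t (\<lambda>y. F y - G y) x"
  by (simp add: lens_def left_diff_distrib)

lemma lens_sum: "(\<Sum>n\<in>I. lens t (F n) x) = lens t (\<lambda>y. \<Sum>n\<in>I. F n y) x"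
  by (simp add: lens_def sum_distrib_right)

subsection \<open>Laguerre modes\<close>

text \<open>
  The factor \<open>exp (2 \<pi> i n s)\<close> with \<open>s = lens_phase t\<close> is \<open>((1 - 4 \<pi> i t) / (1 + 4 \<pi> i t)) ^ n\<close>.
\<close>

definition mode_profile :: "real \<Rightarrow> nat \<Rightarrow> real \<Rightarrow> real \<Rightarrow> complex" where
  "mode_profile \<nu> n t y = exp (\<i> * of_real (2 * pi * real n * lens_phase t)) * of_real (poly (laguerre_poly \<nu> n) y)"

definition mode :: "nat \<Rightarrow> real \<Rightarrow> 'a::euclidean_space \<Rightarrow> complex" where
  "mode n t = lens t (mode_profile (real DIM('a) / 2 - 1) n t)"

lemma lens_width_derivative: "(lens_width has_real_derivative 32 * pi\<^sup>2 * t) (at t)"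
  unfolding lens_width_def[abs_def] by (auto intro!: derivative_eq_intros simp: power2_eq_square)

lemma lens_phase_derivative: "(lens_phase has_real_derivative - 4 / lens_width t) (at t)"
  unfolding lens_phase_def[abs_def] lens_width_def
  by (auto intro!: derivative_eq_intros simp: divide_simps) 

lemma lens_time_derivative: "(lens_time has_vector_derivative \<i>) (at t)"
proof -
  have eq: "lens_time = (\<lambda>t. of_real (1 / (4 * pi)) + \<i> * of_real t)"
    by (auto simp: lens_time_def complex_eq_iff)
  have "((\<lambda>w. of_real (1 / (4 * pi)) + \<i> * w) has_field_derivative \<i>) (at (of_real t))"
    by (auto intro!: derivative_eq_intros)
  from has_vector_derivative_real_field[OF this] show ?thesis unfolding eq .
qed

lemma lens_kernel_space_derivative:
  "(lens_kernel D t has_vector_derivative - (1 / (4 * lens_time t)) * lens_kernel D t r) (at r)"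
  unfolding lens_kernel_def[abs_def]
  using has_vector_derivative_mult_right[OF free_kernel_space_derivative[OF lens_time_nonzero[of t], of D r], of "of_real ((4 * pi) powr (- D / 2))"]
  by (simp add: mult_ac)

lemma lens_kernel_time_derivative:
  "((\<lambda>t. lens_kernel D t r) has_vector_derivative
     \<i> * (- of_real (D / 2) / lens_time t + of_real r / (4 * (lens_time t)\<^sup>2)) * lens_kernel D t r) (at t)"
  using has_vector_derivative_mult_right[OF field_vector_diff_chain_at[OF lens_time_derivative
      free_kernel_time_derivative[OF Re_lens_time_pos]], of "of_real ((4 * pi) powr (- D / 2))"]
  by (simp add: lens_kernel_def[abs_def] o_def mult_ac)

text \<open>
  The modes as functions of \<open>r = |x|\<^sup>2\<close>, followed by their first and second derivatives in \<open>r\<close>.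
\<close>

definition mode_r :: "real \<Rightarrow> nat \<Rightarrow> real \<Rightarrow> real \<Rightarrow> complex" where
  "mode_r D n t r = mode_profile (D / 2 - 1) n t (2 * pi / lens_width t * r) * lens_kernel D t r"

definition mode_r' :: "real \<Rightarrow> nat \<Rightarrow> real \<Rightarrow> real \<Rightarrow> complex" where
  "mode_r' D n t r = exp (\<i> * of_real (2 * pi * real n * lens_phase t)) *
     (let L = laguerre_poly (D / 2 - 1) n; \<kappa> = 2 * pi / lens_width t; z = lens_time t in
       of_real (\<kappa> * poly (pderiv L) (\<kappa> * r)) - of_real (poly L (\<kappa> * r)) / (4 * z)) * lens_kernel D t r"

definition mode_r'' :: "real \<Rightarrow> nat \<Rightarrow> real \<Rightarrow> real \<Rightarrow> complex" where
  "mode_r'' D n t r = exp (\<i> * of_real (2 * pi * real n * lens_phase t)) *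
     (let L = laguerre_poly (D / 2 - 1) n; \<kappa> = 2 * pi / lens_width t; z = lens_time t in
       of_real (\<kappa>\<^sup>2 * poly (pderiv (pderiv L)) (\<kappa> * r)) - of_real (\<kappa> * poly (pderiv L) (\<kappa> * r)) / (2 * z)
        + of_real (poly L (\<kappa> * r)) / (16 * z\<^sup>2)) * lens_kernel D t r"

lemma mode_eq: "mode n t (x :: 'a::euclidean_space) = mode_r (real DIM('a)) n t ((norm x)\<^sup>2)"
  by (simp add: mode_def lens_def mode_r_def)

lemma has_vector_derivative_poly_scaled:
  "((\<lambda>r. complex_of_real (poly q (\<kappa> * r))) has_vector_derivative of_real (\<kappa> * poly (pderiv q) (\<kappa> * r))) (at r)"
proof -
  have "((\<lambda>r. poly q (\<kappa> * r)) has_real_derivative poly (pderiv q) (\<kappa> * r) * \<kappa>) (at r)"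
    by (rule DERIV_chain2[OF poly_DERIV]) (auto intro!: derivative_eq_intros)
  then show ?thesis
    by (intro has_vector_derivative_of_real) (simp add: has_real_derivative_iff_has_vector_derivative[symmetric] mult.commute)
qed

lemma mode_r_derivative: "(mode_r D n t has_vector_derivative mode_r' D n t r) (at r)"
proof -
  let ?L = "laguerre_poly (D / 2 - 1) n" and ?\<kappa> = "2 * pi / lens_width t"
  let ?e = "exp (\<i> * of_real (2 * pi * real n * lens_phase t))"
  have "((\<lambda>r. ?e * (complex_of_real (poly ?L (?\<kappa> * r)) * lens_kernel D t r)) has_vector_derivative
     ?e * (complex_of_real (poly ?L (?\<kappa> * r)) * (- (1 / (4 * lens_time t)) * lens_kernel D t r) +
      of_real (?\<kappa> * poly (pderiv ?L) (?\<kappa> * r)) * lens_kernel D t r)) (at r)"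
    by (intro has_vector_derivative_mult_right has_vector_derivative_mult has_vector_derivative_poly_scaled lens_kernel_space_derivative)
  also have "?e * (complex_of_real (poly ?L (?\<kappa> * r)) * (- (1 / (4 * lens_time t)) * lens_kernel D t r) +
      of_real (?\<kappa> * poly (pderiv ?L) (?\<kappa> * r)) * lens_kernel D t r) = mode_r' D n t r"
    unfolding mode_r'_def Let_def by (simp add: algebra_simps)
  finally show ?thesis unfolding mode_r_def[abs_def] mode_profile_def by (simp only: mult.assoc)
qed

lemma mode_r'_derivative: "(mode_r' D n t has_vector_derivative mode_r'' D n t r) (at r)"
proof -
  let ?L = "laguerre_poly (D / 2 - 1) n" and ?\<kappa> = "2 * pi / lens_width t" and ?z = "lens_time t"
  let ?e = "exp (\<i> * of_real (2 * pi * real n * lens_phase t))"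
  have "((\<lambda>r. ?e * ((of_real ?\<kappa> * complex_of_real (poly (pderiv ?L) (?\<kappa> * r)) - of_real (poly ?L (?\<kappa> * r)) / (4 * ?z)) * lens_kernel D t r)) has_vector_derivative
     ?e * ((of_real ?\<kappa> * complex_of_real (poly (pderiv ?L) (?\<kappa> * r)) - of_real (poly ?L (?\<kappa> * r)) / (4 * ?z)) * (- (1 / (4 * ?z)) * lens_kernel D t r) +
      (of_real ?\<kappa> * of_real (?\<kappa> * poly (pderiv (pderiv ?L)) (?\<kappa> * r)) - of_real (?\<kappa> * poly (pderiv ?L) (?\<kappa> * r)) / (4 * ?z)) * lens_kernel D t r)) (at r)"
    by (intro has_vector_derivative_mult_right has_vector_derivative_mult has_vector_derivative_diff has_vector_derivative_divide
        has_vector_derivative_poly_scaled lens_kernel_space_derivative)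
  also have "?e * ((of_real ?\<kappa> * complex_of_real (poly (pderiv ?L) (?\<kappa> * r)) - of_real (poly ?L (?\<kappa> * r)) / (4 * ?z)) * (- (1 / (4 * ?z)) * lens_kernel D t r) +
      (of_real ?\<kappa> * of_real (?\<kappa> * poly (pderiv (pderiv ?L)) (?\<kappa> * r)) - of_real (?\<kappa> * poly (pderiv ?L) (?\<kappa> * r)) / (4 * ?z)) * lens_kernel D t r)
     = mode_r'' D n t r"
    unfolding mode_r''_def Let_def using lens_time_nonzero[of t] by (simp add: power2_eq_square algebra_simps)
  finally show ?thesis unfolding mode_r'_def[abs_def] Let_def by (simp only: mult.assoc of_real_mult)
qed

text \<open>
  Each mode solves the radial free Schroedinger equation; after cancellation the remaining identity
  is the Laguerre equation at \<open>\<kappa> r\<close>.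
\<close>

lemma mode_r_time_derivative:
  assumes D: "D > 0"
  shows "((\<lambda>t. mode_r D n t r) has_vector_derivative
     \<i> * (of_real (4 * r) * mode_r'' D n t r + of_real (2 * D) * mode_r' D n t r)) (at t)"
proof -
  let ?L = "laguerre_poly (D / 2 - 1) n"
  \<comment> \<open>The argument of the Laguerre polynomial is \<open>X = \<kappa> r\<close>; all time derivatives are expressed through \<open>\<kappa>\<close> and \<open>1 / z\<close>.\<close>
  define \<kappa> where "\<kappa> = 2 * pi / lens_width t"
  define z where "z = lens_time t"
  define X where "X = \<kappa> * r"
  define e where "e = exp (\<i> * of_real (2 * pi * real n * lens_phase t))"
  define k where "k = lens_kernel D t r"
  have z: "z \<noteq> 0" unfolding z_def by (rule lens_time_nonzero)
  have zi: "1 / z = of_real (2 * \<kappa>) * (1 - \<i> * of_real (4 * pi * t))"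
    unfolding z_def inverse_lens_time \<kappa>_def by simp
  \<comment> \<open>The derivatives of the phase, of the polynomial and of the kernel.\<close>
  have d1: "((\<lambda>t. exp (\<i> * of_real (2 * pi * real n * lens_phase t))) has_vector_derivative (- 4 * \<i> * of_real (\<kappa> * real n)) * e) (at t)"
  proof -
    have "((\<lambda>t. 2 * pi * real n * lens_phase t) has_real_derivative 2 * pi * real n * (- 4 / lens_width t)) (at t)"
      by (intro DERIV_cmult lens_phase_derivative)
    from has_vector_derivative_mult_right[OF has_vector_derivative_of_real[OF this], of \<i>]
    have "((\<lambda>t. \<i> * of_real (2 * pi * real n * lens_phase t)) has_vector_derivative \<i> * of_real (2 * pi * real n * (- 4 / lens_width t))) (at t)" .
    from field_vector_diff_chain_at[OF this DERIV_exp]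
    show ?thesis by (simp add: o_def e_def \<kappa>_def mult_ac)
  qed
  have d2: "((\<lambda>t. complex_of_real (poly ?L (2 * pi / lens_width t * r))) has_vector_derivative
      of_real (poly (pderiv ?L) X) * (- \<i> * of_real r * of_real \<kappa> * (2 / z - of_real (4 * \<kappa>)))) (at t)"
  proof -
    have "((\<lambda>t. 2 * pi / lens_width t * r) has_real_derivative (- (2 * pi * (32 * pi\<^sup>2 * t)) / (lens_width t)\<^sup>2 * r)) (at t)"
      using lens_width_pos[of t]
      by (auto intro!: derivative_eq_intros lens_width_derivative simp: power2_eq_square)
    from DERIV_chain2[OF poly_DERIV this, of ?L]
    have "((\<lambda>t. poly ?L (2 * pi / lens_width t * r)) has_real_derivative poly (pderiv ?L) X * (- (2 * pi * (32 * pi\<^sup>2 * t)) / (lens_width t)\<^sup>2 * r)) (at t)"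
      by (simp only: X_def \<kappa>_def)
    then have "((\<lambda>t. complex_of_real (poly ?L (2 * pi / lens_width t * r))) has_vector_derivative
       of_real (poly (pderiv ?L) X * (- (2 * pi * (32 * pi\<^sup>2 * t)) / (lens_width t)\<^sup>2 * r))) (at t)"
      by (intro has_vector_derivative_of_real) (simp add: has_real_derivative_iff_has_vector_derivative)
    moreover have "complex_of_real (- (2 * pi * (32 * pi\<^sup>2 * t)) / (lens_width t)\<^sup>2 * r) = - \<i> * of_real r * of_real \<kappa> * (2 / z - of_real (4 * \<kappa>))"
    proof -
      have "2 / z - of_real (4 * \<kappa>) = of_real (- 16 * pi * t * \<kappa>) * \<i>"
        using arg_cong[OF zi, of "\<lambda>w. 2 * w"] by (simp add: algebra_simps)
      then have "- \<i> * of_real r * of_real \<kappa> * (2 / z - of_real (4 * \<kappa>)) = of_real (- 16 * pi * t * r * \<kappa>\<^sup>2)"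
        by (simp add: power2_eq_square)
      also have "- 16 * pi * t * r * \<kappa>\<^sup>2 = - (2 * pi * (32 * pi\<^sup>2 * t)) / (lens_width t)\<^sup>2 * r"
        by (simp add: \<kappa>_def power2_eq_square)
      finally show ?thesis ..
    qed
    ultimately show ?thesis by (simp only: of_real_mult)
  qed
  have d3: "((\<lambda>t. lens_kernel D t r) has_vector_derivative \<i> * (- of_real (D / 2) / z + of_real r / (4 * z\<^sup>2)) * k) (at t)"
    unfolding z_def k_def by (rule lens_kernel_time_derivative)
  define P where "P = complex_of_real (poly ?L X)"
  define P' where "P' = complex_of_real (poly (pderiv ?L) X)"
  define P'' where "P'' = complex_of_real (poly (pderiv (pderiv ?L)) X)"
  have "poly ([:0, 1:] * pderiv (pderiv ?L) + [:D / 2 - 1 + 1, -1:] * pderiv ?L) X = poly (smult (- real n) ?L) X"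
    using laguerre_ode[of "D / 2 - 1" n] D by simp
  then have "X * poly (pderiv (pderiv ?L)) X + (D / 2 - X) * poly (pderiv ?L) X = - real n * poly ?L X"
    by (simp add: algebra_simps)
  then have "of_real (X * poly (pderiv (pderiv ?L)) X + (D / 2 - X) * poly (pderiv ?L) X) = complex_of_real (- real n * poly ?L X)"
    by (rule arg_cong)
  then have ode: "of_nat n * P = - (of_real X * P'' + (of_real D / 2 - of_real X) * P')"
    by (simp add: P_def P'_def P''_def algebra_simps)
  have "((\<lambda>t. exp (\<i> * of_real (2 * pi * real n * lens_phase t)) * complex_of_real (poly ?L (2 * pi / lens_width t * r)) * lens_kernel D t r) has_vector_derivative
     (e * P * (\<i> * (- of_real (D / 2) / z + of_real r / (4 * z\<^sup>2)) * k) +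
      (e * (P' * (- \<i> * of_real r * of_real \<kappa> * (2 / z - of_real (4 * \<kappa>)))) + (- 4 * \<i> * of_real (\<kappa> * real n)) * e * P) * k)) (at t)"
    using has_vector_derivative_mult[OF has_vector_derivative_mult[OF d1 d2] d3]
    by (simp only: P_def P'_def e_def k_def X_def \<kappa>_def)
  also have "(e * P * (\<i> * (- of_real (D / 2) / z + of_real r / (4 * z\<^sup>2)) * k) +
      (e * (P' * (- \<i> * of_real r * of_real \<kappa> * (2 / z - of_real (4 * \<kappa>)))) + (- 4 * \<i> * of_real (\<kappa> * real n)) * e * P) * k) =
      \<i> * e * k * (P * (- of_real (D / 2) / z + of_real r / (4 * z\<^sup>2)) - P' * of_real r * of_real \<kappa> * (2 / z - of_real (4 * \<kappa>)) - 4 * of_real \<kappa> * (of_nat n * P))"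
    by (simp add: algebra_simps)
  also have "\<dots> = \<i> * e * k * (of_real (4 * r) * (of_real (\<kappa>\<^sup>2) * P'' - of_real \<kappa> * P' / (2 * z) + P / (16 * z\<^sup>2)) + of_real (2 * D) * (of_real \<kappa> * P' - P / (4 * z)))"
    unfolding ode X_def using z by (simp add: field_simps power2_eq_square)
  also have "\<dots> = \<i> * (of_real (4 * r) * mode_r'' D n t r + of_real (2 * D) * mode_r' D n t r)"
    unfolding mode_r''_def mode_r'_def Let_def \<kappa>_def[symmetric] z_def[symmetric] X_def[symmetric] e_def[symmetric] k_def[symmetric]
    by (simp add: P_def P'_def P''_def algebra_simps)
  finally show ?thesis unfolding mode_r_def[abs_def] mode_profile_def .
qed

subsection \<open>The modes are solutions\<close>

lemma continuous_lens_data: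
  "continuous_on UNIV lens_width" "continuous_on UNIV lens_phase" "continuous_on UNIV lens_time"
  "continuous_on UNIV (\<lambda>t. lens_time t powr w)"
proof -
  show "continuous_on UNIV lens_width" "continuous_on UNIV lens_phase"
    using lens_width_derivative lens_phase_derivative by (meson DERIV_isCont continuous_at_imp_continuous_on)+
  show c: "continuous_on UNIV lens_time"
    using lens_time_derivative by (meson continuous_at_imp_continuous_on has_vector_derivative_continuous)
  have "lens_time t \<notin> \<real>\<^sub>\<le>\<^sub>0" for t using Re_lens_time_pos[of t] by (auto simp: complex_nonpos_Reals_iff)
  then have "continuous_on UNIV (\<lambda>t. exp (w * Ln (lens_time t)))"
    by (intro continuous_intros c) auto
  then show "continuous_on UNIV (\<lambda>t. lens_time t powr w)"
    using lens_time_nonzero by (simp add: powr_def)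
qed

lemma continuous_mode_r:
  fixes g :: "'b::topological_space \<Rightarrow> real" and r :: "'b \<Rightarrow> real"
  assumes g: "continuous_on S g" and r: "continuous_on S r"
  shows "continuous_on S (\<lambda>a. mode_r D n (g a) (r a))"
    "continuous_on S (\<lambda>a. mode_r' D n (g a) (r a))"
    "continuous_on S (\<lambda>a. mode_r'' D n (g a) (r a))"
proof -
  note c = continuous_on_compose2[OF continuous_lens_data(1) g subset_UNIV]
    continuous_on_compose2[OF continuous_lens_data(2) g subset_UNIV]
    continuous_on_compose2[OF continuous_lens_data(3) g subset_UNIV]
    continuous_on_compose2[OF continuous_lens_data(4) g subset_UNIV]
  have ne: "lens_width (g a) \<noteq> 0" "lens_time (g a) \<noteq> 0" for a
    using lens_width_pos[of "g a"] lens_time_nonzero by auto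
  have k: "continuous_on S (\<lambda>a. lens_kernel D (g a) (r a))"
    unfolding lens_kernel_def free_kernel_def by (intro continuous_intros c r) (use ne in auto)
  show "continuous_on S (\<lambda>a. mode_r D n (g a) (r a))"
    unfolding mode_r_def mode_profile_def by (intro continuous_intros c r k) (use ne in auto)
  show "continuous_on S (\<lambda>a. mode_r' D n (g a) (r a))"
    unfolding mode_r'_def Let_def by (intro continuous_intros c r k) (use ne in auto)
  show "continuous_on S (\<lambda>a. mode_r'' D n (g a) (r a))"
    unfolding mode_r''_def Let_def by (intro continuous_intros c r k) (use ne in auto)
qed

lemma lborel_integral_eq_integral_cbox:
  fixes g :: "'a::euclidean_space \<Rightarrow> complex"
  assumes c: "continuous_on UNIV g" and s: "\<And>x. g x \<noteq> 0 \<Longrightarrow> x \<in> cbox a b"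
  shows "(LINT x|lborel. g x) = integral (cbox a b) g"
proof -
  have "set_integrable lborel (cbox a b) g"
    unfolding set_integrable_def by (intro borel_integrable_compact continuous_on_subset[OF c]) auto
  then have "(LINT x:cbox a b|lborel. g x) = integral (cbox a b) g"
    using set_borel_integral_eq_integral(2) by blast
  moreover have "(LINT x:cbox a b|lborel. g x) = (LINT x|lborel. g x)"
    unfolding set_lebesgue_integral_def
    by (intro Bochner_Integration.integral_cong refl) (use s in \<open>fastforce simp: indicator_def\<close>)
  ultimately show ?thesis by simp
qed

text \<open>
  The time derivative passes under the integral because \<open>\<phi>\<close> has bounded support; the equation for the mode
  turns it into a Laplacian, which Green's identity moves to \<open>\<phi>\<close>.
\<close>

lemma mode_weak_derivative:
  fixes \<phi> :: "'a::euclidean_space \<Rightarrow> complex"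
  assumes \<phi>: "test_function \<phi>"
  shows "((\<lambda>t. LINT x|lborel. mode n t x * \<phi> x) has_vector_derivative
            \<i> * (LINT x|lborel. mode n t x * laplacian \<phi> x)) (at t)"
proof -
  define D where "D = real DIM('a)"
  have D: "D > 0" by (simp add: D_def)
  have c\<phi>: "continuous_on UNIV \<phi>" by (rule test_function_continuous[OF \<phi>])
  have "bounded {x. \<phi> x \<noteq> 0}" using \<phi> by (simp add: test_function_def)
  then obtain a where "{x. \<phi> x \<noteq> 0} \<subseteq> cbox (- a) a" using bounded_subset_cbox_symmetric by blast
  then have supp: "x \<in> cbox (- a) a" if "\<phi> x \<noteq> 0" for x using that by auto
  define V where "V t x = \<i> * (of_real (4 * (norm x)\<^sup>2) * mode_r'' D n t ((norm x)\<^sup>2) + of_real (2 * D) * mode_r' D n t ((norm x)\<^sup>2))" for t and x :: 'a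
  have cV: "continuous_on UNIV (\<lambda>p. V (fst p) (snd p))"
    unfolding V_def by (intro continuous_intros continuous_mode_r)
  have cM: "continuous_on UNIV (\<lambda>x::'a. mode n t x)" for t
    unfolding mode_eq by (intro continuous_intros continuous_mode_r)
  have "((\<lambda>t. integral (cbox (- a) a) (\<lambda>x. mode n t x * \<phi> x)) has_vector_derivative
          integral (cbox (- a) a) (\<lambda>x. V t x * \<phi> x)) (at t within UNIV)"
  proof (rule leibniz_rule_vector_derivative)
    fix s :: real and x :: 'a
    show "((\<lambda>s. mode n s x * \<phi> x) has_vector_derivative V s x * \<phi> x) (at s within UNIV)"
      unfolding V_def mode_eq D_def[symmetric]
      by (intro has_vector_derivative_mult_left mode_r_time_derivative D)
  next
    fix s :: real
    show "(\<lambda>x. mode n s x * \<phi> x) integrable_on cbox (- a) a"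
      by (intro integrable_continuous continuous_on_subset[OF continuous_on_mult[OF cM c\<phi>]]) auto
  next
    have "continuous_on UNIV (\<lambda>p::real \<times> 'a. V (fst p) (snd p) * \<phi> (snd p))"
      by (intro continuous_intros cV continuous_on_compose2[OF c\<phi>]) auto
    then show "continuous_on (UNIV \<times> cbox (- a) a) (\<lambda>(s, x). V s x * \<phi> x)"
      by (auto simp: case_prod_unfold intro: continuous_on_subset)
  qed auto
  moreover have "integral (cbox (- a) a) (\<lambda>x. mode n t x * \<phi> x) = (LINT x|lborel. mode n t x * \<phi> x)" for t
    by (rule lborel_integral_eq_integral_cbox[symmetric]) (use supp in \<open>auto intro!: continuous_intros cM c\<phi>\<close>)
  moreover have "integral (cbox (- a) a) (\<lambda>x. V t x * \<phi> x) = \<i> * (LINT x|lborel. mode n t x * laplacian \<phi> x)"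
  proof -
    have "continuous_on UNIV (\<lambda>x. V t x)"
      using continuous_on_compose2[OF cV, of UNIV "\<lambda>x. (t, x)"] by (simp add: continuous_on_Pair)
    then have "integral (cbox (- a) a) (\<lambda>x. V t x * \<phi> x) = (LINT x|lborel. V t x * \<phi> x)"
      by (intro lborel_integral_eq_integral_cbox[symmetric] continuous_on_mult c\<phi>) (use supp in auto)
    also have "\<dots> = (LINT x|lborel. \<i> * (((4 * (norm x)\<^sup>2) *\<^sub>R mode_r'' D n t ((norm x)\<^sup>2) + (2 * D) *\<^sub>R mode_r' D n t ((norm x)\<^sup>2)) * \<phi> x))"
      unfolding V_def scaleR_conv_of_real by (simp only: mult.assoc)
    also have "\<dots> = \<i> * (LINT x|lborel. mode_r D n t ((norm x)\<^sup>2) * laplacian \<phi> x)"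
      unfolding D_def
      by (subst integral_mult_right_zero, subst green_identity_radial[OF mode_r_derivative mode_r'_derivative _ \<phi>])
         (auto intro!: continuous_mode_r continuous_intros)
    finally show ?thesis by (simp add: mode_eq D_def)
  qed
  ultimately show ?thesis by simp
qed

lemma poly_growth:
  fixes q :: "real poly"
  obtains C where "0 \<le> C" "\<And>x. 0 \<le> x \<Longrightarrow> \<bar>poly q x\<bar> \<le> C * (1 + x) ^ degree q"
proof
  let ?C = "\<Sum>i\<le>degree q. \<bar>coeff q i\<bar>"
  show "0 \<le> ?C" by (intro sum_nonneg) auto
  fix x :: real assume x: "0 \<le> x"
  have "\<bar>poly q x\<bar> \<le> (\<Sum>i\<le>degree q. \<bar>coeff q i * x ^ i\<bar>)"
    unfolding poly_altdef by (rule sum_abs)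
  also have "\<dots> \<le> (\<Sum>i\<le>degree q. \<bar>coeff q i\<bar> * (1 + x) ^ degree q)"
  proof (intro sum_mono)
    fix i assume i: "i \<in> {..degree q}"
    have "x ^ i \<le> (1 + x) ^ i" using x by (intro power_mono) auto
    also have "\<dots> \<le> (1 + x) ^ degree q" using x i by (intro power_increasing) auto
    finally show "\<bar>coeff q i * x ^ i\<bar> \<le> \<bar>coeff q i\<bar> * (1 + x) ^ degree q"
      using x by (simp add: abs_mult mult_left_mono)
  qed
  finally show "\<bar>poly q x\<bar> \<le> ?C * (1 + x) ^ degree q" by (simp add: sum_distrib_right)
qed

text \<open>
  Over a bounded time interval the widths are bounded, so one Gaussian with a polynomial factor dominates the
  mode throughout.
\<close>

lemma mode_dominated:
  assumes "0 \<le> S"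
  obtains m :: "'a::euclidean_space \<Rightarrow> complex" where "m \<in> L2 lborel" "\<And>s x. \<bar>s\<bar> \<le> S \<Longrightarrow> cmod (mode n s x) \<le> cmod (m x)"
proof -
  define D where "D = real DIM('a)"
  have D: "D > 0" by (simp add: D_def)
  let ?L = "laguerre_poly (D / 2 - 1) n"
  obtain C where C: "0 \<le> C" "\<And>x. 0 \<le> x \<Longrightarrow> \<bar>poly ?L x\<bar> \<le> C * (1 + x) ^ degree ?L"
    using poly_growth[of ?L] by blast
  define \<delta> where "\<delta> = pi / lens_width S"
  have \<delta>: "\<delta> > 0" using lens_width_pos[of S] by (simp add: \<delta>_def)
  define C' where "C' = C * (1 + 2 * pi) ^ degree ?L"
  define m where "m x = complex_of_real C' * complex_of_real ((1 + (norm (x - 0))\<^sup>2) ^ degree ?L * exp (- \<delta> * (norm (x - 0))\<^sup>2))" for x :: 'a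
  have mL: "m \<in> L2 lborel"
    unfolding m_def by (intro L2_cmult gaussian_moment_L2 \<delta>)
  have "cmod (mode n s x) \<le> cmod (m x)" if s: "\<bar>s\<bar> \<le> S" for s and x :: 'a
  proof -
    let ?r = "(norm x)\<^sup>2" and ?\<sigma> = "lens_width s"
    have \<sigma>: "1 \<le> ?\<sigma>" by (rule lens_width_ge_1)
    have "s\<^sup>2 \<le> S\<^sup>2" using s by (intro power2_le_iff_abs_le[THEN iffD2]) (use \<open>0 \<le> S\<close> in auto)
    then have "?\<sigma> \<le> lens_width S" by (simp add: lens_width_def power_mult_distrib)
    then have d: "\<delta> \<le> pi / ?\<sigma>" using \<sigma> by (auto simp: \<delta>_def intro!: divide_left_mono)
    have "2 * pi / ?\<sigma> * ?r \<le> 2 * pi * ?r"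
      using \<sigma> by (intro mult_right_mono) (auto simp: divide_le_eq)
    moreover have "(1 + 2 * pi) * (1 + ?r) = (1 + 2 * pi * ?r) + (?r + 2 * pi)" by (simp add: algebra_simps)
    moreover have "0 \<le> ?r + 2 * pi" using pi_ge_zero by simp
    ultimately have X: "0 \<le> 2 * pi / ?\<sigma> * ?r" "1 + 2 * pi / ?\<sigma> * ?r \<le> (1 + 2 * pi) * (1 + ?r)"
      using \<sigma> by (simp, linarith)
    have "\<bar>poly ?L (2 * pi / ?\<sigma> * ?r)\<bar> \<le> C * (1 + 2 * pi / ?\<sigma> * ?r) ^ degree ?L" by (rule C(2)[OF X(1)])
    also have "\<dots> \<le> C * ((1 + 2 * pi) * (1 + ?r)) ^ degree ?L"
      using X C(1) by (intro mult_left_mono power_mono) auto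
    also have "\<dots> = C' * (1 + ?r) ^ degree ?L" by (simp add: C'_def power_mult_distrib)
    finally have 1: "\<bar>poly ?L (2 * pi / ?\<sigma> * ?r)\<bar> \<le> C' * (1 + ?r) ^ degree ?L" .
    have "?\<sigma> powr (- D / 4) \<le> 1 powr (- D / 4)" using \<sigma> D by (intro powr_mono2') auto
    moreover have "exp (- pi / ?\<sigma> * ?r) \<le> exp (- \<delta> * ?r)"
      using mult_right_mono[OF d, of ?r] by simp
    ultimately have 2: "?\<sigma> powr (- D / 4) * exp (- pi / ?\<sigma> * ?r) \<le> 1 * exp (- \<delta> * ?r)"
      by (intro mult_mono) auto
    have "cmod (mode n s x) = \<bar>poly ?L (2 * pi / ?\<sigma> * ?r)\<bar> * (?\<sigma> powr (- D / 4) * exp (- pi / ?\<sigma> * ?r))"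
      unfolding mode_eq mode_r_def mode_profile_def norm_mult norm_lens_kernel D_def[symmetric] by simp
    also have "\<dots> \<le> C' * (1 + ?r) ^ degree ?L * (1 * exp (- \<delta> * ?r))"
      by (rule mult_mono[OF 1 2]) (use C(1) in \<open>auto simp: C'_def\<close>)
    also have "\<dots> = cmod (m x)"
      unfolding m_def norm_mult norm_of_real using C(1) by (simp add: C'_def abs_mult)
    finally show ?thesis .
  qed
  then show thesis using that[OF mL] by blast
qed

lemma mode_L2: "(mode n t :: 'a::euclidean_space \<Rightarrow> complex) \<in> L2 lborel"
proof -
  obtain m where m: "m \<in> L2 lborel" "\<And>s x. \<bar>s\<bar> \<le> \<bar>t\<bar> \<Longrightarrow> cmod (mode n s (x::'a)) \<le> cmod (m x)"
    using mode_dominated[of "\<bar>t\<bar>"] by auto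
  have "continuous_on UNIV (\<lambda>x::'a. mode n t x)"
    unfolding mode_eq by (intro continuous_intros continuous_mode_r)
  then have "(mode n t :: 'a \<Rightarrow> complex) \<in> borel_measurable lborel" by (simp add: borel_measurable_continuous_onI)
  moreover have "sqint lborel (mode n t :: 'a \<Rightarrow> complex) \<le> sqint lborel m"
    by (intro sqint_mono_AE AE_I2 m(2)) simp
  ultimately show ?thesis using m(1) by (auto simp: L2_iff intro: le_less_trans)
qed

lemma mode_L2_continuous:
  "((\<lambda>s. sqint lborel (\<lambda>x::'a::euclidean_space. mode n s x - mode n t x)) \<longlongrightarrow> 0) (at t)"
  unfolding tendsto_at_iff_sequentially o_def
proof (intro allI impI)
  fix X assume lim: "X \<longlonglongrightarrow> t"
  obtain S where S: "0 \<le> S" "\<And>i. \<bar>X i\<bar> \<le> S" "\<bar>t\<bar> \<le> S"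
  proof -
    have "Bseq X" using lim by (simp add: convergent_imp_Bseq convergentI)
    then obtain K where "\<And>i. \<bar>X i\<bar> \<le> K" "0 < K" by (auto simp: Bseq_def)
    then show thesis by (intro that[of "max K \<bar>t\<bar>"]) (auto intro: order_trans max.coboundedI1)
  qed
  obtain m where m: "m \<in> L2 lborel" "\<And>s x. \<bar>s\<bar> \<le> S \<Longrightarrow> cmod (mode n s (x::'a)) \<le> cmod (m x)"
    using mode_dominated[OF S(1)] by blast
  note [measurable] = L2_measurable[OF mode_L2] L2_measurable[OF m(1)]
  have "(\<lambda>i. \<integral>\<^sup>+x. ennreal ((cmod (mode n (X i) (x::'a) - mode n t x))\<^sup>2) \<partial>lborel) \<longlonglongrightarrow> (\<integral>\<^sup>+(x::'a). 0 \<partial>lborel)"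
  proof (rule nn_integral_dominated_convergence[where w = "\<lambda>x. ennreal 4 * ennreal ((cmod (m x))\<^sup>2)"])
    show "AE x in lborel. ennreal ((cmod (mode n (X i) (x::'a) - mode n t x))\<^sup>2) \<le> ennreal 4 * ennreal ((cmod (m x))\<^sup>2)" for i
    proof (rule AE_I2)
      fix x :: 'a
      have "cmod (mode n (X i) x - mode n t x) \<le> 2 * cmod (m x)"
        using norm_triangle_ineq4[of "mode n (X i) x" "mode n t x"] m(2)[OF S(2), of i x] m(2)[OF S(3), of x] by linarith
      then have "(cmod (mode n (X i) x - mode n t x))\<^sup>2 \<le> (2 * cmod (m x))\<^sup>2" by (intro power_mono) auto
      then show "ennreal ((cmod (mode n (X i) x - mode n t x))\<^sup>2) \<le> ennreal 4 * ennreal ((cmod (m x))\<^sup>2)"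
        by (subst ennreal_mult[symmetric]) (auto simp: power_mult_distrib intro!: ennreal_leI)
    qed
    have "(\<integral>\<^sup>+x. ennreal 4 * ennreal ((cmod (m x))\<^sup>2) \<partial>lborel) = ennreal 4 * sqint lborel m"
      unfolding sqint_def by (rule nn_integral_cmult) measurable
    also have "\<dots> < \<infinity>" using m(1) by (simp add: L2_iff ennreal_mult_less_top)
    finally show "(\<integral>\<^sup>+x. ennreal 4 * ennreal ((cmod (m x))\<^sup>2) \<partial>lborel) < \<infinity>" .
    show "AE x in lborel. (\<lambda>i. ennreal ((cmod (mode n (X i) (x::'a) - mode n t x))\<^sup>2)) \<longlonglongrightarrow> 0"
    proof (rule AE_I2)
      fix x :: 'a
      have "continuous_on UNIV (\<lambda>s. mode n s x)" unfolding mode_eq by (intro continuous_mode_r continuous_intros)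
      then have "(\<lambda>i. mode n (X i) x) \<longlonglongrightarrow> mode n t x"
        by (rule continuous_on_tendsto_compose[OF _ lim]) auto
      then have "(\<lambda>i. ennreal ((cmod (mode n (X i) x - mode n t x))\<^sup>2)) \<longlonglongrightarrow> ennreal ((cmod (mode n t x - mode n t x))\<^sup>2)"
        by (intro tendsto_intros)
      then show "(\<lambda>i. ennreal ((cmod (mode n (X i) x - mode n t x))\<^sup>2)) \<longlonglongrightarrow> 0" by simp
    qed
  qed measurable
  then show "(\<lambda>i. sqint lborel (\<lambda>x::'a. mode n (X i) x - mode n t x)) \<longlonglongrightarrow> 0"
    by (simp add: sqint_def)
qed

subsection \<open>The flow on Laguerre coefficients\<close>

abbreviation laguerre_norm :: "real \<Rightarrow> nat \<Rightarrow> real" where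
  "laguerre_norm \<nu> n \<equiv> Gamma (real n + \<nu> + 1) / (fact n * Gamma (\<nu> + 1))"

definition laguerre_mode :: "real \<Rightarrow> (nat \<Rightarrow> complex) \<Rightarrow> real \<Rightarrow> nat \<Rightarrow> real \<Rightarrow> complex" where
  "laguerre_mode \<nu> \<alpha> s n y = \<alpha> n * exp (\<i> * of_real (2 * pi * real n * s)) * of_real (poly (laguerre \<nu> n) y)"

lemma poly_borel_measurable [measurable]: "poly (q :: real poly) \<in> borel_measurable borel"
  by (intro borel_measurable_continuous_onI continuous_intros)

lemma laguerre_mode_measurable [measurable]: "laguerre_mode \<nu> \<alpha> s n \<in> borel_measurable borel"
  unfolding laguerre_mode_def[abs_def] by measurable

lemma cmod_phase [simp]: "cmod (exp (\<i> * of_real x)) = 1"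
  by simp

text \<open>
  All phases \<open>s\<close> are served by one subsequence of partial sums, which makes the limit jointly
  measurable in \<open>s\<close> and \<open>y\<close> and the approximation uniform in \<open>s\<close>.
\<close>

lemma laguerre_flow:
  assumes \<nu>: "\<nu> > -1" and sum: "summable (\<lambda>n. (cmod (\<alpha> n))\<^sup>2 * laguerre_norm \<nu> n)"
  obtains G :: "real \<Rightarrow> real \<Rightarrow> complex" and e :: "nat \<Rightarrow> real" where
    "(\<lambda>(s, y). G s y) \<in> borel_measurable (borel \<Otimes>\<^sub>M borel)"
    "\<And>s. has_L2_sum (laguerre_measure \<nu>) (laguerre_mode \<nu> \<alpha> s) (G s)"
    "\<And>s N. sqint (laguerre_measure \<nu>) (\<lambda>y. G s y - (\<Sum>n<N. laguerre_mode \<nu> \<alpha> s n y)) \<le> ennreal (e N)"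
    "e \<longlonglongrightarrow> 0"
proof -
  let ?L = "\<lambda>n. poly (laguerre \<nu> n)"
  obtain r :: "nat \<Rightarrow> nat" where r:
    "\<And>b. (\<And>n. cmod (b n) \<le> cmod (\<alpha> n)) \<Longrightarrow>
        has_L2_sum (laguerre_measure \<nu>) (\<lambda>n x. b n * of_real (poly (laguerre \<nu> n) x)) (series_limit ?L r b)"
    "\<And>b N. (\<And>n. cmod (b n) \<le> cmod (\<alpha> n)) \<Longrightarrow>
        sqint (laguerre_measure \<nu>) (\<lambda>x. series_limit ?L r b x - partial_sum ?L b N x)
        \<le> ennreal (\<Sum>n. (cmod (\<alpha> (n + N)))\<^sup>2 * laguerre_norm \<nu> (n + N))"
    using riesz_fischer[OF orthogonal_laguerre[OF \<nu>] sum] by blast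
  define b where "b s n = \<alpha> n * exp (\<i> * of_real (2 * pi * real n * s))" for s n
  define G where "G s = series_limit ?L r (b s)" for s
  define e where "e N = (\<Sum>n. (cmod (\<alpha> (n + N)))\<^sup>2 * laguerre_norm \<nu> (n + N))" for N
  have le: "cmod (b s n) \<le> cmod (\<alpha> n)" for n s
    by (simp only: b_def norm_mult cmod_phase mult_1_right order_refl)
  show thesis
  proof
    show "(\<lambda>(s, y). G s y) \<in> borel_measurable (borel \<Otimes>\<^sub>M borel)"
      unfolding G_def series_limit_def partial_sum_def b_def by measurable
    show "has_L2_sum (laguerre_measure \<nu>) (laguerre_mode \<nu> \<alpha> s) (G s)" for s
      unfolding G_def laguerre_mode_def[abs_def] b_def[symmetric] by (rule r(1)[OF le])
    show "sqint (laguerre_measure \<nu>) (\<lambda>y. G s y - (\<Sum>n<N. laguerre_mode \<nu> \<alpha> s n y)) \<le> ennreal (e N)" for s N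
      using r(2)[OF le] unfolding G_def laguerre_mode_def e_def b_def[symmetric] partial_sum_def .
    have "(\<lambda>N. suminf (\<lambda>n. (cmod (\<alpha> n))\<^sup>2 * laguerre_norm \<nu> n) - (\<Sum>n<N. (cmod (\<alpha> n))\<^sup>2 * laguerre_norm \<nu> n)) \<longlonglongrightarrow>
        suminf (\<lambda>n. (cmod (\<alpha> n))\<^sup>2 * laguerre_norm \<nu> n) - suminf (\<lambda>n. (cmod (\<alpha> n))\<^sup>2 * laguerre_norm \<nu> n)"
      by (intro tendsto_intros summable_LIMSEQ sum)
    then show "e \<longlonglongrightarrow> 0"
      unfolding e_def[abs_def] suminf_minus_initial_segment[OF sum] by simp
  qed
qed

lemma lens_kernel_0: "lens_kernel D 0 r = of_real (exp (- pi * r))"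
proof -
  have z: "lens_time 0 = of_real (1 / (4 * pi))" by (simp add: lens_time_def complex_eq_iff)
  have "complex_of_real (1 / (4 * pi)) powr - complex_of_real (D / 2) = of_real ((1 / (4 * pi)) powr - (D / 2))"
    using powr_of_real[of "1 / (4 * pi)" "- (D / 2)"] by simp
  also have "(1 / (4 * pi)) powr - (D / 2) = (4 * pi) powr (D / 2)"
    by (simp add: powr_divide powr_minus inverse_eq_divide)
  finally have p: "complex_of_real (1 / (4 * pi)) powr - complex_of_real (D / 2) = of_real ((4 * pi) powr (D / 2))" .
  have x: "- complex_of_real r / (4 * of_real (1 / (4 * pi))) = of_real (- pi * r)" by simp
  have "(4 * pi) powr (- D / 2) * (4 * pi) powr (D / 2) = 1"
    by (simp add: powr_add[symmetric])
  then have c: "complex_of_real ((4 * pi) powr (- D / 2)) * of_real ((4 * pi) powr (D / 2)) = 1"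
    by (simp only: of_real_mult[symmetric] of_real_1)
  show ?thesis
    unfolding lens_kernel_def free_kernel_def z p x mult.assoc[symmetric] c exp_of_real by simp
qed

lemma lens_width_0: "lens_width 0 = 1" and lens_phase_0: "lens_phase 0 = 0"
  by (simp_all add: lens_width_def lens_phase_def)

lemma radial_basis_eq_lens:
  "radial_basis n (x :: 'a::euclidean_space) = lens 0 (\<lambda>y. of_real (poly (laguerre (real DIM('a) / 2 - 1) n) y)) x"
  unfolding radial_basis_def lens_def lens_kernel_0 lens_width_0 by simp

lemma sum_radial_basis_eq_lens:
  "(\<Sum>n<N. \<alpha> n * radial_basis n (x :: 'a::euclidean_space)) =
     lens 0 (\<lambda>y. \<Sum>n<N. laguerre_mode (real DIM('a) / 2 - 1) \<alpha> 0 n y) x"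
  unfolding lens_sum[symmetric] radial_basis_eq_lens by (simp add: laguerre_mode_def lens_def mult.assoc)

text \<open>
  The partial sums converge, so their norms are bounded, and Pythagoras expresses these norms by the coefficients.
\<close>

lemma radial_coefficients_summable:
  fixes f :: "'a::euclidean_space \<Rightarrow> complex"
  assumes f: "has_L2_sum lborel (\<lambda>n x. \<alpha> n * radial_basis n x) f"
  shows "summable (\<lambda>n. (cmod (\<alpha> n))\<^sup>2 * laguerre_norm (real DIM('a) / 2 - 1) n)"
proof -
  define D where "D = real DIM('a)"
  define \<nu> where "\<nu> = D / 2 - 1"
  have \<nu>: "\<nu> > -1" by (simp add: \<nu>_def D_def)
  note orth = orthogonal_laguerre[OF \<nu>]
  define S where "S N x = (\<Sum>n<N. \<alpha> n * radial_basis n (x::'a))" for N x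
  define W where "W N = (\<Sum>n<N. (cmod (\<alpha> n))\<^sup>2 * laguerre_norm \<nu> n)" for N
  have SW: "sqint lborel (S N) = ennreal (2 powr (- D / 2)) * ennreal (W N)" for N
  proof -
    have "sqint lborel (S N) = ennreal (2 powr (- D / 2)) * sqint (laguerre_measure \<nu>) (\<lambda>y. \<Sum>n<N. laguerre_mode \<nu> \<alpha> 0 n y)"
      unfolding S_def[abs_def] sum_radial_basis_eq_lens D_def \<nu>_def by (rule sqint_lens) measurable
    also have "sqint (laguerre_measure \<nu>) (\<lambda>y. \<Sum>n<N. laguerre_mode \<nu> \<alpha> 0 n y) = ennreal (W N)"
      using pythagoras[OF orth, of "{..<N}" \<alpha>] by (simp add: laguerre_mode_def W_def)
    finally show ?thesis .
  qed
  have [measurable]: "S N \<in> borel_measurable borel" for N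
  proof -
    have "lens 0 (\<lambda>y. \<Sum>n<N. laguerre_mode (real DIM('a) / 2 - 1) \<alpha> 0 n y) \<in> borel_measurable (borel :: 'a measure)"
      by measurable
    then show ?thesis unfolding S_def[abs_def] sum_radial_basis_eq_lens .
  qed
  have fL: "f \<in> L2 lborel" using f by (simp add: has_L2_sum_def)
  note [measurable] = L2_measurable[OF fL]
  have "((\<lambda>N. sqint lborel (\<lambda>x. S N x - f x)) \<longlongrightarrow> 0) sequentially"
    using f by (simp add: has_L2_sum_def tendsto_Lp_norm_2_iff S_def)
  then have "eventually (\<lambda>N. sqint lborel (\<lambda>x. S N x - f x) \<le> ennreal 1) sequentially"
    by (simp only: tendsto_ennreal_0_iff zero_less_one)
  then obtain N0 where N0: "\<And>N. N \<ge> N0 \<Longrightarrow> sqint lborel (\<lambda>x. S N x - f x) \<le> ennreal 1"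
    by (auto simp: eventually_sequentially)
  obtain F where F: "sqint lborel f = ennreal F" "0 \<le> F"
    using fL by (cases "sqint lborel f") (auto simp: L2_iff)
  have mono: "W N \<le> W N'" if "N \<le> N'" for N N'
    unfolding W_def using that by (intro sum_mono2) (auto intro!: mult_nonneg_nonneg norm_basis_nonneg[OF orth] simp del: times_divide_eq_right)
  have W0: "0 \<le> W N" for N
    unfolding W_def by (intro sum_nonneg mult_nonneg_nonneg norm_basis_nonneg[OF orth]) auto
  have "W N \<le> (2 + 2 * F) * 2 powr (D / 2)" for N
  proof -
    let ?N = "max N N0"
    have "ennreal (2 powr (- D / 2) * W ?N) = sqint lborel (S ?N)"
      unfolding SW by (rule ennreal_mult) (use W0 in auto)
    also have "\<dots> \<le> 2 * sqint lborel (\<lambda>x. S ?N x - f x) + 2 * sqint lborel f"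
      using sqint_add_le[of "\<lambda>x. S ?N x - f x" lborel f] by simp
    also have "\<dots> \<le> 2 * ennreal 1 + 2 * ennreal F"
      unfolding F(1) by (intro add_right_mono mult_left_mono N0) auto
    also have "\<dots> = ennreal (2 + 2 * F)"
      using F(2) by (simp add: ennreal_plus ennreal_mult)
    finally have "2 powr (- D / 2) * W ?N \<le> 2 + 2 * F" using F(2) by (subst (asm) ennreal_le_iff) auto
    moreover have "2 powr (- D / 2) * 2 powr (D / 2) = 1" by (simp add: powr_add[symmetric])
    ultimately have "W ?N \<le> (2 + 2 * F) * 2 powr (D / 2)"
      using mult_right_mono[of "2 powr (- D / 2) * W ?N" "2 + 2 * F" "2 powr (D / 2)"]
      by (simp add: mult.commute mult.left_commute)
    then show ?thesis using mono[of N ?N] by simp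
  qed
  moreover have "0 \<le> (cmod (\<alpha> n))\<^sup>2 * laguerre_norm \<nu> n" for n
    by (intro mult_nonneg_nonneg norm_basis_nonneg[OF orth]) auto
  ultimately show ?thesis
    unfolding W_def D_def[symmetric] \<nu>_def[symmetric] by (intro summableI_nonneg_bounded)
qed

text \<open>
  The lens transform of the flow is the solution: partial sums are finite combinations of modes, and
  they converge uniformly in time.
\<close>

lemma lens_flow_solution:
  fixes f :: "'a::euclidean_space \<Rightarrow> complex"
  defines "\<nu> \<equiv> real DIM('a) / 2 - 1"
  assumes f: "has_L2_sum lborel (\<lambda>n x. \<alpha> n * radial_basis n x) f"
    and Gm: "(\<lambda>(s, y). G s y) \<in> borel_measurable (borel \<Otimes>\<^sub>M borel)"
    and G: "\<And>s. has_L2_sum (laguerre_measure \<nu>) (laguerre_mode \<nu> \<alpha> s) (G s)"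
    and e: "\<And>s N. sqint (laguerre_measure \<nu>) (\<lambda>y. G s y - (\<Sum>n<N. laguerre_mode \<nu> \<alpha> s n y)) \<le> ennreal (e N)"
    and e0: "e \<longlonglongrightarrow> 0"
  shows "is_schroedinger_solution f (\<lambda>t. lens t (G (lens_phase t)))"
proof -
  define D where "D = real DIM('a)"
  have \<nu>: "\<nu> > -1" by (simp add: \<nu>_def)
  have \<nu>D: "\<nu> = D / 2 - 1" by (simp add: \<nu>_def D_def)
  have GL: "G s \<in> L2 (laguerre_measure \<nu>)" for s using G by (simp add: has_L2_sum_def)
  have [measurable]: "G s \<in> borel_measurable borel" for s
    using L2_measurable[OF GL[of s]] by (simp add: borel_measurable_laguerre_measure)
  define u where "u t = (lens t (G (lens_phase t)) :: 'a \<Rightarrow> complex)" for t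
  define v where "v N t x = (\<Sum>n<N. \<alpha> n * mode n t (x::'a))" for N t x
  have v_eq: "v N t = lens t (\<lambda>y. \<Sum>n<N. laguerre_mode \<nu> \<alpha> (lens_phase t) n y)" for N t
  proof
    fix x
    show "v N t x = lens t (\<lambda>y. \<Sum>n<N. laguerre_mode \<nu> \<alpha> (lens_phase t) n y) x"
      unfolding v_def lens_sum[symmetric] mode_def
      by (simp add: lens_def laguerre_mode_def mode_profile_def laguerre_eq[OF \<nu>] \<nu>_def[symmetric] mult.assoc)
  qed
  have uL: "u t \<in> L2 lborel" for t
    using GL[of "lens_phase t"] unfolding u_def L2_iff
    by (auto simp: sqint_lens \<nu>_def[symmetric] ennreal_mult_less_top)
  have vL: "v N t \<in> L2 lborel" for N t
    unfolding v_def by (intro L2_sum L2_cmult mode_L2)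
  note [measurable] = uL[THEN L2_measurable] vL[THEN L2_measurable]
  have approx: "sqint lborel (\<lambda>x. u t x - v N t x) \<le> ennreal (e N)" for t N
  proof -
    have "sqint lborel (\<lambda>x. u t x - v N t x) = ennreal (2 powr (- D / 2)) *
       sqint (laguerre_measure \<nu>) (\<lambda>y. G (lens_phase t) y - (\<Sum>n<N. laguerre_mode \<nu> \<alpha> (lens_phase t) n y))"
      unfolding u_def v_eq lens_diff \<nu>D D_def by (rule sqint_lens) measurable
    also have "\<dots> \<le> 1 * ennreal (e N)"
    proof (intro mult_mono e)
      have "2 powr (- D / 2) \<le> 2 powr 0" by (intro powr_mono) (auto simp: D_def)
      then show "ennreal (2 powr (- D / 2)) \<le> 1" using ennreal_leI by fastforce
    qed auto
    finally show ?thesis by simp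
  qed
  have small: "\<exists>N. \<forall>n\<ge>N. e n \<le> \<epsilon>" if "\<epsilon> > 0" for \<epsilon>
    using order_tendstoD(2)[OF e0 that] by (auto simp: eventually_sequentially intro: less_imp_le)
  show ?thesis
    unfolding is_schroedinger_solution_def u_def[symmetric]
  proof (intro conjI allI impI)
    show "u t \<in> L2 lborel" for t by (rule uL)
    have rm: "(\<lambda>x::'a. \<alpha> n * radial_basis n x) \<in> borel_measurable lborel" for n
      unfolding radial_basis_def by measurable
    have "has_L2_sum lborel (\<lambda>n x. \<alpha> n * radial_basis n x) (u 0)"
      unfolding has_L2_sum_def tendsto_Lp_norm_2_iff
    proof
      have "(\<Sum>n<N. \<alpha> n * radial_basis n x) = v N 0 x" for N and x :: 'a
        unfolding v_eq lens_phase_0 sum_radial_basis_eq_lens \<nu>_def ..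
      moreover have "(\<lambda>N. sqint lborel (\<lambda>x. v N 0 x - u 0 x)) \<longlonglongrightarrow> 0"
        unfolding sqint_minus_commute[of lborel "v _ 0"]
      proof (rule tendsto_ennreal_0_le)
        show "(\<lambda>N. ennreal (e N)) \<longlonglongrightarrow> 0" using tendsto_ennrealI[OF e0] by simp
      qed (simp_all add: approx)
      ultimately show "(\<lambda>N. sqint lborel (\<lambda>x::'a. (\<Sum>n<N. \<alpha> n * radial_basis n x) - u 0 x)) \<longlonglongrightarrow> 0" by simp
    qed (rule uL)
    then show "AE x in lborel. u 0 x = f x"
      by (rule has_L2_sum_unique[OF _ f rm])
  next
    fix t
    show "((\<lambda>s. Lp_norm lborel 2 (\<lambda>x. u s x - u t x)) \<longlongrightarrow> 0) (at t)"
      unfolding tendsto_Lp_norm_2_iff tendsto_ennreal_0_iff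
    proof (intro allI impI)
      fix \<epsilon> :: real assume \<epsilon>: "\<epsilon> > 0"
      obtain N where N: "e N \<le> \<epsilon> / 16" using small[of "\<epsilon> / 16"] \<epsilon> by auto
      have "((\<lambda>s. sqint lborel (\<lambda>x. v M s x - v M t x)) \<longlongrightarrow> 0) (at t)" for M
      proof (induction M)
        case 0
        then show ?case by (simp add: v_def sqint_def)
      next
        case (Suc M)
        have mm: "(\<lambda>x::'a. mode M s x - mode M t x) \<in> borel_measurable lborel" for s
          using mode_L2[of M] by (intro borel_measurable_diff L2_measurable)
        have "((\<lambda>s. 2 * sqint lborel (\<lambda>x. v M s x - v M t x) + 2 * (ennreal ((cmod (\<alpha> M))\<^sup>2) * sqint lborel (\<lambda>x::'a. mode M s x - mode M t x))) \<longlongrightarrow> 2 * 0 + 2 * (ennreal ((cmod (\<alpha> M))\<^sup>2) * 0)) (at t)"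
          by (intro tendsto_add tendsto_mult_ennreal Suc.IH mode_L2_continuous tendsto_const) auto
        moreover have "sqint lborel (\<lambda>x. v (Suc M) s x - v (Suc M) t x) \<le>
           2 * sqint lborel (\<lambda>x. v M s x - v M t x) + 2 * (ennreal ((cmod (\<alpha> M))\<^sup>2) * sqint lborel (\<lambda>x::'a. mode M s x - mode M t x))" for s
        proof -
          have eq: "v (Suc M) s x - v (Suc M) t x = (v M s x - v M t x) + \<alpha> M * (mode M s x - mode M t x)" for x
            by (simp add: v_def algebra_simps)
          show ?thesis
            unfolding eq sqint_cmult[OF mm, symmetric] by (rule sqint_add_le) (use mm in measurable)
        qed
        ultimately show ?case
          by - (rule tendsto_ennreal_0_le, assumption, assumption, simp)
      qed
      then have "eventually (\<lambda>s. sqint lborel (\<lambda>x. v N s x - v N t x) \<le> ennreal (\<epsilon> / 16)) (at t)"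
        using \<epsilon> unfolding tendsto_ennreal_0_iff by auto
      then show "eventually (\<lambda>s. sqint lborel (\<lambda>x. u s x - u t x) \<le> ennreal \<epsilon>) (at t)"
      proof eventually_elim
        case (elim s)
        have a: "sqint lborel (\<lambda>x. u s x - v N s x) \<le> ennreal (\<epsilon> / 16)" "sqint lborel (\<lambda>x. v N t x - u t x) \<le> ennreal (\<epsilon> / 16)"
          using order_trans[OF approx ennreal_leI[OF N]] sqint_minus_commute[of lborel "v N t" "u t"] by auto
        have "sqint lborel (\<lambda>x. u s x - u t x) \<le> 2 * sqint lborel (\<lambda>x. u s x - v N s x) + 2 * sqint lborel (\<lambda>x. v N s x - u t x)"
          by (rule sqint_triangle_le) measurable
        also have "\<dots> \<le> 2 * sqint lborel (\<lambda>x. u s x - v N s x) + 2 * (2 * sqint lborel (\<lambda>x. v N s x - v N t x) + 2 * sqint lborel (\<lambda>x. v N t x - u t x))"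
          by (intro add_left_mono mult_left_mono sqint_triangle_le) measurable
        also have "\<dots> \<le> 2 * ennreal (\<epsilon> / 16) + 2 * (2 * ennreal (\<epsilon> / 16) + 2 * ennreal (\<epsilon> / 16))"
          by (intro add_mono mult_left_mono a elim) auto
        also have "\<dots> = ennreal (2 * (\<epsilon> / 16) + 2 * (2 * (\<epsilon> / 16) + 2 * (\<epsilon> / 16)))"
        proof -
          have tw: "2 * ennreal x + 2 * ennreal y = ennreal (2 * x + 2 * y)" if "0 \<le> x" "0 \<le> y" for x y
            using that by (simp add: ennreal_plus ennreal_mult)
          have h: "0 \<le> \<epsilon> / 16" "0 \<le> 2 * (\<epsilon> / 16) + 2 * (\<epsilon> / 16)" using \<epsilon> by auto
          show ?thesis unfolding tw[OF h(1) h(1)] tw[OF h] ..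
        qed
        also have "\<dots> \<le> ennreal \<epsilon>" using \<epsilon> by (intro ennreal_leI) simp
        finally show ?case .
      qed
    qed
  next
    fix \<phi> :: "'a \<Rightarrow> complex" and t assume \<phi>: "test_function \<phi>"
    note L = test_function_L2[OF \<phi>] laplacian_test_function_L2[OF \<phi>]
    obtain A where A: "A > 0" "sqint lborel (laplacian \<phi>) \<le> ennreal (A\<^sup>2)" "sqint lborel \<phi> \<le> ennreal (A\<^sup>2)"
    proof -
      obtain a b where ab: "sqint lborel (laplacian \<phi>) = ennreal a" "sqint lborel \<phi> = ennreal b" "0 \<le> a" "0 \<le> b"
        using L by (cases "sqint lborel (laplacian \<phi>)"; cases "sqint lborel \<phi>") (auto simp: L2_iff)
      show thesis
        by (rule that[of "sqrt (a + b + 1)"]) (use ab in \<open>auto intro!: ennreal_leI\<close>)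
    qed
    have close: "cmod ((LINT x|lborel. v N s x * \<psi> x) - (LINT x|lborel. u s x * \<psi> x)) \<le> \<epsilon>"
      if \<psi>: "\<psi> \<in> L2 lborel" "sqint lborel \<psi> \<le> ennreal (A\<^sup>2)" and \<epsilon>: "\<epsilon> > 0" and N: "e N \<le> (\<epsilon> / A)\<^sup>2" for \<psi> N s \<epsilon>
    proof -
      have "cmod (LINT x|lborel. (u s x - v N s x) * \<psi> x) \<le> \<epsilon> / A * A"
        using A(1) \<epsilon> order_trans[OF approx ennreal_leI[OF N]]
        by (intro cmod_integral_mult_le[OF _ L2_measurable[OF \<psi>(1)] _ \<psi>(2)]) auto
      moreover have "(LINT x|lborel. (u s x - v N s x) * \<psi> x) = (LINT x|lborel. u s x * \<psi> x) - (LINT x|lborel. v N s x * \<psi> x)"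
        using integrable_L2_mult[OF uL \<psi>(1)] integrable_L2_mult[OF vL \<psi>(1)] by (simp add: left_diff_distrib)
      ultimately show ?thesis using A(1) by (simp add: norm_minus_commute)
    qed
    have vd: "((\<lambda>s. LINT x|lborel. v N s x * \<phi> x) has_vector_derivative \<i> * (LINT x|lborel. v N s x * laplacian \<phi> x)) (at s)" for N s
    proof -
      have pair: "(LINT x|lborel. v N s x * \<psi> x) = (\<Sum>n<N. \<alpha> n * (LINT x|lborel. mode n s x * \<psi> x))" if "\<psi> \<in> L2 lborel" for s \<psi>
      proof -
        have "(LINT x|lborel. v N s x * \<psi> x) = (LINT x|lborel. (\<Sum>n<N. \<alpha> n * (mode n s x * \<psi> x)))"
          by (simp add: v_def sum_distrib_right mult.assoc)
        also have "\<dots> = (\<Sum>n<N. LINT x|lborel. \<alpha> n * (mode n s x * \<psi> x))"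
          by (intro Bochner_Integration.integral_sum integrable_mult_right integrable_L2_mult mode_L2 that)
        finally show ?thesis by simp
      qed
      have "((\<lambda>s. \<Sum>n<N. \<alpha> n * (LINT x|lborel. mode n s x * \<phi> x)) has_vector_derivative
             (\<Sum>n<N. \<alpha> n * (\<i> * (LINT x|lborel. mode n s x * laplacian \<phi> x)))) (at s)"
        by (intro has_vector_derivative_sum has_vector_derivative_mult_right mode_weak_derivative \<phi>)
      then show ?thesis
        by (simp add: pair L sum_distrib_left mult.left_commute)
    qed
    have lim: "(\<lambda>N. LINT x|lborel. v N s x * \<phi> x) \<longlonglongrightarrow> (LINT x|lborel. u s x * \<phi> x)" for s
    proof (rule LIMSEQ_I)
      fix \<epsilon> :: real assume \<epsilon>: "0 < \<epsilon>"
      obtain N where N: "\<forall>n\<ge>N. e n \<le> (\<epsilon> / 2 / A)\<^sup>2" using small[of "(\<epsilon> / 2 / A)\<^sup>2"] \<epsilon> A(1) by auto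
      have "norm ((LINT x|lborel. v n s x * \<phi> x) - (LINT x|lborel. u s x * \<phi> x)) < \<epsilon>" if "n \<ge> N" for n
        using close[OF L(1) A(3), of "\<epsilon> / 2" n s] N that \<epsilon> by fastforce
      then show "\<exists>N. \<forall>n\<ge>N. norm ((LINT x|lborel. v n s x * \<phi> x) - (LINT x|lborel. u s x * \<phi> x)) < \<epsilon>" by blast
    qed
    have "\<exists>g. \<forall>s\<in>UNIV. (\<lambda>N. LINT x|lborel. v N s x * \<phi> x) \<longlonglongrightarrow> g s \<and>
        (g has_derivative (\<lambda>h. h *\<^sub>R (\<i> * (LINT x|lborel. u s x * laplacian \<phi> x)))) (at s within UNIV)"
    proof (rule has_derivative_sequence[where f' = "\<lambda>N s h. h *\<^sub>R (\<i> * (LINT x|lborel. v N s x * laplacian \<phi> x))"])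
      show "((\<lambda>s. LINT x|lborel. v N s x * \<phi> x) has_derivative (\<lambda>h. h *\<^sub>R (\<i> * (LINT x|lborel. v N s x * laplacian \<phi> x)))) (at s within UNIV)" for N s
        using vd by (simp add: has_vector_derivative_def)
      show "(\<lambda>N. LINT x|lborel. v N 0 x * \<phi> x) \<longlonglongrightarrow> (LINT x|lborel. u 0 x * \<phi> x)" by (rule lim)
      fix \<epsilon> :: real assume \<epsilon>: "0 < \<epsilon>"
      obtain N where N: "\<forall>n\<ge>N. e n \<le> (\<epsilon> / A)\<^sup>2" using small[of "(\<epsilon> / A)\<^sup>2"] \<epsilon> A(1) by auto
      have "norm (h *\<^sub>R (\<i> * (LINT x|lborel. v n s x * laplacian \<phi> x)) - h *\<^sub>R (\<i> * (LINT x|lborel. u s x * laplacian \<phi> x))) \<le> \<epsilon> * norm h"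
        if "n \<ge> N" for n s h
      proof -
        have "cmod ((LINT x|lborel. v n s x * laplacian \<phi> x) - (LINT x|lborel. u s x * laplacian \<phi> x)) \<le> \<epsilon>"
          using N that by (intro close[OF L(2) A(2) \<epsilon>]) auto
        then have "\<bar>h\<bar> * cmod ((LINT x|lborel. v n s x * laplacian \<phi> x) - (LINT x|lborel. u s x * laplacian \<phi> x)) \<le> \<bar>h\<bar> * \<epsilon>"
          by (intro mult_left_mono) auto
        then show ?thesis
          by (simp only: scaleR_diff_right[symmetric] right_diff_distrib[symmetric] norm_scaleR norm_mult norm_ii mult_1 real_norm_def mult.commute)
      qed
      then show "\<forall>\<^sub>F n in sequentially. \<forall>s\<in>UNIV. \<forall>h. norm (h *\<^sub>R (\<i> * (LINT x|lborel. v n s x * laplacian \<phi> x)) -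
          h *\<^sub>R (\<i> * (LINT x|lborel. u s x * laplacian \<phi> x))) \<le> \<epsilon> * norm h"
        unfolding eventually_sequentially by blast
    qed auto
    then obtain g where g: "\<And>s. (\<lambda>N. LINT x|lborel. v N s x * \<phi> x) \<longlonglongrightarrow> g s"
      "\<And>s. (g has_derivative (\<lambda>h. h *\<^sub>R (\<i> * (LINT x|lborel. u s x * laplacian \<phi> x)))) (at s)" by auto
    have "g = (\<lambda>s. LINT x|lborel. u s x * \<phi> x)"
      using LIMSEQ_unique[OF g(1) lim] by auto
    then show "((\<lambda>s. LINT x|lborel. u s x * \<phi> x) has_vector_derivative \<i> * (LINT x|lborel. u t x * laplacian \<phi> x)) (at t)"
      using g(2)[of t] by (simp add: has_vector_derivative_def)
  qed
qed

section \<open>The Laguerre operator\<close>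

text \<open>
  The dilated weight contains \<open>exp (- p y / 2)\<close>, which is at most \<open>exp (- y)\<close> because \<open>p \<ge> 2\<close>.
\<close>

lemma nn_integral_laguerre_dilation:
  fixes H :: "real \<Rightarrow> ennreal"
  assumes \<nu>: "\<nu> > -1" and p: "p \<ge> 2" and [measurable]: "H \<in> borel_measurable borel"
  shows "(\<integral>\<^sup>+x. H (2 / p * x) \<partial>laguerre_measure \<nu>) \<le> ennreal ((p / 2) powr (\<nu> + 1)) * (\<integral>\<^sup>+y. H y \<partial>laguerre_measure \<nu>)"
proof -
  have G: "Gamma (\<nu> + 1) > 0" using \<nu> by (intro Gamma_real_pos) auto
  have w: "gamma_weight \<nu> (p / 2 * y) \<le> (p / 2) powr \<nu> * gamma_weight \<nu> y" for y
  proof (cases "y > 0")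
    case True
    then have py: "p / 2 * y > 0" using p by simp
    have "y \<le> p / 2 * y" using p True by simp
    then have "exp (- (p / 2 * y)) \<le> exp (- y)" by simp
    then have "exp (- (p / 2 * y)) * ((p / 2) powr \<nu> * y powr \<nu>) \<le> exp (- y) * ((p / 2) powr \<nu> * y powr \<nu>)"
      by (intro mult_right_mono) auto
    moreover have "(p / 2 * y) powr \<nu> = (p / 2) powr \<nu> * y powr \<nu>" by (rule powr_mult)
    ultimately show ?thesis using True py by (simp only: gamma_weight_def) (simp add: mult_ac)
  next
    case False
    then have "\<not> p / 2 * y > 0" using p by (simp add: zero_less_mult_iff)
    then show ?thesis using False by (simp add: gamma_weight_def)
  qed
  have "(\<integral>\<^sup>+x. H (2 / p * x) \<partial>laguerre_measure \<nu>) = (\<integral>\<^sup>+x. ennreal (gamma_weight \<nu> x / Gamma (\<nu> + 1)) * H (2 / p * x) \<partial>lborel)"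
    by (rule nn_integral_laguerre_measure) measurable
  also have "\<dots> = ennreal \<bar>p / 2\<bar> * (\<integral>\<^sup>+y. ennreal (gamma_weight \<nu> (0 + p / 2 * y) / Gamma (\<nu> + 1)) * H (2 / p * (0 + p / 2 * y)) \<partial>lborel)"
    using p by (intro nn_integral_real_affine) auto
  also have "\<dots> \<le> ennreal (p / 2) * (\<integral>\<^sup>+y. ennreal ((p / 2) powr \<nu>) * (ennreal (gamma_weight \<nu> y / Gamma (\<nu> + 1)) * H y) \<partial>lborel)"
  proof -
    have "ennreal (gamma_weight \<nu> (0 + p / 2 * y) / Gamma (\<nu> + 1)) * H (2 / p * (0 + p / 2 * y)) \<le>
          ennreal ((p / 2) powr \<nu>) * (ennreal (gamma_weight \<nu> y / Gamma (\<nu> + 1)) * H y)" for y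
    proof -
      have "gamma_weight \<nu> (p / 2 * y) / Gamma (\<nu> + 1) \<le> (p / 2) powr \<nu> * (gamma_weight \<nu> y / Gamma (\<nu> + 1))"
        using divide_right_mono[OF w[of y], of "Gamma (\<nu> + 1)"] G by simp
      then have "ennreal (gamma_weight \<nu> (p / 2 * y) / Gamma (\<nu> + 1)) \<le> ennreal ((p / 2) powr \<nu>) * ennreal (gamma_weight \<nu> y / Gamma (\<nu> + 1))"
        using G by (subst ennreal_mult[symmetric]) (auto simp: gamma_weight_nonneg intro!: ennreal_leI)
      then have "ennreal (gamma_weight \<nu> (p / 2 * y) / Gamma (\<nu> + 1)) * H y \<le> ennreal ((p / 2) powr \<nu>) * ennreal (gamma_weight \<nu> y / Gamma (\<nu> + 1)) * H y"
        by (intro mult_right_mono) auto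
      moreover have "2 / p * (0 + p / 2 * y) = y" "0 + p / 2 * y = p / 2 * y" using p by auto
      ultimately show ?thesis by (simp only: mult.assoc)
    qed
    moreover have "\<bar>p / 2\<bar> = p / 2" using p by simp
    ultimately show ?thesis by (simp only:) (intro mult_left_mono nn_integral_mono; simp)
  qed
  also have "\<dots> = ennreal (p / 2) * (ennreal ((p / 2) powr \<nu>) * (\<integral>\<^sup>+y. H y \<partial>laguerre_measure \<nu>))"
    by (subst nn_integral_cmult) (auto simp: nn_integral_laguerre_measure)
  also have "\<dots> = ennreal ((p / 2) powr (\<nu> + 1)) * (\<integral>\<^sup>+y. H y \<partial>laguerre_measure \<nu>)"
  proof -
    have "(p / 2) powr (\<nu> + 1) = p / 2 * (p / 2) powr \<nu>" using p by (simp add: powr_add)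
    then have "ennreal ((p / 2) powr (\<nu> + 1)) = ennreal (p / 2) * ennreal ((p / 2) powr \<nu>)"
      using p by (simp only:) (rule ennreal_mult; simp)
    then show ?thesis by (simp only: mult.assoc)
  qed
  finally show ?thesis .
qed

lemma sqint_laguerre_dilation:
  assumes "\<nu> > -1" "p \<ge> 2" and [measurable]: "h \<in> borel_measurable borel"
  shows "sqint (laguerre_measure \<nu>) (\<lambda>x. h (2 / p * x)) \<le> ennreal ((p / 2) powr (\<nu> + 1)) * sqint (laguerre_measure \<nu>) h"
  unfolding sqint_def by (rule nn_integral_laguerre_dilation[OF assms(1,2)]) measurable

lemma L2_laguerre_dilation:
  assumes "\<nu> > -1" "p \<ge> 2" "h \<in> L2 (laguerre_measure \<nu>)"
  shows "(\<lambda>x. h (2 / p * x)) \<in> L2 (laguerre_measure \<nu>)"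
proof -
  have [measurable]: "h \<in> borel_measurable borel"
    using L2_measurable[OF assms(3)] by (simp add: borel_measurable_laguerre_measure)
  have "sqint (laguerre_measure \<nu>) (\<lambda>x. h (2 / p * x)) \<le> ennreal ((p / 2) powr (\<nu> + 1)) * sqint (laguerre_measure \<nu>) h"
    by (rule sqint_laguerre_dilation) (use assms in auto)
  also have "\<dots> < top" using assms(3) by (simp add: L2_iff ennreal_mult_less_top)
  finally show ?thesis
    unfolding L2_iff by (intro conjI) (simp_all add: borel_measurable_laguerre_measure)
qed

lemma AE_laguerre_dilation:
  assumes "\<nu> > -1" "p \<ge> 2" and [measurable]: "h \<in> borel_measurable borel" "k \<in> borel_measurable borel"
    and "AE x in laguerre_measure \<nu>. h x = (k x :: complex)"
  shows "AE x in laguerre_measure \<nu>. h (2 / p * x) = k (2 / p * x)"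
proof -
  have "sqint (laguerre_measure \<nu>) (\<lambda>x. h x - k x) = sqint (laguerre_measure \<nu>) (\<lambda>x. 0)"
    by (rule sqint_cong_AE) (use assms(5) in auto)
  moreover have "sqint (laguerre_measure \<nu>) (\<lambda>x. h (2 / p * x) - k (2 / p * x)) \<le>
     ennreal ((p / 2) powr (\<nu> + 1)) * sqint (laguerre_measure \<nu>) (\<lambda>x. h x - k x)"
    using sqint_laguerre_dilation[OF assms(1,2), of "\<lambda>x. h x - k x"] by simp
  ultimately have "sqint (laguerre_measure \<nu>) (\<lambda>x. h (2 / p * x) - k (2 / p * x)) = 0"
    by (simp add: sqint_def)
  then have "AE x in laguerre_measure \<nu>. h (2 / p * x) - k (2 / p * x) = 0"
    by (rule sqint_eq_0_imp_AE[rotated]) (simp add: borel_measurable_laguerre_measure)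
  then show ?thesis by simp
qed

lemma has_L2_sum_linear:
  assumes h: "has_L2_sum M \<phi> h" and k: "has_L2_sum M \<psi> k"
    and [measurable]: "\<And>n. \<phi> n \<in> borel_measurable M" "\<And>n. \<psi> n \<in> borel_measurable M"
  shows "has_L2_sum M (\<lambda>n x. a * \<phi> n x + b * \<psi> n x) (\<lambda>x. a * h x + b * k x)"
  unfolding has_L2_sum_def tendsto_Lp_norm_2_iff
proof
  have L: "h \<in> L2 M" "k \<in> L2 M" using h k by (auto simp: has_L2_sum_def)
  note [measurable] = L[THEN L2_measurable]
  show "(\<lambda>x. a * h x + b * k x) \<in> L2 M" by (intro L2_add L2_cmult L)
  have "sqint M (\<lambda>x. (\<Sum>n<N. a * \<phi> n x + b * \<psi> n x) - (a * h x + b * k x)) \<le>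
     2 * (ennreal ((cmod a)\<^sup>2) * sqint M (\<lambda>x. (\<Sum>n<N. \<phi> n x) - h x)) + 2 * (ennreal ((cmod b)\<^sup>2) * sqint M (\<lambda>x. (\<Sum>n<N. \<psi> n x) - k x))" for N
  proof -
    have eq: "(\<Sum>n<N. a * \<phi> n x + b * \<psi> n x) - (a * h x + b * k x) = a * ((\<Sum>n<N. \<phi> n x) - h x) + b * ((\<Sum>n<N. \<psi> n x) - k x)" for x
      by (simp add: sum.distrib sum_distrib_left algebra_simps)
    have "sqint M (\<lambda>x. a * ((\<Sum>n<N. \<phi> n x) - h x) + b * ((\<Sum>n<N. \<psi> n x) - k x)) \<le>
      2 * sqint M (\<lambda>x. a * ((\<Sum>n<N. \<phi> n x) - h x)) + 2 * sqint M (\<lambda>x. b * ((\<Sum>n<N. \<psi> n x) - k x))"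
      by (rule sqint_add_le) measurable
    then show ?thesis unfolding eq by (simp add: sqint_cmult)
  qed
  moreover have "((\<lambda>N. 2 * (ennreal ((cmod a)\<^sup>2) * sqint M (\<lambda>x. (\<Sum>n<N. \<phi> n x) - h x)) + 2 * (ennreal ((cmod b)\<^sup>2) * sqint M (\<lambda>x. (\<Sum>n<N. \<psi> n x) - k x)))
      \<longlongrightarrow> 2 * (ennreal ((cmod a)\<^sup>2) * 0) + 2 * (ennreal ((cmod b)\<^sup>2) * 0)) sequentially"
    using h k unfolding has_L2_sum_def tendsto_Lp_norm_2_iff
    by (intro tendsto_add tendsto_mult_ennreal tendsto_const) auto
  ultimately show "(\<lambda>N. sqint M (\<lambda>x. (\<Sum>n<N. a * \<phi> n x + b * \<psi> n x) - (a * h x + b * k x))) \<longlonglongrightarrow> 0"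
    by - (rule tendsto_ennreal_0_le, assumption, assumption, simp)
qed

lemma phase_exponent:
  "exp (2 * of_real pi * of_nat n * \<i> * of_real t) = exp (\<i> * of_real (2 * pi * real n * t))"
  by (rule arg_cong[where f = exp]) simp

text \<open>
  The operator is a unimodular coefficient multiplier, which does not increase the norm, followed by
  the dilation, which is bounded because \<open>2 / p \<le> 1\<close>.
\<close>

lemma is_laguerre_operator_exists:
  assumes \<nu>: "\<nu> > -1" and p: "p \<ge> 2"
  shows "\<exists>T. is_laguerre_operator p \<nu> t T"
proof -
  define \<mu> where "\<mu> = laguerre_measure \<nu>"
  let ?L = "\<lambda>n. poly (laguerre \<nu> n)"
  note orth = orthogonal_laguerre[OF \<nu>, folded \<mu>_def]
  define coeff where "coeff = coefficient \<mu> ?L (laguerre_norm \<nu>)"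
  have cpos: "laguerre_norm \<nu> n > 0" for n
    using \<nu> by (intro divide_pos_pos mult_pos_pos Gamma_real_pos) auto
  have borel: "h \<in> borel_measurable borel" if "h \<in> L2 \<mu>" for h :: "real \<Rightarrow> complex"
    using L2_measurable[OF that] by (simp add: \<mu>_def borel_measurable_laguerre_measure)
  define tm where "tm h n y = laguerre_mode \<nu> (coeff h) t n y" for h n y
  have tm_meas: "tm h n \<in> borel_measurable \<mu>" for h n
    unfolding tm_def[abs_def] \<mu>_def by (simp add: borel_measurable_laguerre_measure)
  define R where "R h = (SOME k. has_L2_sum \<mu> (tm h) k)" for h
  have R: "has_L2_sum \<mu> (tm h) (R h)" and R_le: "sqint \<mu> (R h) \<le> sqint \<mu> h" if h: "h \<in> L2 \<mu>" for h
  proof -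
    have b: "(\<Sum>n<N. (cmod (coeff h n))\<^sup>2 * laguerre_norm \<nu> n) \<le> (LINT x|\<mu>. (cmod (h x))\<^sup>2)" for N
      by (rule bessel[OF orth h cpos, folded coeff_def])
    have nn: "0 \<le> (cmod (coeff h n))\<^sup>2 * laguerre_norm \<nu> n" for n
      by (intro mult_nonneg_nonneg norm_basis_nonneg[OF orth]) auto
    have s: "summable (\<lambda>n. (cmod (coeff h n))\<^sup>2 * laguerre_norm \<nu> n)"
      by (rule summableI_nonneg_bounded[OF nn b])
    obtain r :: "nat \<Rightarrow> nat" where r:
      "\<And>b. (\<And>n. cmod (b n) \<le> cmod (coeff h n)) \<Longrightarrow>
        has_L2_sum \<mu> (\<lambda>n x. b n * of_real (poly (laguerre \<nu> n) x)) (series_limit ?L r b)"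
      "\<And>b N. (\<And>n. cmod (b n) \<le> cmod (coeff h n)) \<Longrightarrow>
        sqint \<mu> (\<lambda>x. series_limit ?L r b x - partial_sum ?L b N x)
        \<le> ennreal (\<Sum>n. (cmod (coeff h (n + N)))\<^sup>2 * laguerre_norm \<nu> (n + N))"
      using riesz_fischer[OF orth s] by blast
    let ?b = "\<lambda>n. coeff h n * exp (\<i> * of_real (2 * pi * real n * t))"
    let ?k = "series_limit ?L r ?b"
    have le: "cmod (?b n) \<le> cmod (coeff h n)" for n
      by (simp only: norm_mult cmod_phase mult_1_right order_refl)
    have k: "has_L2_sum \<mu> (tm h) ?k"
      unfolding tm_def[abs_def] laguerre_mode_def by (rule r(1)[OF le])
    then show Rh: "has_L2_sum \<mu> (tm h) (R h)" unfolding R_def by (rule someI[where P = "has_L2_sum \<mu> (tm h)"])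
    have "sqint \<mu> (R h) = sqint \<mu> ?k"
      by (intro sqint_cong_AE has_L2_sum_unique[OF Rh k tm_meas])
    also have "\<dots> \<le> ennreal (\<Sum>n. (cmod (coeff h n))\<^sup>2 * laguerre_norm \<nu> n)"
      using r(2)[of ?b 0, OF le] by (simp add: partial_sum_def)
    also have "\<dots> \<le> ennreal (LINT x|\<mu>. (cmod (h x))\<^sup>2)"
      by (intro ennreal_leI suminf_le_const[OF s]) (rule b)
    also have "\<dots> = sqint \<mu> h" by (rule sqint_eq_integral[OF h, symmetric])
    finally show "sqint \<mu> (R h) \<le> sqint \<mu> h" .
  qed
  have RL: "R h \<in> L2 \<mu>" if "h \<in> L2 \<mu>" for h using R[OF that] by (simp add: has_L2_sum_def)
  define T where "T h x = R h (2 / p * x)" for h x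
  define C where "C = sqrt ((p / 2) powr (\<nu> + 1))"
  have C: "C \<ge> 0" "C\<^sup>2 = (p / 2) powr (\<nu> + 1)" by (simp_all add: C_def)
  have "bounded_L2_operator \<mu> T"
    unfolding bounded_L2_operator_def
  proof (intro conjI ballI allI exI[of _ C])
    fix h assume h: "h \<in> L2 \<mu>"
    show "T h \<in> L2 \<mu>" unfolding T_def[abs_def] \<mu>_def
      by (rule L2_laguerre_dilation[OF \<nu> p RL[OF h, unfolded \<mu>_def]])
    have "sqint \<mu> (T h) \<le> ennreal ((p / 2) powr (\<nu> + 1)) * sqint \<mu> (R h)"
      unfolding T_def[abs_def] \<mu>_def by (rule sqint_laguerre_dilation[OF \<nu> p borel[OF RL[OF h]]])
    also have "\<dots> \<le> ennreal (C\<^sup>2) * sqint \<mu> h"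
      unfolding C by (intro mult_left_mono R_le h) auto
    finally have le: "sqint \<mu> (T h) \<le> ennreal (C\<^sup>2) * sqint \<mu> h" .
    obtain a where a: "sqint \<mu> h = ennreal a" "0 \<le> a"
      using h by (cases "sqint \<mu> h") (auto simp: L2_iff)
    have "sqint \<mu> (T h) \<le> ennreal ((C * sqrt a)\<^sup>2)"
      using le a by (simp add: power_mult_distrib ennreal_mult)
    then have "Lp_norm \<mu> 2 (T h) \<le> ennreal (C * sqrt a)"
      using C(1) a(2) by (simp add: Lp_norm_2_le_iff)
    also have "\<dots> = ennreal C * Lp_norm \<mu> 2 h"
      using C(1) a by (simp add: Lp_norm_2 enn_powr_ennreal powr_half_sqrt ennreal_mult)
    finally show "Lp_norm \<mu> 2 (T h) \<le> ennreal C * Lp_norm \<mu> 2 h" .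
  next
    fix h k a b assume hk: "h \<in> L2 \<mu>" "k \<in> L2 \<mu>"
    have hk': "(\<lambda>y. a * h y + b * k y) \<in> L2 \<mu>" by (intro L2_add L2_cmult hk)
    have "tm (\<lambda>y. a * h y + b * k y) = (\<lambda>n x. a * tm h n x + b * tm k n x)"
      unfolding tm_def[abs_def] laguerre_mode_def coefficient_linear[OF orth hk, folded coeff_def] by (simp add: algebra_simps)
    then have "has_L2_sum \<mu> (tm (\<lambda>y. a * h y + b * k y)) (\<lambda>x. a * R h x + b * R k x)"
      using has_L2_sum_linear[OF R[OF hk(1)] R[OF hk(2)] tm_meas tm_meas, of a b] by simp
    from has_L2_sum_unique[OF R[OF hk'] this tm_meas]
    have "AE x in laguerre_measure \<nu>. R (\<lambda>y. a * h y + b * k y) x = a * R h x + b * R k x"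
      unfolding \<mu>_def .
    moreover note borel[OF RL[OF hk'], measurable] borel[OF RL[OF hk(1)], measurable] borel[OF RL[OF hk(2)], measurable]
    ultimately show "AE x in \<mu>. T (\<lambda>y. a * h y + b * k y) x = a * T h x + b * T k x"
      unfolding T_def \<mu>_def
      by (intro AE_laguerre_dilation[OF \<nu> p, of "R (\<lambda>y. a * h y + b * k y)" "\<lambda>x. a * R h x + b * R k x"]) auto
  qed
  moreover have "AE x in \<mu>. T (\<lambda>y. of_real (poly (laguerre \<nu> n) y)) x =
        exp (2 * of_real pi * of_nat n * \<i> * of_real t) * of_real (poly (laguerre \<nu> n) (2 / p * x))" for n
  proof -
    let ?h = "\<lambda>y. complex_of_real (poly (laguerre \<nu> n) y)"
    let ?k = "\<lambda>y. exp (2 * of_real pi * of_nat n * \<i> * of_real t) * complex_of_real (poly (laguerre \<nu> n) y)"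
    have coef: "coeff ?h m = (if m = n then 1 else 0)" for m
      unfolding coeff_def using cpos[of n] by (intro coefficient_basis[OF orth]) auto
    have "tm ?h = (\<lambda>m y. if m = n then ?k y else 0)"
      unfolding tm_def[abs_def] laguerre_mode_def coef phase_exponent by (auto simp: fun_eq_iff)
    then have sums: "(\<Sum>m<N. tm ?h m y) = ?k y" if "N > n" for N y
      using that by simp
    have kL: "?k \<in> L2 \<mu>" by (intro L2_cmult basis_L2[OF orth])
    have "has_L2_sum \<mu> (tm ?h) ?k"
      unfolding has_L2_sum_def tendsto_Lp_norm_2_iff
    proof (intro conjI kL tendsto_eventually)
      show "\<forall>\<^sub>F N in sequentially. sqint \<mu> (\<lambda>x. (\<Sum>m<N. tm ?h m x) - ?k x) = 0"
        using eventually_gt_at_top[of n] by eventually_elim (simp add: sums sqint_def)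
    qed
    from has_L2_sum_unique[OF R[OF basis_L2[OF orth]] this tm_meas]
    have "AE x in laguerre_measure \<nu>. R ?h x = ?k x" unfolding \<mu>_def .
    then show ?thesis
      unfolding T_def \<mu>_def
      using borel[OF RL[OF basis_L2[OF orth]]] borel[OF kL]
      by (intro AE_laguerre_dilation[OF \<nu> p, of "R ?h" ?k]) auto
  qed
  ultimately show ?thesis unfolding is_laguerre_operator_def \<mu>_def by blast
qed

text \<open>
  Boundedness determines the operator on every function with a Laguerre expansion.
\<close>

lemma is_laguerre_operator_apply:
  assumes \<nu>: "\<nu> > -1" and p: "p \<ge> 2" and T: "is_laguerre_operator p \<nu> t T"
    and g: "has_L2_sum (laguerre_measure \<nu>) (\<lambda>n y. \<alpha> n * of_real (poly (laguerre \<nu> n) y)) g"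
    and G: "has_L2_sum (laguerre_measure \<nu>) (laguerre_mode \<nu> \<alpha> t) G"
  shows "AE x in laguerre_measure \<nu>. T g x = G (2 / p * x)"
proof -
  define \<mu> where "\<mu> = laguerre_measure \<nu>"
  note orth = orthogonal_laguerre[OF \<nu>, folded \<mu>_def]
  have T_L2: "T h \<in> L2 \<mu>" if "h \<in> L2 \<mu>" for h
    using T that unfolding is_laguerre_operator_def bounded_L2_operator_def \<mu>_def by blast
  have T_lin: "AE x in \<mu>. T (\<lambda>y. a * h y + b * k y) x = a * T h x + b * T k x" if "h \<in> L2 \<mu>" "k \<in> L2 \<mu>" for h k a b
    using T that unfolding is_laguerre_operator_def bounded_L2_operator_def \<mu>_def by blast
  have T_basis: "AE x in \<mu>. T (\<lambda>y. of_real (poly (laguerre \<nu> n) y)) x =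
        exp (\<i> * of_real (2 * pi * real n * t)) * of_real (poly (laguerre \<nu> n) (2 / p * x))" for n
    using T unfolding is_laguerre_operator_def \<mu>_def phase_exponent by blast
  obtain C where T_bound: "\<And>h. h \<in> L2 \<mu> \<Longrightarrow> Lp_norm \<mu> 2 (T h) \<le> ennreal C * Lp_norm \<mu> 2 h"
    using T unfolding is_laguerre_operator_def bounded_L2_operator_def \<mu>_def by blast
  have gL: "g \<in> L2 \<mu>" and GL: "G \<in> L2 \<mu>" using g G by (auto simp: has_L2_sum_def \<mu>_def)
  define S where "S N y = (\<Sum>n<N. \<alpha> n * of_real (poly (laguerre \<nu> n) y))" for N y
  have SL: "S N \<in> L2 \<mu>" for N unfolding S_def[abs_def] by (rule partial_sum_L2[OF orth])
  have TS: "AE x in \<mu>. T (S N) x = (\<Sum>n<N. laguerre_mode \<nu> \<alpha> t n (2 / p * x))" for N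
  proof (induction N)
    case 0
    have "S 0 = (\<lambda>y. 0 * S 0 y + 0 * S 0 y)" by (simp add: S_def[abs_def])
    then have "AE x in \<mu>. T (S 0) x = 0 * T (S 0) x + 0 * T (S 0) x"
      using T_lin[OF SL[of 0] SL[of 0], of 0 0] by simp
    then show ?case by simp
  next
    case (Suc N)
    have "S (Suc N) = (\<lambda>y. 1 * S N y + \<alpha> N * of_real (poly (laguerre \<nu> N) y))" by (simp add: S_def[abs_def])
    then have "AE x in \<mu>. T (S (Suc N)) x = 1 * T (S N) x + \<alpha> N * T (\<lambda>y. of_real (poly (laguerre \<nu> N) y)) x"
      using T_lin[OF SL[of N] basis_L2[OF orth, of N], of 1 "\<alpha> N"] by simp
    then show ?case
      using Suc.IH T_basis[of N]
      by eventually_elim (simp add: laguerre_mode_def mult.assoc)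
  qed
  have "has_L2_sum \<mu> (\<lambda>n x. laguerre_mode \<nu> \<alpha> t n (2 / p * x)) (T g)"
    unfolding has_L2_sum_def
  proof (intro conjI T_L2 gL)
    have "Lp_norm \<mu> 2 (\<lambda>x. (\<Sum>n<N. laguerre_mode \<nu> \<alpha> t n (2 / p * x)) - T g x) \<le> ennreal C * Lp_norm \<mu> 2 (\<lambda>x. S N x - g x)" for N
    proof -
      have "AE x in \<mu>. T (\<lambda>y. 1 * S N y + (-1) * g y) x = 1 * T (S N) x + (-1) * T g x"
        by (rule T_lin[OF SL gL])
      then have "AE x in \<mu>. (\<Sum>n<N. laguerre_mode \<nu> \<alpha> t n (2 / p * x)) - T g x = T (\<lambda>y. S N y - g y) x"
        using TS[of N] by eventually_elim simp
      then have "Lp_norm \<mu> 2 (\<lambda>x. (\<Sum>n<N. laguerre_mode \<nu> \<alpha> t n (2 / p * x)) - T g x) = Lp_norm \<mu> 2 (T (\<lambda>y. S N y - g y))"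
        unfolding Lp_norm_2 by (subst sqint_cong_AE) auto
      also have "\<dots> \<le> ennreal C * Lp_norm \<mu> 2 (\<lambda>x. S N x - g x)"
        by (rule T_bound[OF L2_diff[OF SL gL]])
      finally show ?thesis .
    qed
    moreover have "(\<lambda>N. ennreal C * Lp_norm \<mu> 2 (\<lambda>x. S N x - g x)) \<longlonglongrightarrow> ennreal C * 0"
      using g unfolding has_L2_sum_def \<mu>_def S_def by (intro tendsto_mult_ennreal tendsto_const) auto
    ultimately show "(\<lambda>N. Lp_norm \<mu> 2 (\<lambda>x. (\<Sum>n<N. laguerre_mode \<nu> \<alpha> t n (2 / p * x)) - T g x)) \<longlonglongrightarrow> 0"
      by - (rule tendsto_ennreal_0_le, assumption, assumption, simp)
  qed
  moreover have "has_L2_sum \<mu> (\<lambda>n x. laguerre_mode \<nu> \<alpha> t n (2 / p * x)) (\<lambda>x. G (2 / p * x))"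
    unfolding has_L2_sum_def tendsto_Lp_norm_2_iff
  proof
    show "(\<lambda>x. G (2 / p * x)) \<in> L2 \<mu>" using GL unfolding \<mu>_def by (rule L2_laguerre_dilation[OF \<nu> p])
    have [measurable]: "G \<in> borel_measurable borel"
      using L2_measurable[OF GL] by (simp add: \<mu>_def borel_measurable_laguerre_measure)
    have "sqint \<mu> (\<lambda>x. (\<Sum>n<N. laguerre_mode \<nu> \<alpha> t n (2 / p * x)) - G (2 / p * x)) \<le>
        ennreal ((p / 2) powr (\<nu> + 1)) * sqint \<mu> (\<lambda>y. (\<Sum>n<N. laguerre_mode \<nu> \<alpha> t n y) - G y)" for N
      unfolding \<mu>_def by (rule sqint_laguerre_dilation[OF \<nu> p]) measurable
    moreover have "(\<lambda>N. ennreal ((p / 2) powr (\<nu> + 1)) * sqint \<mu> (\<lambda>y. (\<Sum>n<N. laguerre_mode \<nu> \<alpha> t n y) - G y)) \<longlonglongrightarrow> ennreal ((p / 2) powr (\<nu> + 1)) * 0"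
      using G unfolding has_L2_sum_def \<mu>_def tendsto_Lp_norm_2_iff by (intro tendsto_mult_ennreal tendsto_const) auto
    ultimately show "(\<lambda>N. sqint \<mu> (\<lambda>x. (\<Sum>n<N. laguerre_mode \<nu> \<alpha> t n (2 / p * x)) - G (2 / p * x))) \<longlonglongrightarrow> 0"
      by - (rule tendsto_ennreal_0_le, assumption, assumption, simp)
  qed
  moreover have "(\<lambda>x. laguerre_mode \<nu> \<alpha> t n (2 / p * x)) \<in> borel_measurable \<mu>" for n
    by (simp add: \<mu>_def borel_measurable_laguerre_measure)
  ultimately show ?thesis unfolding \<mu>_def by (rule has_L2_sum_unique)
qed

section \<open>Space-time norms\<close>

text \<open>
  The function \<open>- lens_phase\<close> maps the line increasingly onto \<open>(-1/2, 1/2)\<close> with derivative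
  \<open>4 / lens_width\<close>. Substitution on the intervals \<open>[- n, n]\<close> and monotone convergence give the formula.
\<close>

lemma nn_integral_lens_phase:
  fixes W :: "real \<Rightarrow> ennreal"
  assumes W [measurable]: "W \<in> borel_measurable borel"
  shows "(\<integral>\<^sup>+t. ennreal (1 / lens_width t) * W (lens_phase t) \<partial>lborel) =
         ennreal (1 / 4) * (\<integral>\<^sup>+s. W s * indicator {-1/2..1/2} s \<partial>lborel)"
proof -
  define g where "g t = arctan (4 * pi * t) / pi" for t
  define V where "V x = W (- x)" for x
  have Vm [measurable]: "V \<in> borel_measurable borel" unfolding V_def by measurable
  have [measurable]: "lens_width \<in> borel_measurable borel" "lens_phase \<in> borel_measurable borel"
    by (intro borel_measurable_continuous_onI continuous_lens_data)+
  have gp: "lens_phase t = - g t" for t by (simp add: lens_phase_def g_def)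
  have [measurable]: "g \<in> borel_measurable borel"
  proof -
    have "g = (\<lambda>t. - lens_phase t)" by (simp add: gp)
    then show ?thesis by simp
  qed
  have g_mono: "g s \<le> g t" if "s \<le> t" for s t
    using that by (simp add: g_def divide_right_mono arctan_monotone')
  have gd: "(g has_real_derivative 4 / lens_width t) (at t)" for t
    using DERIV_minus[OF lens_phase_derivative[of t]] by (simp add: gp)
  have gc: "continuous_on S (\<lambda>t. 4 / lens_width t)" for S
    using lens_width_pos by (intro continuous_intros continuous_on_subset[OF continuous_lens_data(1)]) (auto simp: less_imp_neq[symmetric] intro: less_imp_neq)
  define A where "A n = {- real (Suc n)..real (Suc n)}" for n
  define B where "B n = {g (- real (Suc n))..g (real (Suc n))}" for n
  let ?M = "density lborel V" and ?N = "density lborel (\<lambda>t. V (g t) * ennreal (4 / lens_width t))"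
  have eq: "emeasure ?M (B n) = emeasure ?N (A n)" for n
  proof -
    have "emeasure ?M (B n) = (\<integral>\<^sup>+x. V x * indicator (B n) x \<partial>lborel)"
      by (rule emeasure_density) (auto simp: B_def)
    also have "\<dots> = (\<integral>\<^sup>+t. V (g t) * ennreal (4 / lens_width t) * indicator (A n) t \<partial>lborel)"
      unfolding A_def B_def
      by (rule nn_integral_substitution_aux[OF Vm _ gd gc]) (use lens_width_pos in \<open>auto intro: less_imp_le\<close>)
    also have "\<dots> = emeasure ?N (A n)"
      by (rule emeasure_density[symmetric]) (auto simp: A_def)
    finally show ?thesis .
  qed
  have "(SUP n. emeasure ?M (B n)) = emeasure ?M (\<Union>n. B n)"
    by (rule SUP_emeasure_incseq) (auto simp: B_def incseq_def intro: order_trans[OF g_mono] order_trans[OF _ g_mono])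
  moreover have "(SUP n. emeasure ?N (A n)) = emeasure ?N (\<Union>n. A n)"
    by (rule SUP_emeasure_incseq) (auto simp: A_def incseq_def)
  moreover have UA: "(\<Union>n. A n) = UNIV"
  proof -
    have "\<exists>n. t \<in> A n" for t
    proof -
      obtain n where "\<bar>t\<bar> \<le> real n" using real_arch_simple by blast
      then have "t \<in> A n" by (auto simp: A_def)
      then show ?thesis ..
    qed
    then show ?thesis by blast
  qed
  moreover have UB: "(\<Union>n. B n) = {-1/2<..<1/2}"
  proof (intro set_eqI iffI)
    fix x assume "x \<in> (\<Union>n. B n)"
    then obtain n where n: "g (- real (Suc n)) \<le> x" "x \<le> g (real (Suc n))" by (auto simp: B_def)
    have gb: "- 1 / 2 < g t" "g t < 1 / 2" for t
      using arctan_lbound[of "4 * pi * t"] arctan_ubound[of "4 * pi * t"] by (auto simp: g_def field_simps)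
    show "x \<in> {-1/2<..<1/2}"
      unfolding greaterThanLessThan_iff using less_le_trans[OF gb(1) n(1)] le_less_trans[OF n(2) gb(2)] by simp
  next
    fix x :: real assume x: "x \<in> {-1/2<..<1/2}"
    define t where "t = tan (pi * x) / (4 * pi)"
    have "- (pi / 2) < pi * x" "pi * x < pi / 2" using x mult_strict_left_mono[of "-1/2" x pi] mult_strict_left_mono[of x "1/2" pi] by auto
    then have "g t = x" by (simp add: g_def t_def arctan_tan)
    obtain n where "t \<in> A n" using UA by blast
    then have "x \<in> B n" unfolding \<open>g t = x\<close>[symmetric] A_def B_def by (auto intro: g_mono)
    then show "x \<in> (\<Union>n. B n)" by blast
  qed
  ultimately have "emeasure ?M {-1/2<..<1/2} = emeasure ?N UNIV" by (simp add: eq)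
  then have "(\<integral>\<^sup>+x. V x * indicator {-1/2<..<1/2} x \<partial>lborel) = (\<integral>\<^sup>+t. V (g t) * ennreal (4 / lens_width t) \<partial>lborel)"
    by (simp add: emeasure_density)
  also have "(\<integral>\<^sup>+t. V (g t) * ennreal (4 / lens_width t) \<partial>lborel) = (\<integral>\<^sup>+t. ennreal 4 * (ennreal (1 / lens_width t) * W (lens_phase t)) \<partial>lborel)"
  proof (intro nn_integral_cong)
    fix t
    have "ennreal (4 / lens_width t) = ennreal 4 * ennreal (1 / lens_width t)"
      using lens_width_pos[of t] by (subst ennreal_mult[symmetric]) (auto intro: less_imp_le)
    then show "V (g t) * ennreal (4 / lens_width t) = ennreal 4 * (ennreal (1 / lens_width t) * W (lens_phase t))"
      by (simp only: V_def gp mult_ac)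
  qed
  also have "\<dots> = ennreal 4 * (\<integral>\<^sup>+t. ennreal (1 / lens_width t) * W (lens_phase t) \<partial>lborel)"
    by (rule nn_integral_cmult) measurable
  finally have 1: "(\<integral>\<^sup>+x. V x * indicator {-1/2<..<1/2} x \<partial>lborel) = ennreal 4 * (\<integral>\<^sup>+t. ennreal (1 / lens_width t) * W (lens_phase t) \<partial>lborel)" .
  have "(\<integral>\<^sup>+x. V x * indicator {-1/2<..<1/2} x \<partial>lborel) = (\<integral>\<^sup>+x. W (0 + -1 * x) * indicator {-1/2..1/2} (0 + -1 * x) \<partial>lborel)"
  proof (rule nn_integral_cong_AE)
    show "AE x in lborel. V x * indicator {-1/2<..<1/2} x = W (0 + -1 * x) * indicator {-1/2..1/2} (0 + -1 * x)"
      using AE_lborel_singleton[of "1/2"] AE_lborel_singleton[of "-1/2"]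
      by eventually_elim (auto simp: V_def indicator_def)
  qed
  also have "\<dots> = (\<integral>\<^sup>+x. W x * indicator {-1/2..1/2} x \<partial>lborel)"
    using nn_integral_real_affine[of "\<lambda>x. W x * indicator {-1/2..1/2} x" "-1" 0] by simp
  finally have 2: "(\<integral>\<^sup>+x. W x * indicator {-1/2..1/2} x \<partial>lborel) = ennreal 4 * (\<integral>\<^sup>+t. ennreal (1 / lens_width t) * W (lens_phase t) \<partial>lborel)"
    using 1 by simp
  have "ennreal (1 / 4) * ennreal 4 = 1" by (subst ennreal_mult[symmetric]) auto
  then show ?thesis unfolding 2 mult.assoc[symmetric] by simp
qed

theorem theorem5:
  fixes f :: "real ^ 'n \<Rightarrow> complex"
    and g :: "real \<Rightarrow> complex"
    and \<alpha> :: "nat \<Rightarrow> complex"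
    and p q \<nu> :: real
    and d :: nat
  assumes d: "d = CARD('n)"
    and nu: "\<nu> = real d / 2 - 1"
    and p: "2 \<le> p" and q: "2 \<le> q"
    and pq: "real d / p + 2 / q = real d / 2"
    and f: "f \<in> L2 lborel" "radial f"
    and f_expansion: "has_L2_sum lborel (\<lambda>n x. \<alpha> n * radial_basis n x) f"
    and g: "g = L2_suminf (laguerre_measure \<nu>) (\<lambda>n x. \<alpha> n * of_real (poly (laguerre \<nu> n) x))"
  shows "Lp_enorm lborel q (\<lambda>t. Lp_norm lborel p (schroedinger f t)) /
           ennreal ((p powr (- (1 / (2 * p))) * 2 powr (1 / p - 1 / 2)) ^ d) =
         enn_powr
           (\<integral>\<^sup>+t\<in>{-1/2..1/2}.
              enn_powr
                (\<integral>\<^sup>+x. ennreal (cmod (laguerre_operator p \<nu> t g x) powr p) \<partial>laguerre_measure \<nu>)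
                (q / p) \<partial>lborel)
           (1 / q)
         \<and>
         ennreal (strichartz_const p d / (p powr (- (1 / (2 * p))) * 2 powr (1 / p - 1 / 2)) ^ d) *
           Lp_norm lborel 2 f =
         enn_powr (\<integral>\<^sup>+x. ennreal ((cmod (g x))\<^sup>2) \<partial>laguerre_measure \<nu>) (1 / 2)"
proof -
  define D where "D = real d"
  have dim: "real DIM(real ^ 'n) = D" by (simp add: D_def d)
  have \<nu>dim: "\<nu> = real DIM(real ^ 'n) / 2 - 1" unfolding dim nu D_def ..
  have \<nu>D: "\<nu> = D / 2 - 1" by (simp add: nu D_def)
  have "d > 0" by (simp add: d)
  then have Dpos: "D > 0" by (simp add: D_def)
  then have \<nu>: "\<nu> > -1" by (simp add: \<nu>D)
  have ppos: "p > 0" and qpos: "q > 0" using p q by auto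
  define \<mu> where "\<mu> = laguerre_measure \<nu>"
  have sm: "summable (\<lambda>n. (cmod (\<alpha> n))\<^sup>2 * laguerre_norm \<nu> n)"
    unfolding \<nu>dim by (rule radial_coefficients_summable[OF f_expansion])
  obtain G :: "real \<Rightarrow> real \<Rightarrow> complex" and e :: "nat \<Rightarrow> real" where
    Gm: "(\<lambda>(s, y). G s y) \<in> borel_measurable (borel \<Otimes>\<^sub>M borel)"
    and G: "\<And>s. has_L2_sum (laguerre_measure \<nu>) (laguerre_mode \<nu> \<alpha> s) (G s)"
    and Ge: "\<And>s N. sqint (laguerre_measure \<nu>) (\<lambda>y. G s y - (\<Sum>n<N. laguerre_mode \<nu> \<alpha> s n y)) \<le> ennreal (e N)"
    and e0: "e \<longlonglongrightarrow> 0"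
    using laguerre_flow[OF \<nu> sm] by blast
  have GL: "G s \<in> L2 \<mu>" for s using G by (simp add: has_L2_sum_def \<mu>_def)
  have Gborel [measurable]: "G s \<in> borel_measurable borel" for s
    using L2_measurable[OF GL[of s]] by (simp add: \<mu>_def borel_measurable_laguerre_measure)
  have sol: "is_schroedinger_solution f (\<lambda>t. lens t (G (lens_phase t)))"
    by (rule lens_flow_solution[OF f_expansion Gm G[unfolded \<nu>dim] Ge[unfolded \<nu>dim] e0])
  then have "is_schroedinger_solution f (schroedinger f)"
    unfolding schroedinger_def by (rule someI[where P = "is_schroedinger_solution f"])
  then have schr: "AE x in lborel. schroedinger f t x = lens t (G (lens_phase t)) x" for t
    by (rule schroedinger_solution_unique[OF _ sol])
  have mode0: "laguerre_mode \<nu> \<alpha> 0 = (\<lambda>n x. \<alpha> n * of_real (poly (laguerre \<nu> n) x))"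
    by (simp add: laguerre_mode_def[abs_def])
  have G0: "has_L2_sum \<mu> (\<lambda>n x. \<alpha> n * of_real (poly (laguerre \<nu> n) x)) (G 0)"
    using G[of 0] unfolding mode0 \<mu>_def .
  have gsum: "has_L2_sum \<mu> (\<lambda>n x. \<alpha> n * of_real (poly (laguerre \<nu> n) x)) g"
    unfolding g L2_suminf_def \<mu>_def[symmetric]
    by (rule someI[where P = "has_L2_sum \<mu> (\<lambda>n x. \<alpha> n * of_real (poly (laguerre \<nu> n) x))", OF G0])
  define A where "A = (p powr (- (1 / (2 * p))) * 2 powr (1 / p - 1 / 2)) ^ d"
  have A: "A > 0" using ppos by (simp add: A_def)
  have A_eq: "A = p powr (- D / (2 * p)) * 2 powr (D / p - D / 2)"
  proof -
    have "(p powr (- (1 / (2 * p)))) ^ d = p powr (- D / (2 * p))"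
      using ppos by (simp add: powr_power D_def)
    moreover have "(2 powr (1 / p - 1 / 2)) ^ d = 2 powr (D / p - D / 2)"
      by (simp add: powr_power D_def algebra_simps)
    ultimately show ?thesis by (simp only: A_def power_mult_distrib)
  qed

  define I where "I s = (\<integral>\<^sup>+x. ennreal (cmod (G s (2 / p * x)) powr p) \<partial>\<mu>)" for s
  define W where "W s = enn_powr (I s) (q / p)" for s
  have I_op: "I s = (\<integral>\<^sup>+x. ennreal (cmod (laguerre_operator p \<nu> s g x) powr p) \<partial>\<mu>)" for s
  proof -
    have T: "is_laguerre_operator p \<nu> s (laguerre_operator p \<nu> s)"
      unfolding laguerre_operator_def by (rule someI_ex[OF is_laguerre_operator_exists[OF \<nu> p]])
    have "AE x in \<mu>. laguerre_operator p \<nu> s g x = G s (2 / p * x)"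
      unfolding \<mu>_def by (rule is_laguerre_operator_apply[OF \<nu> p T gsum[unfolded \<mu>_def] G])
    then show ?thesis
      unfolding I_def by (intro nn_integral_cong_AE) auto
  qed
  \<comment> \<open>Joint measurability of \<open>G\<close> gives measurability in time.\<close>
  have I_meas: "I \<in> borel_measurable borel"
  proof -
    have "(\<lambda>z. (fst z, 2 / p * snd z)) \<in> borel \<Otimes>\<^sub>M lborel \<rightarrow>\<^sub>M borel \<Otimes>\<^sub>M borel" by measurable
    from measurable_compose[OF this Gm]
    have [measurable]: "(\<lambda>z. G (fst z) (2 / p * snd z)) \<in> borel_measurable (borel \<Otimes>\<^sub>M lborel)" by simp
    have "(\<lambda>s. \<integral>\<^sup>+x. (ennreal (gamma_weight \<nu> x / Gamma (\<nu> + 1)) * ennreal (cmod (G s (2 / p * x)) powr p)) \<partial>lborel) \<in> borel_measurable borel"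
      by (rule lborel.borel_measurable_nn_integral) (simp only: case_prod_unfold, measurable)
    moreover have "I s = (\<integral>\<^sup>+x. (ennreal (gamma_weight \<nu> x / Gamma (\<nu> + 1)) * ennreal (cmod (G s (2 / p * x)) powr p)) \<partial>lborel)" for s
      unfolding I_def \<mu>_def by (rule nn_integral_laguerre_measure) measurable
    ultimately show ?thesis by (simp cong: measurable_cong)
  qed
  have W_meas: "W \<in> borel_measurable borel"
    unfolding W_def using I_meas by measurable

  define K where "K = p powr (- D * q / (2 * p))"
  have K: "K > 0" using ppos by (simp add: K_def)
  have slice: "enn_powr (Lp_norm lborel p (schroedinger f t)) q = ennreal K * (ennreal (1 / lens_width t) * W (lens_phase t))" for t
  proof -
    let ?\<sigma> = "lens_width t"
    have \<sigma>: "?\<sigma> > 0" by (rule lens_width_pos)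
    let ?c = "p powr (- D / 2) * ?\<sigma> powr (D / 2 - D * p / 4)"
    have c: "?c > 0" using ppos \<sigma> by simp
    have "(\<integral>\<^sup>+x. ennreal (cmod (schroedinger f t x) powr p) \<partial>lborel) =
          (\<integral>\<^sup>+x. ennreal (cmod (lens t (G (lens_phase t)) (x :: real ^ 'n)) powr p) \<partial>lborel)"
      using schr[of t] by (intro nn_integral_cong_AE) auto
    also have "\<dots> = ennreal ?c * I (lens_phase t)"
      unfolding I_def \<mu>_def \<nu>D using nn_integral_lens[OF ppos Gborel[of "lens_phase t"], of t, where 'a = "real ^ 'n"]
      unfolding dim .
    finally have norm: "Lp_norm lborel p (schroedinger f t) = enn_powr (ennreal ?c * I (lens_phase t)) (1 / p)"
      by (simp add: Lp_norm_def Lp_enorm_def enn_powr_ennreal)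
    \<comment> \<open>This is the admissibility relation.\<close>
    have exps: "(D / 2 - D * p / 4) * (q / p) = -1"
    proof -
      have "(D / 2 - D * p / 4) * (q / p) = - (q / 2) * (D / 2 - D / p)"
        using ppos by (simp add: field_simps)
      also have "D / 2 - D / p = 2 / q" using pq by (simp add: D_def)
      finally show ?thesis using qpos by simp
    qed
    have "?c powr (q / p) = (p powr (- D / 2)) powr (q / p) * (?\<sigma> powr (D / 2 - D * p / 4)) powr (q / p)"
      by (rule powr_mult)
    also have "(p powr (- D / 2)) powr (q / p) = K"
      unfolding K_def powr_powr by (simp add: mult.commute)
    also have "(?\<sigma> powr (D / 2 - D * p / 4)) powr (q / p) = 1 / ?\<sigma>"
      unfolding powr_powr exps using \<sigma> by (simp add: powr_minus_divide)
    finally have cp: "?c powr (q / p) = K * (1 / ?\<sigma>)" .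
    have "enn_powr (Lp_norm lborel p (schroedinger f t)) q = enn_powr (ennreal ?c * I (lens_phase t)) (q / p)"
      unfolding norm enn_powr_enn_powr by simp
    also have "\<dots> = ennreal (?c powr (q / p)) * W (lens_phase t)"
      unfolding W_def by (rule enn_powr_cmult[OF c])
    also have "ennreal (?c powr (q / p)) = ennreal K * ennreal (1 / ?\<sigma>)"
      unfolding cp using K \<sigma> by (intro ennreal_mult) auto
    finally show ?thesis by (simp only: mult.assoc)
  qed
  let ?J = "\<integral>\<^sup>+s. W s * indicator {-1/2..1/2} s \<partial>lborel"
  have "(\<integral>\<^sup>+t. enn_powr (Lp_norm lborel p (schroedinger f t)) q \<partial>lborel) = ennreal K * (ennreal (1 / 4) * ?J)"
  proof -
    note [measurable] = W_meas borel_measurable_continuous_onI[OF continuous_lens_data(1)] borel_measurable_continuous_onI[OF continuous_lens_data(2)]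
    have "(\<integral>\<^sup>+t. enn_powr (Lp_norm lborel p (schroedinger f t)) q \<partial>lborel) =
          ennreal K * (\<integral>\<^sup>+t. ennreal (1 / lens_width t) * W (lens_phase t) \<partial>lborel)"
      unfolding slice by (rule nn_integral_cmult) measurable
    then show ?thesis unfolding nn_integral_lens_phase[OF W_meas] .
  qed
  also have "\<dots> = ennreal (K / 4) * ?J"
    using K by (simp add: mult.assoc[symmetric] ennreal_mult[symmetric])
  finally have "Lp_enorm lborel q (\<lambda>t. Lp_norm lborel p (schroedinger f t)) = ennreal ((K / 4) powr (1 / q)) * enn_powr ?J (1 / q)"
    using K by (simp add: Lp_enorm_def enn_powr_cmult)
  also have "(K / 4) powr (1 / q) = A"
  proof -
    have "(K / 4) powr (1 / q) = K powr (1 / q) / 4 powr (1 / q)" by (rule powr_divide)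
    also have "K powr (1 / q) = p powr (- D / (2 * p))"
      unfolding K_def powr_powr using qpos by (simp add: field_simps)
    also have "4 powr (1 / q) = (2 powr 2) powr (1 / q)" by simp
    also have "(2 powr 2) powr (1 / q) = 2 powr (2 / q)" by (simp only: powr_powr) simp
    also have "2 / q = D / 2 - D / p" using pq by (simp add: D_def)
    also have "p powr (- D / (2 * p)) / 2 powr (D / 2 - D / p) = A"
      unfolding A_eq by (simp add: powr_diff)
    finally show ?thesis .
  qed
  finally have "Lp_enorm lborel q (\<lambda>t. Lp_norm lborel p (schroedinger f t)) / ennreal A = enn_powr ?J (1 / q)"
    using A by (simp add: mult.commute[of "ennreal A"] mult_divide_eq_ennreal)
  moreover have "ennreal (strichartz_const p d / A) * Lp_norm lborel 2 f = enn_powr (\<integral>\<^sup>+x. ennreal ((cmod (g x))\<^sup>2) \<partial>\<mu>) (1 / 2)"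
  proof -
    have "AE x in lborel. lens 0 (G (lens_phase 0)) x = f x"
      using sol by (simp add: is_schroedinger_solution_def)
    then have "sqint lborel f = sqint lborel (lens 0 (G (lens_phase 0)) :: real ^ 'n \<Rightarrow> complex)"
      by (intro sqint_cong_AE) auto
    also have "\<dots> = ennreal (2 powr (- D / 2)) * sqint \<mu> (G 0)"
      unfolding lens_phase_0 \<mu>_def \<nu>D using sqint_lens[OF Gborel[of 0], of 0, where 'a = "real ^ 'n"] unfolding dim .
    also have "sqint \<mu> (G 0) = sqint \<mu> g"
    proof (intro sqint_cong_AE has_L2_sum_unique[OF G0 gsum])
      show "(\<lambda>x. \<alpha> n * of_real (poly (laguerre \<nu> n) x)) \<in> borel_measurable \<mu>" for n
        by (simp add: \<mu>_def borel_measurable_laguerre_measure)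
    qed
    finally have "Lp_norm lborel 2 f = ennreal ((2 powr (- D / 2)) powr (1 / 2)) * enn_powr (sqint \<mu> g) (1 / 2)"
      unfolding Lp_norm_2 by (simp only:) (rule enn_powr_cmult, simp)
    also have "(2 powr (- D / 2)) powr (1 / 2) = 2 powr (- D / 4)" unfolding powr_powr by simp
    finally have norm: "Lp_norm lborel 2 f = ennreal (2 powr (- D / 4)) * enn_powr (sqint \<mu> g) (1 / 2)" .
    have "strichartz_const p d = p powr (- D / (2 * p)) * 2 powr (D / p - D / 4)"
    proof -
      have "(p powr (- (1 / (2 * p)))) ^ d = p powr (- D / (2 * p))"
        using ppos by (simp add: powr_power D_def)
      moreover have "(2 powr (1 / p - 1 / 4)) ^ d = 2 powr (D / p - D / 4)"
        by (simp add: powr_power D_def algebra_simps)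
      ultimately show ?thesis by (simp only: strichartz_const_def power_mult_distrib)
    qed
    then have "strichartz_const p d / A = 2 powr (D / p - D / 4) / 2 powr (D / p - D / 2)"
      unfolding A_eq using ppos by simp
    also have "\<dots> = 2 powr (D / 4)" by (simp add: powr_diff[symmetric])
    finally have ratio: "strichartz_const p d / A = 2 powr (D / 4)" .
    have "ennreal (2 powr (D / 4)) * ennreal (2 powr (- D / 4)) = 1"
      by (subst ennreal_mult[symmetric]) (auto simp: powr_add[symmetric])
    then show ?thesis unfolding ratio norm mult.assoc[symmetric] by (simp add: sqint_def)
  qed
  ultimately show ?thesis
    unfolding A_def W_def I_op \<mu>_def by blast
qed

end
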